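(* Let $\mathbb{M}$ be a monster model of a complete $C$-minimal expansion of ACVF whose language contains a constant symbol $t$ with $v(t)>0$, and suppose $\mathbb{M}$ is definably complete. Let $f:\mathbb{M}^\times\to\mathbb{M}^\times$ be definable. Then there are a definable multiplicative endomorphism $g:\mathbb{M}^\times\to\mathbb{M}^\times$ and a constant $c\in\mathbb{M}^\times$ such that $\lim_{x\to0}f(x)/g(x)=c$.
   Context: ACVF is the theory of algebraically closed non-trivially valued fields; $C$-minimal means every definable subset of the home sort is a finite boolean combination of balls and points. "Definable" means with parameters; limits in the valuation topology. $\mathbb{M}$ is definably complete if every definable chain of balls whose radii approach $+\infty$ has non-empty intersection. *)

theory Defs
  imports "HOL-Analysis.Abstract_Limits" "HOL-Algebra.Algebraic_Closure"
begin

unbundle cardinal_syntax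

section \<open>First-order logic\<close>

datatype 'f fo_term = Var nat | App 'f "'f fo_term list"

datatype ('f, 'r) fo_form =
    Equal "'f fo_term" "'f fo_term"
  | Rel 'r "'f fo_term list"
  | Neg "('f, 'r) fo_form"
  | Conj "('f, 'r) fo_form" "('f, 'r) fo_form"
  | Exists nat "('f, 'r) fo_form"

text \<open>Every element of \<open>'f\<close> is a function symbol and every element of \<open>'r\<close> a relation symbol;
  constant symbols are function symbols of arity 0.\<close>

record ('f, 'r) signature =
  fun_ar :: "'f \<Rightarrow> nat"
  rel_ar :: "'r \<Rightarrow> nat"

text \<open>The universe of a structure is the whole type \<open>'a\<close>. Interpretations matter only on argument
  lists whose length is the arity of the symbol.\<close>

record ('f, 'r, 'a) fo_struct =
  fun_int :: "'f \<Rightarrow> 'a list \<Rightarrow> 'a"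
  rel_int :: "'r \<Rightarrow> 'a list \<Rightarrow> bool"

primrec term_vars :: "'f fo_term \<Rightarrow> nat set" where
  "term_vars (Var i) = {i}"
| "term_vars (App f ts) = \<Union> (set (map term_vars ts))"

primrec free_vars :: "('f, 'r) fo_form \<Rightarrow> nat set" where
  "free_vars (Equal s u) = term_vars s \<union> term_vars u"
| "free_vars (Rel r ts) = \<Union> (set (map term_vars ts))"
| "free_vars (Neg \<phi>) = free_vars \<phi>"
| "free_vars (Conj \<phi> \<psi>) = free_vars \<phi> \<union> free_vars \<psi>"
| "free_vars (Exists i \<phi>) = free_vars \<phi> - {i}"

primrec wf_term :: "('f, 'r, 'm) signature_scheme \<Rightarrow> 'f fo_term \<Rightarrow> bool" where
  "wf_term L (Var i) \<longleftrightarrow> True"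
| "wf_term L (App f ts) \<longleftrightarrow> length ts = fun_ar L f \<and> list_all (wf_term L) ts"

primrec wf_form :: "('f, 'r, 'm) signature_scheme \<Rightarrow> ('f, 'r) fo_form \<Rightarrow> bool" where
  "wf_form L (Equal s u) \<longleftrightarrow> wf_term L s \<and> wf_term L u"
| "wf_form L (Rel r ts) \<longleftrightarrow> length ts = rel_ar L r \<and> list_all (wf_term L) ts"
| "wf_form L (Neg \<phi>) \<longleftrightarrow> wf_form L \<phi>"
| "wf_form L (Conj \<phi> \<psi>) \<longleftrightarrow> wf_form L \<phi> \<and> wf_form L \<psi>"
| "wf_form L (Exists i \<phi>) \<longleftrightarrow> wf_form L \<phi>"

primrec term_val :: "('f, 'r, 'a) fo_struct \<Rightarrow> (nat \<Rightarrow> 'a) \<Rightarrow> 'f fo_term \<Rightarrow> 'a" where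
  "term_val M e (Var i) = e i"
| "term_val M e (App f ts) = fun_int M f (map (term_val M e) ts)"

primrec sat :: "('f, 'r, 'a) fo_struct \<Rightarrow> (nat \<Rightarrow> 'a) \<Rightarrow> ('f, 'r) fo_form \<Rightarrow> bool" where
  "sat M e (Equal s u) \<longleftrightarrow> term_val M e s = term_val M e u"
| "sat M e (Rel r ts) \<longleftrightarrow> rel_int M r (map (term_val M e) ts)"
| "sat M e (Neg \<phi>) \<longleftrightarrow> \<not> sat M e \<phi>"
| "sat M e (Conj \<phi> \<psi>) \<longleftrightarrow> sat M e \<phi> \<and> sat M e \<psi>"
| "sat M e (Exists i \<phi>) \<longleftrightarrow> (\<exists>a. sat M (e(i := a)) \<phi>)"

definition sentence :: "('f, 'r, 'm) signature_scheme \<Rightarrow> ('f, 'r) fo_form \<Rightarrow> bool" where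
  "sentence L \<phi> \<longleftrightarrow> wf_form L \<phi> \<and> free_vars \<phi> = {}"

definition models :: "('f, 'r, 'a) fo_struct \<Rightarrow> ('f, 'r) fo_form set \<Rightarrow> bool" (infix \<open>\<Turnstile>\<close> 50) where
  "M \<Turnstile> T \<longleftrightarrow> (\<forall>\<phi>\<in>T. \<forall>e. sat M e \<phi>)"

text \<open>HOL cannot quantify over the type of the universe, so models of a theory range over the
  structures on a given type \<open>'a\<close>. By the Loewenheim-Skolem theorem this is no restriction for a
  theory without finite models as soon as \<open>'a\<close> is infinite and at least as large as the language.\<close>

definition complete_theory ::
    "'a itself \<Rightarrow> ('f, 'r, 'm) signature_scheme \<Rightarrow> ('f, 'r) fo_form set \<Rightarrow> bool" where
  "complete_theory (A :: 'a itself) L T \<longleftrightarrow>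
     (\<forall>\<phi>\<in>T. sentence L \<phi>) \<and>
     (\<exists>N :: ('f, 'r, 'a) fo_struct. N \<Turnstile> T) \<and>
     (\<forall>\<phi>. sentence L \<phi> \<longrightarrow>
        (\<forall>N :: ('f, 'r, 'a) fo_struct. N \<Turnstile> T \<longrightarrow> N \<Turnstile> {\<phi>}) \<or>
        (\<forall>N :: ('f, 'r, 'a) fo_struct. N \<Turnstile> T \<longrightarrow> N \<Turnstile> {Neg \<phi>}))"

text \<open>\<open>S\<close> is a subset of the \<open>n\<close>-th power of the universe (\<open>n\<close>-tuples are lists of length \<open>n\<close>)
  that is definable with parameters from \<open>A\<close>: the variables \<open>0, \<dots>, n - 1\<close> stand for the
  coordinates, the following ones for the parameters \<open>ps\<close>.\<close>

definition definable_over ::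
    "('f, 'r, 'm) signature_scheme \<Rightarrow> ('f, 'r, 'a) fo_struct \<Rightarrow> 'a set \<Rightarrow> nat \<Rightarrow> 'a list set \<Rightarrow> bool" where
  "definable_over L M A n S \<longleftrightarrow>
     (\<exists>\<phi> ps. wf_form L \<phi> \<and> free_vars \<phi> \<subseteq> {..<n + length ps} \<and> set ps \<subseteq> A \<and>
        S = {xs. length xs = n \<and> sat M (\<lambda>i. (xs @ ps) ! i) \<phi>})"

abbreviation definable ::
    "('f, 'r, 'm) signature_scheme \<Rightarrow> ('f, 'r, 'a) fo_struct \<Rightarrow> nat \<Rightarrow> 'a list set \<Rightarrow> bool" where
  "definable L M \<equiv> definable_over L M UNIV"

section \<open>Monster models\<close>

text \<open>A complete 1-type over \<open>A\<close> is identified with the family of the sets defined by its formulas.\<close>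

definition saturated ::
    "('f, 'r, 'm) signature_scheme \<Rightarrow> 'a rel \<Rightarrow> ('f, 'r, 'a) fo_struct \<Rightarrow> bool" where
  "saturated L \<kappa> M \<longleftrightarrow>
     (\<forall>A. |A| <o \<kappa> \<longrightarrow>
       (\<forall>\<F>. (\<forall>S\<in>\<F>. definable_over L M A 1 ((\<lambda>x. [x]) ` S)) \<and>
            (\<forall>\<F>\<^sub>0. finite \<F>\<^sub>0 \<and> \<F>\<^sub>0 \<subseteq> \<F> \<longrightarrow> \<Inter>\<F>\<^sub>0 \<noteq> {}) \<longrightarrow>
          \<Inter>\<F> \<noteq> {}))"

definition partial_elementary ::
    "('f, 'r, 'm) signature_scheme \<Rightarrow> ('f, 'r, 'a) fo_struct \<Rightarrow> 'a set \<Rightarrow> ('a \<Rightarrow> 'a) \<Rightarrow> bool" where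
  "partial_elementary L M A h \<longleftrightarrow>
     (\<forall>\<phi> e. wf_form L \<phi> \<and> e ` free_vars \<phi> \<subseteq> A \<longrightarrow> (sat M e \<phi> \<longleftrightarrow> sat M (h \<circ> e) \<phi>))"

definition automorphism ::
    "('f, 'r, 'm) signature_scheme \<Rightarrow> ('f, 'r, 'a) fo_struct \<Rightarrow> ('a \<Rightarrow> 'a) \<Rightarrow> bool" where
  "automorphism L M \<sigma> \<longleftrightarrow> bij \<sigma> \<and>
     (\<forall>f xs. length xs = fun_ar L f \<longrightarrow> \<sigma> (fun_int M f xs) = fun_int M f (map \<sigma> xs)) \<and>
     (\<forall>r xs. length xs = rel_ar L r \<longrightarrow> (rel_int M r xs \<longleftrightarrow> rel_int M r (map \<sigma> xs)))"

definition strongly_homogeneous ::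
    "('f, 'r, 'm) signature_scheme \<Rightarrow> 'a rel \<Rightarrow> ('f, 'r, 'a) fo_struct \<Rightarrow> bool" where
  "strongly_homogeneous L \<kappa> M \<longleftrightarrow>
     (\<forall>A h. |A| <o \<kappa> \<and> partial_elementary L M A h \<longrightarrow>
        (\<exists>\<sigma>. automorphism L M \<sigma> \<and> (\<forall>a\<in>A. \<sigma> a = h a)))"

text \<open>An infinite \<open>\<kappa>\<close>-saturated structure has at least \<open>\<kappa>\<close> elements, so \<open>\<kappa>\<close> can be taken on the
  type \<open>'a\<close>.\<close>

definition monster ::
    "('f, 'r, 'm) signature_scheme \<Rightarrow> ('f, 'r, 'a) fo_struct \<Rightarrow> bool" where
  "monster L (M :: ('f, 'r, 'a) fo_struct) \<longleftrightarrow>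
     (\<exists>\<kappa> :: 'a rel. Card_order \<kappa> \<and> natLeq <o \<kappa> \<and>
        |UNIV :: 'f set| <o \<kappa> \<and> |UNIV :: 'r set| <o \<kappa> \<and>
        saturated L \<kappa> M \<and> strongly_homogeneous L \<kappa> M)"

section \<open>Valued fields\<close>

text \<open>A language containing that of valued fields: the ring symbols \<open>0, 1, +, \<cdot>\<close> and the binary
  divisibility predicate \<open>v(x) \<le> v(y)\<close>.\<close>

record ('f, 'r) vf_signature = "('f, 'r) signature" +
  zero_sym :: 'f
  one_sym :: 'f
  add_sym :: 'f
  mul_sym :: 'f
  div_sym :: 'r

definition contains_vf_language :: "('f, 'r) vf_signature \<Rightarrow> bool" where
  "contains_vf_language L \<longleftrightarrow>
     fun_ar L (zero_sym L) = 0 \<and> fun_ar L (one_sym L) = 0 \<and>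
     fun_ar L (add_sym L) = 2 \<and> fun_ar L (mul_sym L) = 2 \<and> rel_ar L (div_sym L) = 2"

definition field_of :: "('f, 'r) vf_signature \<Rightarrow> ('f, 'r, 'a) fo_struct \<Rightarrow> 'a ring" where
  "field_of L M =
     \<lparr>carrier = UNIV,
      monoid.mult = (\<lambda>x y. fun_int M (mul_sym L) [x, y]), one = fun_int M (one_sym L) [],
      zero = fun_int M (zero_sym L) [], add = (\<lambda>x y. fun_int M (add_sym L) [x, y])\<rparr>"

abbreviation mult_group :: "('f, 'r) vf_signature \<Rightarrow> ('f, 'r, 'a) fo_struct \<Rightarrow> 'a monoid" where
  "mult_group L M \<equiv> Ring_Divisibility.mult_of (field_of L M)"

text \<open>\<open>v(x) \<le> v(y)\<close> and \<open>v(x) < v(y)\<close>, where \<open>v(0) = \<infinity>\<close>. The value group is the quotient of the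
  multiplicative group by the units of the valuation ring, so its elements are written \<open>v(c)\<close> with
  \<open>c \<noteq> 0\<close>.\<close>

definition val_le :: "('f, 'r) vf_signature \<Rightarrow> ('f, 'r, 'a) fo_struct \<Rightarrow> 'a \<Rightarrow> 'a \<Rightarrow> bool" where
  "val_le L M x y \<longleftrightarrow> rel_int M (div_sym L) [x, y]"

definition val_less :: "('f, 'r) vf_signature \<Rightarrow> ('f, 'r, 'a) fo_struct \<Rightarrow> 'a \<Rightarrow> 'a \<Rightarrow> bool" where
  "val_less L M x y \<longleftrightarrow> \<not> val_le L M y x"

definition is_ACVF :: "('f, 'r) vf_signature \<Rightarrow> ('f, 'r, 'a) fo_struct \<Rightarrow> bool" where
  "is_ACVF L M \<longleftrightarrow>
     (let K = field_of L M in
        algebraically_closed K \<and>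
        (\<forall>x y. val_le L M x y \<or> val_le L M y x) \<and>
        (\<forall>x y z. val_le L M x y \<and> val_le L M y z \<longrightarrow> val_le L M x z) \<and>
        (\<forall>x y z. val_le L M x y \<longrightarrow> val_le L M (x \<otimes>\<^bsub>K\<^esub> z) (y \<otimes>\<^bsub>K\<^esub> z)) \<and>
        (\<forall>x y z. val_le L M z x \<and> val_le L M z y \<longrightarrow> val_le L M z (x \<oplus>\<^bsub>K\<^esub> y)) \<and>
        val_less L M \<one>\<^bsub>K\<^esub> \<zero>\<^bsub>K\<^esub> \<and>
        (\<exists>x. x \<noteq> \<zero>\<^bsub>K\<^esub> \<and> val_less L M \<one>\<^bsub>K\<^esub> x))"

text \<open>The closed and open ball of centre \<open>a\<close> and radius \<open>v(c)\<close>.\<close>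

definition closed_ball :: "('f, 'r) vf_signature \<Rightarrow> ('f, 'r, 'a) fo_struct \<Rightarrow> 'a \<Rightarrow> 'a \<Rightarrow> 'a set" where
  "closed_ball L M a c = {x. val_le L M c (x \<ominus>\<^bsub>field_of L M\<^esub> a)}"

definition open_ball :: "('f, 'r) vf_signature \<Rightarrow> ('f, 'r, 'a) fo_struct \<Rightarrow> 'a \<Rightarrow> 'a \<Rightarrow> 'a set" where
  "open_ball L M a c = {x. val_less L M c (x \<ominus>\<^bsub>field_of L M\<^esub> a)}"

text \<open>In a model of ACVF the value group is dense without endpoints, so the radius of a ball is
  determined by the ball.\<close>

definition has_radius :: "('f, 'r) vf_signature \<Rightarrow> ('f, 'r, 'a) fo_struct \<Rightarrow> 'a set \<Rightarrow> 'a \<Rightarrow> bool" where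
  "has_radius L M B c \<longleftrightarrow>
     c \<noteq> \<zero>\<^bsub>field_of L M\<^esub> \<and> (\<exists>a. B = closed_ball L M a c \<or> B = open_ball L M a c)"

definition is_ball :: "('f, 'r) vf_signature \<Rightarrow> ('f, 'r, 'a) fo_struct \<Rightarrow> 'a set \<Rightarrow> bool" where
  "is_ball L M B \<longleftrightarrow> (\<exists>c. has_radius L M B c)"

definition valuation_topology :: "('f, 'r) vf_signature \<Rightarrow> ('f, 'r, 'a) fo_struct \<Rightarrow> 'a topology" where
  "valuation_topology L M =
     topology_generated_by {open_ball L M a c | a c. c \<noteq> \<zero>\<^bsub>field_of L M\<^esub>}"

section \<open>C-minimality and definable completeness\<close>

inductive_set boolean_combinations :: "'a set set \<Rightarrow> 'a set set" for E where
  base: "B \<in> E \<Longrightarrow> B \<in> boolean_combinations E"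
| compl: "Y \<in> boolean_combinations E \<Longrightarrow> - Y \<in> boolean_combinations E"
| union: "Y \<in> boolean_combinations E \<Longrightarrow> Z \<in> boolean_combinations E \<Longrightarrow>
    Y \<union> Z \<in> boolean_combinations E"

definition C_minimal :: "('f, 'r) vf_signature \<Rightarrow> ('f, 'r, 'a) fo_struct \<Rightarrow> bool" where
  "C_minimal L M \<longleftrightarrow>
     (\<forall>S. definable L M 1 ((\<lambda>x. [x]) ` S) \<longrightarrow>
        S \<in> boolean_combinations ({B. is_ball L M B} \<union> {{a} | a. True}))"

definition C_minimal_ACVF_theory ::
    "'a itself \<Rightarrow> ('f, 'r) vf_signature \<Rightarrow> ('f, 'r) fo_form set \<Rightarrow> bool" where
  "C_minimal_ACVF_theory (A :: 'a itself) L T \<longleftrightarrow>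
     (\<forall>N :: ('f, 'r, 'a) fo_struct. N \<Turnstile> T \<longrightarrow> is_ACVF L N \<and> C_minimal L N)"

text \<open>A definable chain of balls is a family \<open>B\<close> indexed by a definable set \<open>I\<close> of \<open>n\<close>-tuples,
  uniformly definable and linearly ordered by inclusion.\<close>

definition definable_ball_chain ::
    "('f, 'r) vf_signature \<Rightarrow> ('f, 'r, 'a) fo_struct \<Rightarrow> nat \<Rightarrow> 'a list set \<Rightarrow> ('a list \<Rightarrow> 'a set) \<Rightarrow> bool" where
  "definable_ball_chain L M n I B \<longleftrightarrow>
     definable L M n I \<and>
     definable L M (n + 1) {i @ [x] | i x. i \<in> I \<and> x \<in> B i} \<and>
     (\<forall>i\<in>I. is_ball L M (B i)) \<and>
     (\<forall>i\<in>I. \<forall>j\<in>I. B i \<subseteq> B j \<or> B j \<subseteq> B i)"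

definition definably_complete :: "('f, 'r) vf_signature \<Rightarrow> ('f, 'r, 'a) fo_struct \<Rightarrow> bool" where
  "definably_complete L M \<longleftrightarrow>
     (\<forall>n I B. definable_ball_chain L M n I B \<and>
        (\<forall>c. c \<noteq> \<zero>\<^bsub>field_of L M\<^esub> \<longrightarrow>
           (\<exists>i\<in>I. \<exists>d. has_radius L M (B i) d \<and> val_less L M c d)) \<longrightarrow>
        (\<Inter>i\<in>I. B i) \<noteq> {})"

text \<open>Definability of a map with domain \<open>D\<close>, as definability of its graph; values outside \<open>D\<close> are
  irrelevant.\<close>

definition definable_map ::
    "('f, 'r) vf_signature \<Rightarrow> ('f, 'r, 'a) fo_struct \<Rightarrow> 'a set \<Rightarrow> ('a \<Rightarrow> 'a) \<Rightarrow> bool" where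
  "definable_map L M D f \<longleftrightarrow> definable L M 2 {[x, f x] | x. x \<in> D}"

end

theory Submission
  imports Defs
begin

text \<open>For a fixed unit \<open>u\<close> the residue of \<open>f(ux)/f(x)\<close> is eventually constant as \<open>x\<close> tends to 0, because
  the residue field is strongly minimal and orthogonal to the value group, and the cocycle identity
  makes this uniform in \<open>u\<close>. Hence for every \<open>a\<close> the leading term of \<open>f(ax)/f(x)\<close> depends on \<open>v(x)\<close>
  only, which by C-minimality is possible only if \<open>v(f(ax)/f(x))\<close> is eventually constant. A definable
  function whose valuation is eventually constant has a limit by definable completeness, once the radii
  of the balls that it eventually enters are known to be unbounded: at a bound the same arguments,
  applied to the function or to its differences, would map the value group onto the residue field.
  The endomorphism is \<open>g(a) = lim f(ax)/f(x)\<close>, and the argument applied once more to \<open>f/g\<close> gives the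
  limit \<open>c\<close>.\<close>

section \<open>Definable predicates\<close>

text \<open>Value group and residue field are not sorts here. A set of values is a predicate on
  field elements that is invariant under \<open>\<asymp>\<close>, and two elements lie in the same
  residue class when v(x - y) > 0. The recurrent difficulty is an exchange of quantifiers: what
  holds near 0 for each unit \<open>u\<close> separately is needed on one punctured ball for all
  \<open>u\<close>. Saturation bounds the number of exceptional residue classes uniformly in a
  definable family, which yields a single radius for generic \<open>u\<close>; every unit is a
  product of two generic ones, and here the cocycle identity enters. Orthogonality rests on the fact
  that a definable total preorder cannot spread out generic residue classes. Final segments of the
  value group are totally ordered by inclusion, so the fibres over generic classes generate the same
  segment, and C-minimality then makes two disjoint fibres meet. Definable completeness says nothing
  about chains with bounded radii. They are excluded instead of intersected, and the two shapes of a
  bound, attained or not, need different arguments.\<close>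

primrec ren_term :: "(nat \<Rightarrow> nat) \<Rightarrow> 'f fo_term \<Rightarrow> 'f fo_term" where
  "ren_term \<rho> (Var i) = Var (\<rho> i)"
| "ren_term \<rho> (App f ts) = App f (map (ren_term \<rho>) ts)"

primrec ren_form :: "(nat \<Rightarrow> nat) \<Rightarrow> ('f, 'r) fo_form \<Rightarrow> ('f, 'r) fo_form" where
  "ren_form \<rho> (Equal s u) = Equal (ren_term \<rho> s) (ren_term \<rho> u)"
| "ren_form \<rho> (Rel r ts) = Rel r (map (ren_term \<rho>) ts)"
| "ren_form \<rho> (Neg \<phi>) = Neg (ren_form \<rho> \<phi>)"
| "ren_form \<rho> (Conj \<phi> \<psi>) = Conj (ren_form \<rho> \<phi>) (ren_form \<rho> \<psi>)"
| "ren_form \<rho> (Exists i \<phi>) = Exists (\<rho> i) (ren_form \<rho> \<phi>)"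

lemma term_val_ren_term: "term_val M e (ren_term \<rho> s) = term_val M (e \<circ> \<rho>) s"
  by (induction s) (auto simp: comp_def cong: map_cong)

lemma wf_ren_term [simp]: "wf_term L (ren_term \<rho> s) = wf_term L s"
  by (induction s) (auto simp: list_all_iff)

lemma wf_ren_form [simp]: "wf_form L (ren_form \<rho> \<phi>) = wf_form L \<phi>"
  by (induction \<phi>) (auto simp: list_all_iff)

lemma term_vars_ren_term: "term_vars (ren_term \<rho> s) = \<rho> ` term_vars s"
  by (induction s) auto

lemma free_vars_ren_form: "inj \<rho> \<Longrightarrow> free_vars (ren_form \<rho> \<phi>) = \<rho> ` free_vars \<phi>"
proof (induction \<phi>)
  case (Exists i \<phi>)
  then show ?case by (auto simp: inj_eq)
qed (auto simp: term_vars_ren_term)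

text \<open>Injectivity matters at quantifiers: updating the environment at \<open>\<rho> i\<close>
  must leave the other renamed variables alone.\<close>

lemma sat_ren_form: "inj \<rho> \<Longrightarrow> sat M e (ren_form \<rho> \<phi>) = sat M (e \<circ> \<rho>) \<phi>"
proof (induction \<phi> arbitrary: e)
  case (Exists i \<phi>)
  have "(e(\<rho> i := a)) \<circ> \<rho> = (e \<circ> \<rho>)(i := a)" for a
    using injD[OF Exists.prems] by fastforce
  then show ?case using Exists by (simp del: fun_upd_apply o_apply)
next
  case (Rel r ts)
  then show ?case by (simp add: term_val_ren_term comp_def)
qed (simp_all add: term_val_ren_term flip: comp_def)

lemma finite_term_vars: "finite (term_vars s)"
  by (induction s) auto

lemma finite_free_vars: "finite (free_vars \<phi>)"
  by (induction \<phi>) (auto simp: finite_term_vars)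

lemma term_val_cong: "(\<And>i. i \<in> term_vars s \<Longrightarrow> e i = e' i) \<Longrightarrow> term_val M e s = term_val M e' s"
proof (induction s)
  case (App f ts)
  then have "map (term_val M e) ts = map (term_val M e') ts" by auto
  then show ?case by (metis term_val.simps(2))
qed simp

lemma sat_cong: "(\<And>i. i \<in> free_vars \<phi> \<Longrightarrow> e i = e' i) \<Longrightarrow> sat M e \<phi> = sat M e' \<phi>"
proof (induction \<phi> arbitrary: e e')
  case (Equal s u)
  then have "term_val M e s = term_val M e' s" "term_val M e u = term_val M e' u"
    by (auto intro: term_val_cong)
  then show ?case by simp
next
  case (Rel r ts)
  then have "map (term_val M e) ts = map (term_val M e') ts"
    by (auto intro!: term_val_cong)
  then show ?case by (metis sat.simps(2))
next
  case (Conj \<phi> \<psi>)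
  then show ?case by (metis UnCI free_vars.simps(4) sat.simps(4))
next
  case (Exists i \<phi>)
  have "sat M (e(i := a)) \<phi> = sat M (e'(i := a)) \<phi>" for a
    by (rule Exists.IH) (use Exists.prems in auto)
  then show ?case by simp
next
  case (Neg \<phi>)
  then show ?case by (metis free_vars.simps(3) sat.simps(3))
qed

text \<open>Even-numbered variables carry the arguments and odd-numbered ones the parameters.\<close>

definition mix :: "(nat \<Rightarrow> 'a) \<Rightarrow> (nat \<Rightarrow> 'a) \<Rightarrow> nat \<Rightarrow> 'a" where
  "mix e p i = (if even i then e (i div 2) else p (i div 2))"

lemma mix_simps [simp]: "mix e p (2 * i) = e i" "mix e p (Suc (2 * i)) = p i"
  by (auto simp: mix_def)

lemma inj_parityI:
  fixes a b :: "nat \<Rightarrow> nat"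
  assumes "inj a" "inj b" "\<And>i j. a i \<noteq> b j"
  shows "inj (\<lambda>i. if even i then a (i div 2) else b (i div 2))"
proof (rule injI)
  fix i j :: nat
  assume eq: "(if even i then a (i div 2) else b (i div 2)) = (if even j then a (j div 2) else b (j div 2))"
  then have "even i = even j"
    using assms(3)[of "i div 2" "j div 2"] assms(3)[of "j div 2" "i div 2"]
    by (cases "even i"; cases "even j"; simp)
  moreover from this have "i div 2 = j div 2"
    using eq assms(1,2) by (cases "even i"; simp add: inj_eq)
  ultimately show "i = j"
    by (metis even_two_times_div_two odd_two_times_div_two_succ)
qed

section \<open>Closure properties of definability with parameters\<close>

locale fo_definability =
  fixes L :: "('f, 'r, 'm) signature_scheme"
    and M :: "('f, 'r, 'a) fo_struct"
begin

text \<open>Arguments form an infinite stream instead of a tuple, so that closure properties need no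
  bookkeeping of arities. The parameters are a stream too, of which a formula can use only finitely
  many.\<close>

definition dpred :: "((nat \<Rightarrow> 'a) \<Rightarrow> bool) \<Rightarrow> bool" where
  "dpred P \<longleftrightarrow> (\<exists>\<phi> p. wf_form L \<phi> \<and> (\<forall>e. P e = sat M (mix e p) \<phi>))"

text \<open>De Bruijn convention: the value sits at index 0 and the arguments are shifted by one.
  Quantifiers use the same convention, so the rules collected in \<open>dfn\<close> prove
  definability by following the syntax.\<close>

definition dfun :: "((nat \<Rightarrow> 'a) \<Rightarrow> 'a) \<Rightarrow> bool" where
  "dfun h \<longleftrightarrow> dpred (\<lambda>e. e 0 = h (\<lambda>i. e (Suc i)))"

named_theorems dfn

lemma dpredI:
  assumes "wf_form L \<phi>" "inj \<rho>" "\<And>e. P e = sat M (g e) \<phi>" "\<And>e. mix e p \<circ> \<rho> = g e"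
  shows "dpred P"
  unfolding dpred_def
  by (rule exI[of _ "ren_form \<rho> \<phi>"], rule exI[of _ p]) (simp add: assms sat_ren_form)

lemma dpred_const [dfn]: "dpred (\<lambda>e. b)"
proof -
  have "dpred (\<lambda>e. True)" "dpred (\<lambda>e. False)"
    unfolding dpred_def
    by (rule exI[of _ "Equal (Var 0) (Var 0)"], simp)
      (rule exI[of _ "Neg (Equal (Var 0) (Var 0))"], simp)
  then show ?thesis by (cases b) auto
qed

lemma dpred_not [dfn]: "dpred P \<Longrightarrow> dpred (\<lambda>e. \<not> P e)"
  unfolding dpred_def by (metis sat.simps(3) wf_form.simps(3))

lemma dpred_rename: "dpred P \<Longrightarrow> inj \<rho> \<Longrightarrow> dpred (\<lambda>e. P (\<lambda>i. e (\<rho> i)))"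
proof -
  assume "inj \<rho>" "dpred P"
  then obtain \<phi> p where \<phi>: "wf_form L \<phi>" "\<And>e. P e = sat M (mix e p) \<phi>"
    unfolding dpred_def by blast
  let ?\<rho> = "\<lambda>i. if even i then 2 * \<rho> (i div 2) else 2 * (i div 2) + 1"
  have "inj ?\<rho>"
    by (rule inj_parityI[where a = "\<lambda>i. 2 * \<rho> i" and b = "\<lambda>i. 2 * i + 1"])
      (use \<open>inj \<rho>\<close> in \<open>simp_all add: inj_def, presburger\<close>)
  then show ?thesis
    by (rule dpredI[OF \<phi>(1), where p = p and g = "\<lambda>e. mix (\<lambda>i. e (\<rho> i)) p"])
      (auto simp: \<phi>(2) mix_def fun_eq_iff)
qed

lemma dpred_conj [dfn]:
  assumes "dpred P" "dpred Q"
  shows "dpred (\<lambda>e. P e \<and> Q e)"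
proof -
  obtain \<phi> p where \<phi>: "wf_form L \<phi>" "\<And>e. P e = sat M (mix e p) \<phi>"
    using assms(1) unfolding dpred_def by blast
  obtain \<psi> q where \<psi>: "wf_form L \<psi>" "\<And>e. Q e = sat M (mix e q) \<psi>"
    using assms(2) unfolding dpred_def by blast
  \<comment> \<open>The two parameter streams are interleaved: \<open>k = 0\<close> addresses the
    slots of \<open>p\<close> and \<open>k = 1\<close> those of \<open>q\<close>.\<close>
  let ?\<rho> = "\<lambda>k i :: nat. if even i then 2 * (i div 2) else 2 * (2 * (i div 2) + k) + 1"
  have inj: "inj (?\<rho> k)" for k
    by (rule inj_parityI[where a = "\<lambda>i. 2 * i" and b = "\<lambda>i. 2 * (2 * i + k) + 1"])
      (simp_all add: inj_def, presburger)
  let ?r = "mix p q"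
  have r: "mix e ?r \<circ> ?\<rho> 0 = mix e p" "mix e ?r \<circ> ?\<rho> 1 = mix e q" for e
    by (auto simp: fun_eq_iff mix_def elim!: oddE)
  show ?thesis
    unfolding dpred_def
    by (rule exI[of _ "Conj (ren_form (?\<rho> 0) \<phi>) (ren_form (?\<rho> 1) \<psi>)"], rule exI[of _ ?r])
      (simp only: wf_form.simps wf_ren_form \<phi> \<psi> sat.simps sat_ren_form[OF inj] r simp_thms)
qed

lemma dpred_ex [dfn]:
  assumes "dpred (\<lambda>e. Q (e 0) (\<lambda>i. e (Suc i)))"
  shows "dpred (\<lambda>e. \<exists>x. Q x e)"
proof -
  obtain \<phi> p where \<phi>: "wf_form L \<phi>" "\<And>e. Q (e 0) (\<lambda>i. e (Suc i)) = sat M (mix e p) \<phi>"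
    using assms unfolding dpred_def by blast
  \<comment> \<open>The bound variable occupies the first parameter slot, index 1. Parameters move
    up by one slot to make room, and the other arguments move down by one.\<close>
  let ?a = "case_nat 1 (\<lambda>i. 2 * i)" and ?b = "\<lambda>i. 2 * i + 3"
  let ?\<rho> = "\<lambda>i. if even i then ?a (i div 2) else ?b (i div 2)"
  have inj: "inj ?\<rho>"
  proof (rule inj_parityI)
    show "inj ?a" by (auto simp: inj_def split: nat.splits)
    show "?a i \<noteq> ?b j" for i j by (cases i; simp; presburger?)
  qed (simp add: inj_def)
  let ?p = "case_nat undefined p"
  have "((mix e ?p)(1 := x)) \<circ> ?\<rho> = mix (case_nat x e) p" for e x
  proof
    fix i
    show "(((mix e ?p)(1 := x)) \<circ> ?\<rho>) i = mix (case_nat x e) p i"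
      by (cases "i div 2") (auto simp: mix_def split: nat.splits)
  qed
  moreover have "sat M (mix (case_nat x e) p) \<phi> = Q x e" for e x
    using \<phi>(2)[of "case_nat x e"] by simp
  ultimately have "(\<exists>x. Q x e) = sat M (mix e ?p) (Exists 1 (ren_form ?\<rho> \<phi>))" for e
    by (simp only: sat.simps sat_ren_form[OF inj])
  moreover have "wf_form L (Exists 1 (ren_form ?\<rho> \<phi>))" using \<phi>(1) by simp
  ultimately show ?thesis
    unfolding dpred_def by (intro exI conjI allI)
qed

lemma dpred_disj [dfn]:
  assumes "dpred P" "dpred Q"
  shows "dpred (\<lambda>e. P e \<or> Q e)"
proof -
  have "dpred (\<lambda>e. \<not> (\<not> P e \<and> \<not> Q e))" by (intro dfn assms)
  then show ?thesis by simp
qed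

lemma dpred_imp [dfn]:
  assumes "dpred P" "dpred Q"
  shows "dpred (\<lambda>e. P e \<longrightarrow> Q e)"
proof -
  have "dpred (\<lambda>e. \<not> P e \<or> Q e)" by (intro dfn assms)
  then show ?thesis unfolding imp_conv_disj .
qed

lemma dpred_all [dfn]:
  assumes "dpred (\<lambda>e. Q (e 0) (\<lambda>i. e (Suc i)))"
  shows "dpred (\<lambda>e. \<forall>x. Q x e)"
proof -
  have "dpred (\<lambda>e. \<not> (\<exists>x. \<not> Q x e))" by (intro dfn assms)
  then show ?thesis by simp
qed

lemma dpred_if [dfn]: "dpred P \<Longrightarrow> dpred Q \<Longrightarrow> dpred R \<Longrightarrow> dpred (\<lambda>e. if P e then Q e else R e)"
  unfolding if_bool_eq_conj by (intro dfn)

lemma dfun_var [dfn]: "dfun (\<lambda>e. e i)"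
  unfolding dfun_def dpred_def
  by (rule exI[of _ "Equal (Var 0) (Var (2 * Suc i))"]) (simp add: mix_def)

lemma dfun_const [dfn]: "dfun (\<lambda>e. c)"
  unfolding dfun_def dpred_def
  by (rule exI[of _ "Equal (Var 0) (Var 1)"], rule exI[of _ "\<lambda>_. c"]) (simp add: mix_def)

lemma dfun_shift: "dfun h \<Longrightarrow> dfun (\<lambda>e. h (\<lambda>i. e (Suc i)))"
  unfolding dfun_def
  by (drule dpred_rename[where \<rho> = "case_nat 0 (\<lambda>i. Suc (Suc i))"])
    (auto simp: inj_def split: nat.splits)

text \<open>Substitution is expressed by naming the values with existential quantifiers. The
  innermost quantifier has index 0, hence the transposition of the two arguments.\<close>

lemma dpred_comp2:
  assumes "dpred (\<lambda>e. R (e 0) (e 1))" "dfun x" "dfun y"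
  shows "dpred (\<lambda>e. R (x e) (y e))"
proof -
  have 1: "dpred (\<lambda>e. R (e (Suc 0)) (e 0))"
    using dpred_rename[OF assms(1), of "transpose 0 1"] by (simp add: transpose_def)
  have "dpred (\<lambda>e. \<exists>a. a = x e \<and> (\<exists>b. b = y e \<and> R a b))"
    using assms(2) dfun_shift[OF assms(3)] 1
    by (intro dfn) (auto simp: dfun_def)
  then show ?thesis by simp
qed

lemma dpred_comp3:
  assumes "dpred (\<lambda>e. R (e 0) (e 1) (e 2))" "dfun x" "dfun y" "dfun z"
  shows "dpred (\<lambda>e. R (x e) (y e) (z e))"
proof -
  have 1: "dpred (\<lambda>e. R (e (Suc (Suc 0))) (e (Suc 0)) (e 0))"
    using dpred_rename[OF assms(1), of "transpose 0 2"] by (simp add: transpose_def numeral_2_eq_2)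
  have "dpred (\<lambda>e. \<exists>a. a = x e \<and> (\<exists>b. b = y e \<and> (\<exists>c. c = z e \<and> R a b c)))"
    using assms(2) dfun_shift[OF assms(3)] dfun_shift[OF dfun_shift[OF assms(4)]] 1
    by (intro dfn) (auto simp: dfun_def)
  then show ?thesis by simp
qed

lemma dpred_eq [dfn]: "dfun x \<Longrightarrow> dfun y \<Longrightarrow> dpred (\<lambda>e. x e = y e)"
proof (rule dpred_comp2)
  show "dpred (\<lambda>e. e 0 = e 1)"
    unfolding dpred_def by (rule exI[of _ "Equal (Var 0) (Var 2)"]) (simp add: mix_def)
qed

lemma dfun_comp1:
  assumes "dpred (\<lambda>e. e 0 = g (e 1))" "dfun x"
  shows "dfun (\<lambda>e. g (x e))"
  unfolding dfun_def
  by (rule dpred_comp2[of "\<lambda>a b. a = g b"]) (use assms dfun_shift dfun_var in auto)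

lemma dfun_comp2:
  assumes "dpred (\<lambda>e. e 0 = g (e 1) (e 2))" "dfun x" "dfun y"
  shows "dfun (\<lambda>e. g (x e) (y e))"
  unfolding dfun_def
  by (rule dpred_comp3[of "\<lambda>a b c. a = g b c"]) (use assms dfun_shift dfun_var in auto)

lemma dfun_if [dfn]:
  assumes "dpred P" "dfun x" "dfun y"
  shows "dfun (\<lambda>e. if P e then x e else y e)"
proof -
  have "dpred (\<lambda>e. P (\<lambda>i. e (Suc i)))"
    using dpred_rename[OF assms(1), of Suc] by simp
  then have "dpred (\<lambda>e. if P (\<lambda>i. e (Suc i)) then e 0 = x (\<lambda>i. e (Suc i)) else e 0 = y (\<lambda>i. e (Suc i)))"
    using assms(2,3) unfolding dfun_def[of x] dfun_def[of y]
    by (intro dpred_if) auto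
  then show ?thesis unfolding dfun_def
    by (rule back_subst[of dpred]) auto
qed

lemma dpred_rel2:
  assumes "rel_ar L r = 2" "dfun x" "dfun y"
  shows "dpred (\<lambda>e. rel_int M r [x e, y e])"
proof (rule dpred_comp2[OF _ assms(2,3)])
  show "dpred (\<lambda>e. rel_int M r [e 0, e 1])"
    unfolding dpred_def
    by (rule exI[of _ "Rel r [Var 0, Var 2]"]) (simp add: mix_def assms)
qed

lemma dfun_app2:
  assumes "fun_ar L f = 2" "dfun x" "dfun y"
  shows "dfun (\<lambda>e. fun_int M f [x e, y e])"
proof (rule dfun_comp2[OF _ assms(2,3)])
  show "dpred (\<lambda>e. e 0 = fun_int M f [e 1, e 2])"
    unfolding dpred_def
    by (rule exI[of _ "Equal (Var 0) (App f [Var 2, Var 4])"]) (simp add: mix_def assms)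
qed

lemma dpred_definable:
  assumes "definable L M n S"
  shows "dpred (\<lambda>e. map e [0..<n] \<in> S)"
proof -
  obtain \<phi> ps where \<phi>: "wf_form L \<phi>" "S = {xs. length xs = n \<and> sat M (\<lambda>i. (xs @ ps) ! i) \<phi>}"
    using assms unfolding definable_over_def by blast
  let ?\<rho> = "\<lambda>i. if i < n then 2 * i else 2 * (i - n) + 1"
  have inj: "inj ?\<rho>"
  proof (rule injI)
    fix i j assume "?\<rho> i = ?\<rho> j"
    then show "i = j"
      by (cases "i < n"; cases "j < n"; simp; presburger)
  qed
  show ?thesis
    by (rule dpredI[OF \<phi>(1) inj, where p = "(!) ps" and g = "\<lambda>e i. (map e [0..<n] @ ps) ! i"])
      (auto simp: \<phi>(2) nth_append mix_def fun_eq_iff)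
qed

text \<open>The parameter set is kept finite because saturation applies only to formulas over small
  sets.\<close>

lemma definable_dpred:
  assumes "dpred P" "\<And>e. P e = (map e [0..<n] \<in> S)" "\<And>xs. xs \<in> S \<Longrightarrow> length xs = n"
  shows "\<exists>A. finite A \<and> definable_over L M A n S"
proof -
  obtain \<phi> p where \<phi>: "wf_form L \<phi>" "\<And>e. P e = sat M (mix e p) \<phi>"
    using assms(1) unfolding dpred_def by blast
  obtain m where m: "free_vars \<phi> \<subseteq> {..<m}"
    using finite_free_vars by (metis finite_nat_iff_bounded)
  \<comment> \<open>The values of all variables below \<open>m\<close> are appended as parameters;
    only the first \<open>n\<close> argument variables are redirected to the coordinates.\<close>
  let ?\<rho> = "\<lambda>j. if even j \<and> j div 2 < n then j div 2 else n + j"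
  have inj: "inj ?\<rho>"
  proof (rule injI)
    fix i j assume "?\<rho> i = ?\<rho> j"
    then show "i = j"
      by (cases "even i \<and> i div 2 < n"; cases "even j \<and> j div 2 < n"; simp)
        (metis even_two_times_div_two)
  qed
  \<comment> \<open>\<open>P\<close> depends on the first \<open>n\<close> arguments only, so any
    default serves for the later ones.\<close>
  define d :: 'a where "d = undefined"
  let ?ps = "map (mix (\<lambda>_. d) p) [0..<m]"
  have fv: "free_vars (ren_form ?\<rho> \<phi>) \<subseteq> {..<n + length ?ps}"
    using m by (auto simp: free_vars_ren_form[OF inj])
  have "sat M (\<lambda>i. (xs @ ?ps) ! i) (ren_form ?\<rho> \<phi>) = (xs \<in> S)" if "length xs = n" for xs
  proof -
    let ?e = "\<lambda>i. if i < n then xs ! i else d"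
    have "sat M (\<lambda>i. (xs @ ?ps) ! i) (ren_form ?\<rho> \<phi>) = sat M ((\<lambda>i. (xs @ ?ps) ! i) \<circ> ?\<rho>) \<phi>"
      by (rule sat_ren_form[OF inj])
    also have "\<dots> = sat M (mix ?e p) \<phi>"
      by (rule sat_cong) (use m that in \<open>auto simp: nth_append mix_def\<close>)
    also have "\<dots> = (map ?e [0..<n] \<in> S)" using \<phi>(2) assms(2) by simp
    also have "map ?e [0..<n] = xs" using that by (auto intro: nth_equalityI)
    finally show ?thesis .
  qed
  then have S: "S = {xs. length xs = n \<and> sat M (\<lambda>i. (xs @ ?ps) ! i) (ren_form ?\<rho> \<phi>)}"
    using assms(3) by blast
  have wf: "wf_form L (ren_form ?\<rho> \<phi>)" using \<phi>(1) by simp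
  have "definable_over L M (set ?ps) n S"
    unfolding definable_over_def 
    by (rule exI[of _ "ren_form ?\<rho> \<phi>"], rule exI[of _ ?ps]) (intro conjI wf fv S order_refl)
  then show ?thesis by blast
qed

lemma definable_over_mono: "definable_over L M A n S \<Longrightarrow> A \<subseteq> B \<Longrightarrow> definable_over L M B n S"
  unfolding definable_over_def by (elim exE conjE, intro exI conjI) (assumption | erule (1) order_trans)+

end

section \<open>Valued fields\<close>

locale valued_acf =
  fixes L :: "('f, 'r) vf_signature"
    and M :: "('f, 'r, 'a) fo_struct"
  assumes language: "contains_vf_language L"
    and acvf: "is_ACVF L M"
begin

sublocale fo_definability L M .

abbreviation K :: "'a ring" where "K \<equiv> field_of L M"

definition zer :: 'a (\<open>\<^bold>0\<close>) where "\<^bold>0 = \<zero>\<^bsub>K\<^esub>"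
definition unt :: 'a (\<open>\<^bold>1\<close>) where "\<^bold>1 = \<one>\<^bsub>K\<^esub>"
definition add (infixl \<open>\<^bold>+\<close> 65) where "x \<^bold>+ y = x \<oplus>\<^bsub>K\<^esub> y"
definition mul (infixl \<open>\<^bold>*\<close> 70) where "x \<^bold>* y = x \<otimes>\<^bsub>K\<^esub> y"
definition neg where "neg x = \<ominus>\<^bsub>K\<^esub> x"
definition sub (infixl \<open>\<^bold>-\<close> 65) where "x \<^bold>- y = x \<ominus>\<^bsub>K\<^esub> y"
definition inv' where "inv' x = (if x = \<^bold>0 then \<^bold>0 else inv\<^bsub>K\<^esub> x)"
definition dvs (infixl \<open>\<^bold>'/\<close> 70) where "x \<^bold>/ y = x \<^bold>* inv' y"
abbreviation vle (infix \<open>\<preceq>\<close> 50) where "x \<preceq> y \<equiv> val_le L M x y"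
abbreviation vlt (infix \<open>\<prec>\<close> 50) where "x \<prec> y \<equiv> val_less L M x y"
definition veq (infix \<open>\<asymp>\<close> 50) where "x \<asymp> y \<longleftrightarrow> x \<preceq> y \<and> y \<preceq> x"

lemmas op_defs = zer_def unt_def add_def mul_def neg_def sub_def inv'_def dvs_def

lemma carrier_K [simp]: "carrier K = UNIV"
  by (simp add: field_of_def)

lemma algebraically_closed_K: "algebraically_closed K"
  using acvf by (simp add: is_ACVF_def Let_def)

sublocale alg: algebraically_closed K
  by (rule algebraically_closed_K)

text \<open>Interpreting the locale behind the type class of fields makes its simplification rules
  available for \<open>K\<close>. This is why \<open>inv'\<close> is total with value 0 at
  0.\<close>

lemma class_field: "class.field (\<^bold>/) inv' (\<^bold>*) \<^bold>1 (\<^bold>+) \<^bold>0 (\<^bold>-) neg"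
proof
  show "a \<^bold>* b \<^bold>* c = a \<^bold>* (b \<^bold>* c)" for a b c
    by (simp add: op_defs alg.m_assoc)
  show "a \<^bold>* b = b \<^bold>* a" for a b by (simp add: op_defs alg.m_comm)
  show "\<^bold>1 \<^bold>* a = a" for a by (simp add: op_defs)
  show "a \<^bold>+ b \<^bold>+ c = a \<^bold>+ (b \<^bold>+ c)" for a b c
    by (simp add: op_defs alg.a_assoc)
  show "a \<^bold>+ b = b \<^bold>+ a" for a b by (simp add: op_defs alg.a_comm)
  show "\<^bold>0 \<^bold>+ a = a" for a by (simp add: op_defs)
  show "neg a \<^bold>+ a = \<^bold>0" for a by (simp add: op_defs alg.l_neg)
  show "a \<^bold>- b = a \<^bold>+ neg b" for a b by (simp add: op_defs a_minus_def)
  show "(a \<^bold>+ b) \<^bold>* c = a \<^bold>* c \<^bold>+ b \<^bold>* c" for a b c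
    by (simp add: op_defs alg.l_distr)
  show "\<^bold>0 \<noteq> \<^bold>1" by (simp add: op_defs)
  show "a \<noteq> \<^bold>0 \<Longrightarrow> inv' a \<^bold>* a = \<^bold>1" for a
    using alg.field_Units by (simp add: op_defs)
  show "a \<^bold>/ b = a \<^bold>* inv' b" for a b by (simp add: dvs_def)
  show "inv' \<^bold>0 = \<^bold>0" by (simp add: inv'_def)
qed

sublocale fld: Fields.field "(\<^bold>/)" inv' "(\<^bold>*)" "\<^bold>1" "(\<^bold>+)" "\<^bold>0" "(\<^bold>-)" neg
  by (rule class_field)

section \<open>Arithmetic of the valuation\<close>

lemma vle_total: "x \<preceq> y \<or> y \<preceq> x"
  and vle_trans [trans]: "x \<preceq> y \<Longrightarrow> y \<preceq> z \<Longrightarrow> x \<preceq> z"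
  and vle_mult: "x \<preceq> y \<Longrightarrow> x \<^bold>* z \<preceq> y \<^bold>* z"
  and vle_add: "z \<preceq> x \<Longrightarrow> z \<preceq> y \<Longrightarrow> z \<preceq> x \<^bold>+ y"
  and vlt_one_zero: "\<^bold>1 \<prec> \<^bold>0"
  and ex_small': "\<exists>x. x \<noteq> \<^bold>0 \<and> \<^bold>1 \<prec> x"
  using acvf unfolding is_ACVF_def Let_def op_defs by blast+

lemma vlt_iff: "x \<prec> y \<longleftrightarrow> \<not> y \<preceq> x"
  by (simp add: val_less_def)

lemma not_vle [simp]: "\<not> x \<preceq> y \<longleftrightarrow> y \<prec> x"
  by (simp add: vlt_iff)

lemma not_vlt [simp]: "\<not> x \<prec> y \<longleftrightarrow> y \<preceq> x"
  by (simp add: vlt_iff del: not_vle)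

lemma vle_refl [simp]: "x \<preceq> x"
  using vle_total by blast

lemma vlt_irrefl [simp]: "\<not> x \<prec> x"
  by simp

lemma vlt_imp_vle: "x \<prec> y \<Longrightarrow> x \<preceq> y"
  using vle_total vlt_iff by blast

lemma vle_vlt_trans [trans]: "x \<preceq> y \<Longrightarrow> y \<prec> z \<Longrightarrow> x \<prec> z"
  and vlt_vle_trans [trans]: "x \<prec> y \<Longrightarrow> y \<preceq> z \<Longrightarrow> x \<prec> z"
  and vlt_trans [trans]: "x \<prec> y \<Longrightarrow> y \<prec> z \<Longrightarrow> x \<prec> z"
  using vle_trans vlt_iff vlt_imp_vle by meson+

lemma vle_zero [simp]: "x \<preceq> \<^bold>0"
  using vle_mult[OF vlt_imp_vle[OF vlt_one_zero], of x] by simp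

lemma zero_vle [simp]: "\<^bold>0 \<preceq> x \<longleftrightarrow> x = \<^bold>0"
proof
  assume "\<^bold>0 \<preceq> x"
  show "x = \<^bold>0"
  proof (rule ccontr)
    assume "x \<noteq> \<^bold>0"
    then have "\<^bold>0 \<preceq> \<^bold>1" using vle_mult[OF \<open>\<^bold>0 \<preceq> x\<close>, of "inv' x"] by simp
    then show False using vlt_one_zero by (simp add: vlt_iff del: not_vle)
  qed
qed simp

lemma vlt_zero [simp]: "x \<prec> \<^bold>0 \<longleftrightarrow> x \<noteq> \<^bold>0"
  by (simp add: vlt_iff del: not_vle)

lemma zero_vlt [simp]: "\<not> \<^bold>0 \<prec> x"
  by simp

lemma vle_mult_iff [simp]: "z \<noteq> \<^bold>0 \<Longrightarrow> x \<^bold>* z \<preceq> y \<^bold>* z \<longleftrightarrow> x \<preceq> y"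
  using vle_mult[of "x \<^bold>* z" "y \<^bold>* z" "inv' z"] vle_mult[of x y z]
  by (auto simp: fld.mult_assoc)

lemma vle_mult_iff' [simp]: "z \<noteq> \<^bold>0 \<Longrightarrow> z \<^bold>* x \<preceq> z \<^bold>* y \<longleftrightarrow> x \<preceq> y"
  using vle_mult_iff[of z x y] by (simp add: fld.mult_commute)

lemma vlt_mult_iff [simp]: "z \<noteq> \<^bold>0 \<Longrightarrow> x \<^bold>* z \<prec> y \<^bold>* z \<longleftrightarrow> x \<prec> y"
  and vlt_mult_iff' [simp]: "z \<noteq> \<^bold>0 \<Longrightarrow> z \<^bold>* x \<prec> z \<^bold>* y \<longleftrightarrow> x \<prec> y"
  by (simp_all add: vlt_iff del: not_vle)

lemma neg_one_veq: "neg \<^bold>1 \<preceq> \<^bold>1" "\<^bold>1 \<preceq> neg \<^bold>1"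
  using vle_total[of "\<^bold>1" "neg \<^bold>1"] vle_mult[of "\<^bold>1" "neg \<^bold>1" "neg \<^bold>1"]
    vle_mult[of "neg \<^bold>1" "\<^bold>1" "neg \<^bold>1"] by auto

lemma vle_neg [simp]: "x \<preceq> neg y \<longleftrightarrow> x \<preceq> y" "neg x \<preceq> y \<longleftrightarrow> x \<preceq> y"
proof -
  have "neg x \<preceq> x" "x \<preceq> neg x" for x
    using vle_mult[OF neg_one_veq(1), of x] vle_mult[OF neg_one_veq(2), of x] by auto
  then show "x \<preceq> neg y \<longleftrightarrow> x \<preceq> y" "neg x \<preceq> y \<longleftrightarrow> x \<preceq> y"
    using vle_trans by blast+
qed

lemma vlt_neg [simp]: "x \<prec> neg y \<longleftrightarrow> x \<prec> y" "neg x \<prec> y \<longleftrightarrow> x \<prec> y"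
  by (simp_all add: vlt_iff del: not_vle)

lemma vle_sub: "z \<preceq> x \<Longrightarrow> z \<preceq> y \<Longrightarrow> z \<preceq> x \<^bold>- y"
  using vle_add[of z x "neg y"] by simp

lemma vlt_add: "z \<prec> x \<Longrightarrow> z \<prec> y \<Longrightarrow> z \<prec> x \<^bold>+ y"
  using vle_total[of x y] vle_add[of x x y] vle_add[of y x y]
  by (meson vle_refl vlt_vle_trans)

lemma vlt_sub: "z \<prec> x \<Longrightarrow> z \<prec> y \<Longrightarrow> z \<prec> x \<^bold>- y"
  using vlt_add[of z x "neg y"] by simp

lemma vle_sub_commute: "z \<preceq> x \<^bold>- y \<longleftrightarrow> z \<preceq> y \<^bold>- x" "x \<^bold>- y \<preceq> z \<longleftrightarrow> y \<^bold>- x \<preceq> z"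
  by (metis fld.minus_diff_eq vle_neg)+

lemma vlt_sub_commute: "z \<prec> x \<^bold>- y \<longleftrightarrow> z \<prec> y \<^bold>- x" "x \<^bold>- y \<prec> z \<longleftrightarrow> y \<^bold>- x \<prec> z"
  by (simp_all add: vlt_iff vle_sub_commute del: not_vle)

lemma vle_sub_trans: "z \<preceq> x \<^bold>- y \<Longrightarrow> z \<preceq> y \<^bold>- w \<Longrightarrow> z \<preceq> x \<^bold>- w"
  using vle_add[of z "x \<^bold>- y" "y \<^bold>- w"] by (simp add: fld.add_diff_eq)

lemma vlt_sub_trans: "z \<prec> x \<^bold>- y \<Longrightarrow> z \<prec> y \<^bold>- w \<Longrightarrow> z \<prec> x \<^bold>- w"
  using vlt_add[of z "x \<^bold>- y" "y \<^bold>- w"] by (simp add: fld.add_diff_eq)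

lemma veq_refl [simp]: "x \<asymp> x"
  and veq_sym: "x \<asymp> y \<Longrightarrow> y \<asymp> x"
  and veq_trans [trans]: "x \<asymp> y \<Longrightarrow> y \<asymp> z \<Longrightarrow> x \<asymp> z"
  by (auto simp: veq_def intro: vle_trans)

lemma veq_vle: "x \<asymp> y \<Longrightarrow> x \<preceq> z \<longleftrightarrow> y \<preceq> z" "x \<asymp> y \<Longrightarrow> z \<preceq> x \<longleftrightarrow> z \<preceq> y"
  by (auto simp: veq_def intro: vle_trans)

lemma veq_vlt: "x \<asymp> y \<Longrightarrow> x \<prec> z \<longleftrightarrow> y \<prec> z" "x \<asymp> y \<Longrightarrow> z \<prec> x \<longleftrightarrow> z \<prec> y"
  by (simp_all add: vlt_iff veq_vle del: not_vle)

lemma veq_zero [simp]: "x \<asymp> \<^bold>0 \<longleftrightarrow> x = \<^bold>0" "\<^bold>0 \<asymp> x \<longleftrightarrow> x = \<^bold>0"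
  by (auto simp: veq_def)

lemma veq_nonzero: "x \<asymp> y \<Longrightarrow> x = \<^bold>0 \<longleftrightarrow> y = \<^bold>0"
  using veq_zero veq_sym veq_trans by metis

lemma veq_mult:
  assumes "x \<asymp> y" "x' \<asymp> y'"
  shows "x \<^bold>* x' \<asymp> y \<^bold>* y'"
proof -
  have "x \<^bold>* x' \<asymp> y \<^bold>* x'" using assms(1) by (simp add: veq_def vle_mult)
  also have "x' \<^bold>* y \<asymp> y' \<^bold>* y" using assms(2) by (simp add: veq_def vle_mult)
  then have "y \<^bold>* x' \<asymp> y \<^bold>* y'" by (simp add: fld.mult_commute)
  finally show ?thesis .
qed

lemma veq_mult_iff [simp]: "z \<noteq> \<^bold>0 \<Longrightarrow> x \<^bold>* z \<asymp> y \<^bold>* z \<longleftrightarrow> x \<asymp> y"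
  "z \<noteq> \<^bold>0 \<Longrightarrow> z \<^bold>* x \<asymp> z \<^bold>* y \<longleftrightarrow> x \<asymp> y"
  by (simp_all add: veq_def)

lemma veq_inverse: "x \<asymp> y \<Longrightarrow> inv' x \<asymp> inv' y"
proof (cases "x = \<^bold>0")
  case False
  assume "x \<asymp> y"
  with False have "y \<noteq> \<^bold>0" using veq_nonzero by blast
  have "inv' x \<^bold>* (x \<^bold>* y) = y"
    using False by (simp flip: fld.mult_assoc)
  moreover have "inv' y \<^bold>* (x \<^bold>* y) = x"
    using \<open>y \<noteq> \<^bold>0\<close> by (simp add: fld.mult.left_commute[of "inv' y"])
  ultimately have "inv' x \<^bold>* (x \<^bold>* y) \<asymp> inv' y \<^bold>* (x \<^bold>* y)"
    using veq_sym[OF \<open>x \<asymp> y\<close>] by simp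
  then show ?thesis using False \<open>y \<noteq> \<^bold>0\<close> by simp
qed (use veq_nonzero in fastforce)

lemma veq_divide: "x \<asymp> y \<Longrightarrow> x' \<asymp> y' \<Longrightarrow> x \<^bold>/ x' \<asymp> y \<^bold>/ y'"
  unfolding dvs_def by (intro veq_mult veq_inverse)

lemma add_veq: "x \<prec> y \<Longrightarrow> x \<^bold>+ y \<asymp> x"
proof -
  assume "x \<prec> y"
  have "x \<^bold>+ y \<preceq> x"
  proof (rule ccontr)
    assume "\<not> x \<^bold>+ y \<preceq> x"
    then have "x \<prec> x \<^bold>+ y \<^bold>- y" using \<open>x \<prec> y\<close> by (intro vlt_sub) auto
    then show False by simp
  qed
  then show ?thesis using \<open>x \<prec> y\<close> by (simp add: veq_def vle_add vlt_imp_vle)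
qed

lemma sub_veq: "x \<prec> y \<Longrightarrow> x \<^bold>- y \<asymp> x" "x \<prec> y \<Longrightarrow> y \<^bold>- x \<asymp> x"
  using add_veq[of x "neg y"] add_veq[of "neg x" y]
  by (auto simp: veq_def fld.add_commute)

text \<open>Ultrametric geometry: moving \<open>x\<close> by less than its distance to
  \<open>a\<close> does not change that distance.\<close>

lemma sub_veq_of_close:
  assumes "x \<^bold>- a \<prec> x \<^bold>- y"
  shows "x \<^bold>- a \<asymp> y \<^bold>- a"
proof -
  have "x \<^bold>- a = (x \<^bold>- y) \<^bold>+ (y \<^bold>- a)" by (simp add: fld.add_diff_eq)
  then have "x \<^bold>- a \<^bold>- (x \<^bold>- y) = y \<^bold>- a" by simp
  then show ?thesis using sub_veq(1)[OF assms] veq_sym by simp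
qed

section \<open>Units and leading terms\<close>

definition unit :: "'a \<Rightarrow> bool" where "unit x \<longleftrightarrow> x \<asymp> \<^bold>1"

lemma unit_nonzero: "unit x \<Longrightarrow> x \<noteq> \<^bold>0"
  unfolding unit_def using veq_zero fld.zero_neq_one by metis

lemma unit_one [simp]: "unit \<^bold>1"
  by (simp add: unit_def)

lemma unit_mult: "unit x \<Longrightarrow> unit y \<Longrightarrow> unit (x \<^bold>* y)"
  unfolding unit_def using veq_mult[of x "\<^bold>1" y "\<^bold>1"] by simp

lemma unit_inverse: "unit x \<Longrightarrow> unit (inv' x)"
  unfolding unit_def using veq_inverse[of x "\<^bold>1"] by simp

lemma unit_divide: "unit x \<Longrightarrow> unit y \<Longrightarrow> unit (x \<^bold>/ y)"
  unfolding dvs_def by (intro unit_mult unit_inverse)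

lemma unit_mult_veq: "unit u \<Longrightarrow> u \<^bold>* x \<asymp> x"
  unfolding unit_def using veq_mult[of u "\<^bold>1" x x] by simp

lemma veq_unit: "x \<asymp> y \<Longrightarrow> y \<noteq> \<^bold>0 \<Longrightarrow> unit (x \<^bold>/ y)"
  unfolding unit_def using veq_divide[of x y y y] by simp

text \<open>Equality of the leading terms, that is, of the images in the quotient of the multiplicative
  group by the units congruent to 1. The relation is false as soon as one side is zero.\<close>

definition rveq (infix \<open>\<approx>\<close> 50) where "x \<approx> y \<longleftrightarrow> y \<prec> x \<^bold>- y"

lemma rveq_veq: "x \<approx> y \<Longrightarrow> x \<asymp> y"
  unfolding rveq_def using add_veq[of y "x \<^bold>- y"] by (simp add: fld.add_diff_eq)

lemma rveq_nonzero: "x \<approx> y \<Longrightarrow> x \<noteq> \<^bold>0 \<and> y \<noteq> \<^bold>0"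
  using veq_nonzero[OF rveq_veq] unfolding rveq_def by fastforce

lemma rveq_refl: "x \<noteq> \<^bold>0 \<Longrightarrow> x \<approx> x"
  by (simp add: rveq_def)

lemma rveq_sym: "x \<approx> y \<Longrightarrow> y \<approx> x"
  using rveq_veq[of x y] by (simp add: rveq_def vlt_sub_commute(1)[of x y] veq_vlt)

lemma rveq_trans [trans]: "x \<approx> y \<Longrightarrow> y \<approx> z \<Longrightarrow> x \<approx> z"
  using rveq_veq[of y z] unfolding rveq_def by (meson veq_vlt(1) vlt_sub_trans)

lemma rveq_mult_right: "z \<noteq> \<^bold>0 \<Longrightarrow> x \<^bold>* z \<approx> y \<^bold>* z \<longleftrightarrow> x \<approx> y"
  unfolding rveq_def by (simp flip: fld.left_diff_distrib)

lemma rveq_mult: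
  assumes "x \<approx> y" "x' \<approx> y'"
  shows "x \<^bold>* x' \<approx> y \<^bold>* y'"
proof -
  have "x \<^bold>* x' \<approx> y \<^bold>* x'" using assms rveq_nonzero by (simp add: rveq_mult_right)
  also have "x' \<^bold>* y \<approx> y' \<^bold>* y" using assms rveq_nonzero by (simp add: rveq_mult_right)
  then have "y \<^bold>* x' \<approx> y \<^bold>* y'" by (simp add: fld.mult_commute)
  finally show ?thesis .
qed

lemma unit_rveqI: "\<^bold>1 \<prec> x \<^bold>- y \<Longrightarrow> unit y \<Longrightarrow> x \<approx> y"
  unfolding rveq_def unit_def by (simp add: veq_vlt)

section \<open>Definability of the field operations and of the valuation relations\<close>

lemma dpred_vle [dfn]: "dfun x \<Longrightarrow> dfun y \<Longrightarrow> dpred (\<lambda>e. x e \<preceq> y e)"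
  unfolding val_le_def using language by (intro dpred_rel2) (simp_all add: contains_vf_language_def)

lemma dpred_vlt [dfn]: "dfun x \<Longrightarrow> dfun y \<Longrightarrow> dpred (\<lambda>e. x e \<prec> y e)"
  unfolding vlt_iff by (intro dfn)

lemma dpred_veq [dfn]: "dfun x \<Longrightarrow> dfun y \<Longrightarrow> dpred (\<lambda>e. x e \<asymp> y e)"
  unfolding veq_def by (intro dfn)

lemma dfun_add [dfn]: "dfun x \<Longrightarrow> dfun y \<Longrightarrow> dfun (\<lambda>e. x e \<^bold>+ y e)"
  using dfun_app2[of "add_sym L" x y] language
  by (simp add: add_def field_of_def contains_vf_language_def)

lemma dfun_mul [dfn]: "dfun x \<Longrightarrow> dfun y \<Longrightarrow> dfun (\<lambda>e. x e \<^bold>* y e)"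
  using dfun_app2[of "mul_sym L" x y] language
  by (simp add: mul_def field_of_def contains_vf_language_def)

lemma dfun_sub [dfn]:
  assumes "dfun x" "dfun y"
  shows "dfun (\<lambda>e. x e \<^bold>- y e)"
proof (rule dfun_comp2[OF _ assms])
  have "dpred (\<lambda>e. e 0 \<^bold>+ e 2 = e 1)" by (intro dfn)
  then show "dpred (\<lambda>e. e 0 = e 1 \<^bold>- e 2)" by (simp add: fld.eq_diff_eq)
qed

lemma dfun_inv' [dfn]:
  assumes "dfun x"
  shows "dfun (\<lambda>e. inv' (x e))"
proof (rule dfun_comp1[OF _ assms])
  have "dpred (\<lambda>e. if e 1 = \<^bold>0 then e 0 = \<^bold>0 else e 0 \<^bold>* e 1 = \<^bold>1)" by (intro dfn)
  moreover have "(if e 1 = \<^bold>0 then e 0 = \<^bold>0 else e 0 \<^bold>* e 1 = \<^bold>1) \<longleftrightarrow> e 0 = inv' (e 1)" for e :: "nat \<Rightarrow> 'a"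
    by (auto simp: fld.inverse_unique fld.mult_commute)
  ultimately show "dpred (\<lambda>e. e 0 = inv' (e 1))" by simp
qed

lemma dfun_dvs [dfn]: "dfun x \<Longrightarrow> dfun y \<Longrightarrow> dfun (\<lambda>e. x e \<^bold>/ y e)"
  unfolding dvs_def by (intro dfn)

lemma dpred_unit [dfn]: "dfun x \<Longrightarrow> dpred (\<lambda>e. unit (x e))"
  unfolding unit_def by (intro dfn)

lemma dpred_rveq [dfn]: "dfun x \<Longrightarrow> dfun y \<Longrightarrow> dpred (\<lambda>e. x e \<approx> y e)"
  unfolding rveq_def by (intro dfn)

section \<open>Infinitude of the residue field\<close>

lemma one_vle_mult: "\<^bold>1 \<preceq> x \<Longrightarrow> \<^bold>1 \<preceq> y \<Longrightarrow> \<^bold>1 \<preceq> x \<^bold>* y"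
  and one_vlt_mult: "\<^bold>1 \<prec> x \<Longrightarrow> \<^bold>1 \<preceq> y \<Longrightarrow> \<^bold>1 \<prec> x \<^bold>* y"
  and mult_vlt_one: "x \<prec> \<^bold>1 \<Longrightarrow> y \<preceq> \<^bold>1 \<Longrightarrow> x \<^bold>* y \<prec> \<^bold>1"
proof -
  show "\<^bold>1 \<preceq> x \<Longrightarrow> \<^bold>1 \<preceq> y \<Longrightarrow> \<^bold>1 \<preceq> x \<^bold>* y"
    using vle_mult[of "\<^bold>1" x y] vle_trans by simp
  show "\<^bold>1 \<prec> x \<Longrightarrow> \<^bold>1 \<preceq> y \<Longrightarrow> \<^bold>1 \<prec> x \<^bold>* y"
    using vle_mult[of "\<^bold>1" y x] vlt_vle_trans by (simp add: fld.mult_commute)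
  show "x \<prec> \<^bold>1 \<Longrightarrow> y \<preceq> \<^bold>1 \<Longrightarrow> x \<^bold>* y \<prec> \<^bold>1"
    using vle_mult[of y "\<^bold>1" x] vle_vlt_trans by (simp add: fld.mult_commute)
qed

definition root_prod :: "'a list \<Rightarrow> 'a \<Rightarrow> 'a" where
  "root_prod es x = foldr (\<lambda>e r. (x \<^bold>- e) \<^bold>* r) es \<^bold>1"

text \<open>Algebraic closedness is stated for the polynomial ring on lists, so the product must be
  realised there. The length is recorded to know later that the polynomial is not constant.\<close>

lemma root_prod_poly:
  "\<exists>p. p \<in> carrier (poly_ring K) \<and> p \<noteq> [] \<and> length p = Suc (length es) \<and>
    (\<forall>x. alg.eval p x = root_prod es x)"
proof (induction es)
  case Nil
  show ?case
    by (rule exI[of _ "[\<one>\<^bsub>K\<^esub>]"])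
      (simp add: root_prod_def unt_def univ_poly_def polynomial_def)
next
  case (Cons e es)
  then obtain p where p: "polynomial\<^bsub>K\<^esub> (carrier K) p" "p \<noteq> []" "length p = Suc (length es)"
    "\<And>x. alg.eval p x = root_prod es x"
    by (auto simp: univ_poly_def)
  let ?l = "[\<one>\<^bsub>K\<^esub>, \<ominus>\<^bsub>K\<^esub> e]"
  let ?q = "alg.poly_mult ?l p"
  have l: "polynomial\<^bsub>K\<^esub> (carrier K) ?l" by (simp add: polynomial_def)
  have q: "polynomial\<^bsub>K\<^esub> (carrier K) ?q"
    by (rule alg.poly_mult_closed[OF alg.carrier_is_subring l p(1)])
  have deg: "length ?q - 1 = Suc (length es)"
    using alg.poly_mult_degree_eq[OF alg.carrier_is_subring l p(1)] p(2,3) by simp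
  have ev: "alg.eval ?q x = root_prod (e # es) x" for x
  proof -
    have "alg.eval ?l x = x \<^bold>- e" by (simp add: sub_def a_minus_def)
    then show ?thesis
      using alg.eval_poly_mult[of ?l p x] p(4)[of x] by (simp add: root_prod_def mul_def)
  qed
  have "?q \<noteq> []" "length ?q = Suc (length (e # es))" using deg by auto
  then show ?case
    by (intro exI[of _ ?q] conjI allI ev q[unfolded univ_poly_carrier])
qed

lemma root_prod_eq_neg_one:
  assumes "es \<noteq> []"
  shows "\<exists>x. root_prod es x = neg \<^bold>1"
proof -
  obtain p where p: "polynomial\<^bsub>K\<^esub> (carrier K) p" "p \<noteq> []" "length p = Suc (length es)"
    "\<And>x. alg.eval p x = root_prod es x"
    using root_prod_poly[of es] by (auto simp: univ_poly_def)
  let ?l = "[\<one>\<^bsub>K\<^esub>]" and ?q = "alg.poly_add p [\<one>\<^bsub>K\<^esub>]"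
  have l: "polynomial\<^bsub>K\<^esub> (carrier K) ?l" by (simp add: polynomial_def)
  have q: "?q \<in> carrier (poly_ring K)"
    using alg.poly_add_closed[OF alg.carrier_is_subring p(1) l] by (simp add: univ_poly_def)
  have "length ?q - 1 = length es"
    using alg.poly_add_degree_eq[OF alg.carrier_is_subring p(1) l] p(3) assms by simp
  then have "size (alg.roots ?q) \<noteq> 0"
    using alg.roots_over_carrier[OF q] assms by (simp add: alg.splitted_def)
  then obtain x where "x \<in># alg.roots ?q" by fastforce
  then have "alg.eval ?q x = \<zero>\<^bsub>K\<^esub>"
    using alg.roots_mem_iff_is_root[OF q] by (simp add: alg.is_root_def)
  then have "root_prod es x \<^bold>+ \<^bold>1 = \<^bold>0"
    using alg.eval_poly_add[of p ?l x] p(4) by (simp add: op_defs)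
  then show ?thesis by (metis fld.eq_neg_iff_add_eq_0)
qed

text \<open>Solve \<Prod>(x - e) = -1. If v(x) were negative, all factors and hence the product
  would have negative valuation. So all factors are integral, and since the product has valuation 0,
  none has positive valuation.\<close>

lemma residue_class_avoiding:
  assumes "finite E"
  shows "\<exists>x. \<^bold>1 \<preceq> x \<and> (\<forall>e\<in>E. x \<^bold>- e \<preceq> \<^bold>1)"
proof -
  \<comment> \<open>A non-integral \<open>e\<close> is avoided by every integral \<open>x\<close>,
    so it may be left out; 0 is added to make the list nonempty.\<close>
  obtain es where es: "set es = insert \<^bold>0 {e \<in> E. \<^bold>1 \<preceq> e}"
    using finite_list[of "insert \<^bold>0 {e \<in> E. \<^bold>1 \<preceq> e}"] assms by auto
  then have "es \<noteq> []" by auto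
  then obtain x where x: "root_prod es x = neg \<^bold>1" using root_prod_eq_neg_one by blast
  have O: "\<^bold>1 \<preceq> x"
  proof (rule ccontr)
    assume "\<not> \<^bold>1 \<preceq> x"
    then have lt: "x \<^bold>- e \<prec> \<^bold>1" if "e \<in> set es" for e
    proof -
      have "\<^bold>1 \<preceq> e" using that es by auto
      then have "x \<prec> e" using \<open>\<not> \<^bold>1 \<preceq> x\<close> vlt_vle_trans by simp
      then show ?thesis using veq_vlt(1)[OF sub_veq(1)] \<open>\<not> \<^bold>1 \<preceq> x\<close> by simp
    qed
    have "ds \<noteq> [] \<Longrightarrow> set ds \<subseteq> set es \<Longrightarrow> root_prod ds x \<prec> \<^bold>1" for ds
    proof (induction ds)
      case (Cons d ds)
      then show ?case
        using lt[of d] by (cases "ds = []") (auto simp: root_prod_def intro!: mult_vlt_one vlt_imp_vle)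
    qed simp
    then show False using x \<open>es \<noteq> []\<close> by fastforce
  qed
  have le: "x \<^bold>- e \<preceq> \<^bold>1" if "e \<in> set es" for e
  proof (rule ccontr)
    assume e: "\<not> x \<^bold>- e \<preceq> \<^bold>1"
    have ge: "\<^bold>1 \<preceq> x \<^bold>- d" if "d \<in> set es" for d
      using that es O by (auto intro: vle_sub)
    have "set ds \<subseteq> set es \<Longrightarrow> \<^bold>1 \<preceq> root_prod ds x \<and> (e \<in> set ds \<longrightarrow> \<^bold>1 \<prec> root_prod ds x)" for ds
    proof (induction ds)
      case (Cons d ds)
      then have "\<^bold>1 \<preceq> x \<^bold>- d" and IH: "\<^bold>1 \<preceq> root_prod ds x" "e \<in> set ds \<longrightarrow> \<^bold>1 \<prec> root_prod ds x"
        using ge by auto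
      moreover have "\<^bold>1 \<prec> (x \<^bold>- d) \<^bold>* root_prod ds x" if "e = d \<or> e \<in> set ds"
        using that
      proof
        assume "e = d"
        then show ?thesis using e IH by (intro one_vlt_mult) auto
      next
        assume "e \<in> set ds"
        then show ?thesis
          using IH \<open>\<^bold>1 \<preceq> x \<^bold>- d\<close> one_vlt_mult[of "root_prod ds x" "x \<^bold>- d"]
          by (simp add: fld.mult_commute)
      qed
      ultimately show ?case by (auto simp: root_prod_def intro: one_vle_mult)
    qed (simp add: root_prod_def)
    then show False using x that by fastforce
  qed
  have "x \<^bold>- e \<preceq> \<^bold>1" if "e \<in> E" for e
  proof (cases "\<^bold>1 \<preceq> e")
    case True
    then show ?thesis using le es that by auto
  next
    case False
    then have "e \<prec> x" using O by (auto intro: vlt_vle_trans)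
    then show ?thesis using veq_vle(1)[OF sub_veq(2)] False by (simp add: vlt_imp_vle)
  qed
  then show ?thesis using O by blast
qed

end

section \<open>Consequences of C-minimality and saturation\<close>

locale C_minimal_field = valued_acf L M
  for L :: "('f, 'r) vf_signature" and M :: "('f, 'r, 'a) fo_struct" +
  assumes C_min: "C_minimal L M"
    and sat: "\<exists>\<kappa>. natLeq <o \<kappa> \<and> saturated L \<kappa> M"
begin

section \<open>Finite data that determine a definable set\<close>

lemma closed_ball_iff: "x \<in> closed_ball L M a c \<longleftrightarrow> c \<preceq> x \<^bold>- a"
  by (simp add: closed_ball_def sub_def)

lemma open_ball_iff: "x \<in> open_ball L M a c \<longleftrightarrow> c \<prec> x \<^bold>- a"
  by (simp add: open_ball_def sub_def)

lemma unary_definable: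
  assumes "dpred (\<lambda>e. P (e 0))"
  shows "\<exists>A. finite A \<and> definable_over L M A 1 ((\<lambda>x. [x]) ` Collect P)"
  by (rule definable_dpred[OF assms]) auto

text \<open>Balls are tests comparing v(x - a) with v(c), and a point is the closed ball of radius
  v(0) = \<infinity>. Boolean operations only collect the tests.\<close>

lemma boolean_combination_separated:
  assumes "Y \<in> boolean_combinations ({B. is_ball L M B} \<union> {{a} | a. True})"
  shows "\<exists>A. finite A \<and> (\<forall>x y. (\<forall>(a, c)\<in>A. (c \<preceq> x \<^bold>- a \<longleftrightarrow> c \<preceq> y \<^bold>- a) \<and>
    (c \<prec> x \<^bold>- a \<longleftrightarrow> c \<prec> y \<^bold>- a)) \<longrightarrow> x \<in> Y \<longleftrightarrow> y \<in> Y)"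
  using assms
proof induction
  case (base B)
  then consider a c where "B = closed_ball L M a c" | a c where "B = open_ball L M a c"
    | a where "B = {a}"
    by (auto simp: is_ball_def has_radius_def)
  then show ?case
  proof cases
    case 1
    then show ?thesis by (intro exI[of _ "{(a, c)}"]) (simp add: closed_ball_iff)
  next
    case 2
    then show ?thesis by (intro exI[of _ "{(a, c)}"]) (simp add: open_ball_iff)
  next
    case 3
    then show ?thesis by (intro exI[of _ "{(a, \<^bold>0)}"]) simp
  qed
next
  case (compl Y)
  then show ?case by simp
next
  case (union Y Z)
  then obtain A B where A: "finite A" "\<And>x y. (\<forall>(a, c)\<in>A. (c \<preceq> x \<^bold>- a \<longleftrightarrow> c \<preceq> y \<^bold>- a) \<and>
      (c \<prec> x \<^bold>- a \<longleftrightarrow> c \<prec> y \<^bold>- a)) \<Longrightarrow> x \<in> Y \<longleftrightarrow> y \<in> Y"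
    and B: "finite B" "\<And>x y. (\<forall>(a, c)\<in>B. (c \<preceq> x \<^bold>- a \<longleftrightarrow> c \<preceq> y \<^bold>- a) \<and>
      (c \<prec> x \<^bold>- a \<longleftrightarrow> c \<prec> y \<^bold>- a)) \<Longrightarrow> x \<in> Z \<longleftrightarrow> y \<in> Z"
    by blast
  have "x \<in> Y \<union> Z \<longleftrightarrow> y \<in> Y \<union> Z" if "\<forall>(a, c)\<in>A \<union> B. (c \<preceq> x \<^bold>- a \<longleftrightarrow> c \<preceq> y \<^bold>- a) \<and>
      (c \<prec> x \<^bold>- a \<longleftrightarrow> c \<prec> y \<^bold>- a)" for x y
    using A(2)[of x y] B(2)[of x y] that unfolding ball_Un Un_iff by blast
  then show ?case using A(1) B(1) by (intro exI[of _ "A \<union> B"]) blast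
qed

lemma definable_separated:
  assumes "dpred (\<lambda>e. P (e 0))"
  shows "\<exists>A. finite A \<and> (\<forall>x y. (\<forall>(a, c)\<in>A. (c \<preceq> x \<^bold>- a \<longleftrightarrow> c \<preceq> y \<^bold>- a) \<and>
    (c \<prec> x \<^bold>- a \<longleftrightarrow> c \<prec> y \<^bold>- a)) \<longrightarrow> P x = P y)"
proof -
  have "definable L M 1 ((\<lambda>x. [x]) ` Collect P)"
    using unary_definable[OF assms] definable_over_mono[OF _ subset_UNIV] by blast
  then have "Collect P \<in> boolean_combinations ({B. is_ball L M B} \<union> {{a} | a. True})"
    using C_min unfolding C_minimal_def by blast
  from boolean_combination_separated[OF this] show ?thesis unfolding mem_Collect_eq .
qed

text \<open>If v(x) \<noteq> v(a), then v(x - a) is the smaller of the two. Away from the valuations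
  of centres and radii every test therefore sees only the position of v(x) among them.\<close>

lemma definable_cut:
  assumes "dpred (\<lambda>e. P (e 0))"
  shows "\<exists>E. finite E \<and> (\<forall>x y. (\<forall>e\<in>E. e \<prec> x \<and> e \<prec> y \<or> x \<prec> e \<and> y \<prec> e) \<longrightarrow> P x = P y)"
proof -
  obtain A where A: "finite A" "\<And>x y. (\<forall>(a, c)\<in>A. (c \<preceq> x \<^bold>- a \<longleftrightarrow> c \<preceq> y \<^bold>- a) \<and>
    (c \<prec> x \<^bold>- a \<longleftrightarrow> c \<prec> y \<^bold>- a)) \<Longrightarrow> P x = P y"
    using definable_separated[OF assms] by blast
  have "P x = P y" if xy: "\<forall>e\<in>fst ` A \<union> snd ` A. e \<prec> x \<and> e \<prec> y \<or> x \<prec> e \<and> y \<prec> e" for x y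
  proof (rule A(2), clarify)
    fix a c assume "(a, c) \<in> A"
    then have "a \<in> fst ` A" "c \<in> snd ` A" by (simp_all add: rev_image_eqI)
    then have "a \<prec> x \<and> a \<prec> y \<or> x \<prec> a \<and> y \<prec> a" and c: "c \<prec> x \<and> c \<prec> y \<or> x \<prec> c \<and> y \<prec> c"
      using xy by simp_all
    then consider "x \<^bold>- a \<asymp> a" "y \<^bold>- a \<asymp> a" | "x \<^bold>- a \<asymp> x" "y \<^bold>- a \<asymp> y"
      using sub_veq(1)[of x a] sub_veq(1)[of y a] sub_veq(2)[of a x] sub_veq(2)[of a y] by argo
    then show "(c \<preceq> x \<^bold>- a \<longleftrightarrow> c \<preceq> y \<^bold>- a) \<and> (c \<prec> x \<^bold>- a \<longleftrightarrow> c \<prec> y \<^bold>- a)"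
    proof cases
      case 1
      then show ?thesis
        by (simp add: veq_vle(2)[OF 1(1)] veq_vle(2)[OF 1(2)] veq_vlt(2)[OF 1(1)] veq_vlt(2)[OF 1(2)])
    next
      case 2
      have "(c \<preceq> x \<longleftrightarrow> c \<preceq> y) \<and> (c \<prec> x \<longleftrightarrow> c \<prec> y)"
        using c vlt_iff[of x c] vlt_iff[of y c] vlt_imp_vle[of c x] vlt_imp_vle[of c y]
          vlt_iff[of c x] vlt_iff[of c y] by argo
      then show ?thesis
        by (simp add: veq_vle(2)[OF 2(1)] veq_vle(2)[OF 2(2)] veq_vlt(2)[OF 2(1)] veq_vlt(2)[OF 2(2)])
    qed
  qed
  moreover have "finite (fst ` A \<union> snd ` A)" using A(1) by simp
  ultimately show ?thesis by blast
qed

text \<open>Strong minimality of the residue field: outside the residue classes of the centres, all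
  integral elements have the same distance to each centre, namely 0 for an integral centre
  \<open>a\<close> and v(a) otherwise.\<close>

lemma definable_residue:
  assumes "dpred (\<lambda>e. P (e 0))"
  shows "\<exists>E. finite E \<and> (\<forall>x y. \<^bold>1 \<preceq> x \<and> (\<forall>e\<in>E. x \<^bold>- e \<preceq> \<^bold>1) \<longrightarrow>
    \<^bold>1 \<preceq> y \<and> (\<forall>e\<in>E. y \<^bold>- e \<preceq> \<^bold>1) \<longrightarrow> P x = P y)"
proof -
  obtain A where A: "finite A" "\<And>x y. (\<forall>(a, c)\<in>A. (c \<preceq> x \<^bold>- a \<longleftrightarrow> c \<preceq> y \<^bold>- a) \<and>
    (c \<prec> x \<^bold>- a \<longleftrightarrow> c \<prec> y \<^bold>- a)) \<Longrightarrow> P x = P y"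
    using definable_separated[OF assms] by blast
  have "P x = P y" if x: "\<^bold>1 \<preceq> x \<and> (\<forall>e\<in>fst ` A. x \<^bold>- e \<preceq> \<^bold>1)"
    and y: "\<^bold>1 \<preceq> y \<and> (\<forall>e\<in>fst ` A. y \<^bold>- e \<preceq> \<^bold>1)" for x y
  proof (rule A(2), clarify)
    fix a c assume "(a, c) \<in> A"
    then have "a \<in> fst ` A" by (simp add: rev_image_eqI)
    then have a: "x \<^bold>- a \<preceq> \<^bold>1" "y \<^bold>- a \<preceq> \<^bold>1" using x y by blast+
    have O: "\<^bold>1 \<preceq> x" "\<^bold>1 \<preceq> y" using x y by auto
    have "x \<^bold>- a \<asymp> y \<^bold>- a"
    proof (cases "\<^bold>1 \<preceq> a")
      case True
      then have "\<^bold>1 \<preceq> x \<^bold>- a" "\<^bold>1 \<preceq> y \<^bold>- a" using O by (simp_all add: vle_sub)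
      then have "x \<^bold>- a \<asymp> \<^bold>1" "y \<^bold>- a \<asymp> \<^bold>1" using a by (simp_all add: veq_def)
      then show ?thesis by (rule veq_trans[OF _ veq_sym])
    next
      case False
      then have "a \<prec> \<^bold>1" by simp
      then have "a \<prec> x" "a \<prec> y" using O vlt_vle_trans by blast+
      then show ?thesis by (rule veq_trans[OF sub_veq(2) veq_sym[OF sub_veq(2)]])
    qed
    then show "(c \<preceq> x \<^bold>- a \<longleftrightarrow> c \<preceq> y \<^bold>- a) \<and> (c \<prec> x \<^bold>- a \<longleftrightarrow> c \<prec> y \<^bold>- a)"
      by (simp add: veq_vle(2) veq_vlt(2))
  qed
  moreover have "finite (fst ` A)" using A(1) by simp
  ultimately show ?thesis by blast
qed

lemma finite_vmax: "finite E \<Longrightarrow> E \<noteq> {} \<Longrightarrow> \<exists>m\<in>E. \<forall>e\<in>E. e \<preceq> m"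
proof (induction E rule: finite_ne_induct)
  case (insert x F)
  then obtain m where "m \<in> F" "\<forall>e\<in>F. e \<preceq> m" by blast
  then show ?case using vle_total[of x m] vle_trans[of _ m x] by auto
qed simp

lemma finite_vmin: "finite E \<Longrightarrow> E \<noteq> {} \<Longrightarrow> \<exists>m\<in>E. \<forall>e\<in>E. m \<preceq> e"
proof (induction E rule: finite_ne_induct)
  case (insert x F)
  then obtain m where "m \<in> F" "\<forall>e\<in>F. m \<preceq> e" by blast
  then show ?case using vle_total[of x m] vle_trans[of x m] by auto
qed simp

lemma finite_nonzero_bound:
  assumes "finite E"
  shows "\<exists>d. d \<noteq> \<^bold>0 \<and> (\<forall>e\<in>E. e \<noteq> \<^bold>0 \<longrightarrow> e \<preceq> d)"
proof -
  let ?E = "insert \<^bold>1 {e \<in> E. e \<noteq> \<^bold>0}"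
  have "finite ?E" "?E \<noteq> {}" using assms by auto
  then obtain d where "d \<in> ?E" "\<forall>e\<in>?E. e \<preceq> d" using finite_vmax by blast
  then show ?thesis by (intro exI[of _ d]) auto
qed

lemma ex_larger:
  assumes "d \<noteq> \<^bold>0"
  shows "\<exists>x. x \<noteq> \<^bold>0 \<and> d \<prec> x"
proof -
  obtain p where "p \<noteq> \<^bold>0" "\<^bold>1 \<prec> p" using ex_small' by blast
  then show ?thesis using assms vlt_mult_iff'[of d "\<^bold>1" p] by (intro exI[of _ "d \<^bold>* p"]) simp
qed

text \<open>By \<open>near0_cases\<close> this filter decides every definable predicate: it is the
  type of a nonzero element whose valuation exceeds that of every nonzero element of M.\<close>

definition near0 :: "'a filter" where
  "near0 = (INF d\<in>{d. d \<noteq> \<^bold>0}. principal {x. x \<noteq> \<^bold>0 \<and> d \<prec> x})"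

text \<open>The generic point of the residue field: integral elements outside finitely many residue
  classes.\<close>

definition genr :: "'a filter" where
  "genr = (INF E\<in>{E. finite E}. principal {x. \<^bold>1 \<preceq> x \<and> (\<forall>e\<in>E. x \<^bold>- e \<preceq> \<^bold>1)})"

lemma eventually_near0: "eventually P near0 \<longleftrightarrow> (\<exists>d. d \<noteq> \<^bold>0 \<and> (\<forall>x. x \<noteq> \<^bold>0 \<longrightarrow> d \<prec> x \<longrightarrow> P x))"
proof -
  have "eventually P near0 \<longleftrightarrow> (\<exists>d\<in>{d. d \<noteq> \<^bold>0}. eventually P (principal {x. x \<noteq> \<^bold>0 \<and> d \<prec> x}))"
    unfolding near0_def
  proof (rule eventually_INF_base)
    have "\<^bold>1 \<in> {d. d \<noteq> \<^bold>0}" by simp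
    then show "{d. d \<noteq> \<^bold>0} \<noteq> {}" by blast
    show "\<exists>x\<in>{d. d \<noteq> \<^bold>0}. principal {y. y \<noteq> \<^bold>0 \<and> x \<prec> y} \<le>
        inf (principal {x. x \<noteq> \<^bold>0 \<and> a \<prec> x}) (principal {x. x \<noteq> \<^bold>0 \<and> b \<prec> x})"
      if "a \<in> {d. d \<noteq> \<^bold>0}" "b \<in> {d. d \<noteq> \<^bold>0}" for a b
    proof -
      obtain c where c: "c \<in> {d. d \<noteq> \<^bold>0}" "a \<preceq> c" "b \<preceq> c"
      proof (cases "a \<preceq> b")
        case True
        then show thesis using that vle_refl[of b] \<open>b \<in> _\<close> by blast
      next
        case False
        then have "b \<preceq> a" by (simp add: vlt_imp_vle)
        then show thesis using that vle_refl[of a] \<open>a \<in> _\<close> by blast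
      qed
      then show ?thesis
        using vle_vlt_trans[OF c(2)] vle_vlt_trans[OF c(3)] by (intro bexI[of _ c]) (simp_all add: subset_iff)
    qed
  qed
  then show ?thesis by (auto simp: eventually_principal)
qed

lemma eventually_genr:
  "eventually P genr \<longleftrightarrow> (\<exists>E. finite E \<and> (\<forall>x. \<^bold>1 \<preceq> x \<longrightarrow> (\<forall>e\<in>E. x \<^bold>- e \<preceq> \<^bold>1) \<longrightarrow> P x))"
proof -
  have "eventually P genr \<longleftrightarrow>
      (\<exists>E\<in>{E. finite E}. eventually P (principal {x. \<^bold>1 \<preceq> x \<and> (\<forall>e\<in>E. x \<^bold>- e \<preceq> \<^bold>1)}))"
    unfolding genr_def
  proof (rule eventually_INF_base)
    show "\<exists>x\<in>{E. finite E}. principal {y. \<^bold>1 \<preceq> y \<and> (\<forall>e\<in>x. y \<^bold>- e \<preceq> \<^bold>1)} \<le>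
        inf (principal {x. \<^bold>1 \<preceq> x \<and> (\<forall>e\<in>a. x \<^bold>- e \<preceq> \<^bold>1)}) (principal {x. \<^bold>1 \<preceq> x \<and> (\<forall>e\<in>b. x \<^bold>- e \<preceq> \<^bold>1)})"
      if "a \<in> {E. finite E}" "b \<in> {E. finite E}" for a b
      using that by (intro bexI[of _ "a \<union> b"]) (simp_all add: ball_Un subset_iff)
  qed auto
  then show ?thesis by (auto simp: eventually_principal)
qed

lemma near0_nontrivial [simp]: "near0 \<noteq> bot"
  unfolding trivial_limit_def eventually_near0 using ex_larger by blast

lemma genr_nontrivial [simp]: "genr \<noteq> bot"
  unfolding trivial_limit_def eventually_genr using residue_class_avoiding by blast

lemma eventually_near0_nonzero: "eventually (\<lambda>x. x \<noteq> \<^bold>0) near0"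
  and eventually_near0_vlt: "d \<noteq> \<^bold>0 \<Longrightarrow> eventually (\<lambda>x. d \<prec> x) near0"
  unfolding eventually_near0 by (rule exI[of _ "\<^bold>1"], simp) blast

lemma eventually_genr_integral: "eventually (\<lambda>x. \<^bold>1 \<preceq> x) genr"
  and eventually_genr_avoid: "eventually (\<lambda>x. x \<^bold>- a \<preceq> \<^bold>1) genr"
  unfolding eventually_genr by (blast, intro exI[of _ "{a}"], simp)

lemma eventually_genr_unit: "eventually unit genr"
  using eventually_genr_integral eventually_genr_avoid[of "\<^bold>0"]
  by eventually_elim (simp add: unit_def veq_def)

text \<open>Beyond the largest valuation of a nonzero cut point nothing separates two nonzero
  elements.\<close>

lemma near0_cases:
  assumes "dpred (\<lambda>e. P (e 0))"
  shows "eventually P near0 \<or> eventually (\<lambda>x. \<not> P x) near0"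
proof -
  obtain E where E: "finite E" "\<And>x y. (\<forall>e\<in>E. e \<prec> x \<and> e \<prec> y \<or> x \<prec> e \<and> y \<prec> e) \<Longrightarrow> P x = P y"
    using definable_cut[OF assms] by blast
  obtain d where d: "d \<noteq> \<^bold>0" "\<forall>e\<in>E. e \<noteq> \<^bold>0 \<longrightarrow> e \<preceq> d"
    using finite_nonzero_bound[OF E(1)] by blast
  have "P x = P y" if "x \<noteq> \<^bold>0" "y \<noteq> \<^bold>0" "d \<prec> x" "d \<prec> y" for x y
  proof (rule E(2), rule ballI)
    fix e assume "e \<in> E"
    show "e \<prec> x \<and> e \<prec> y \<or> x \<prec> e \<and> y \<prec> e"
    proof (cases "e = \<^bold>0")
      case False
      then have "e \<preceq> d" using d(2) \<open>e \<in> E\<close> by simp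
      then show ?thesis using vle_vlt_trans that(3,4) by blast
    qed (use that in simp)
  qed
  then have "(\<forall>x. x \<noteq> \<^bold>0 \<longrightarrow> d \<prec> x \<longrightarrow> P x) \<or> (\<forall>x. x \<noteq> \<^bold>0 \<longrightarrow> d \<prec> x \<longrightarrow> \<not> P x)" by blast
  then show ?thesis unfolding eventually_near0 using d(1) by blast
qed

lemma genr_cases:
  assumes "dpred (\<lambda>e. P (e 0))"
  shows "eventually P genr \<or> eventually (\<lambda>x. \<not> P x) genr"
proof -
  let ?A = "\<lambda>E x. \<^bold>1 \<preceq> x \<and> (\<forall>e\<in>E. x \<^bold>- e \<preceq> \<^bold>1)"
  obtain E where E: "finite E" "\<And>x y. ?A E x \<Longrightarrow> ?A E y \<Longrightarrow> P x = P y"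
    using definable_residue[OF assms] by (elim exE conjE) blast
  then have "(\<forall>x. ?A E x \<longrightarrow> P x) \<or> (\<forall>x. ?A E x \<longrightarrow> \<not> P x)" by blast
  then show ?thesis
  proof
    assume "\<forall>x. ?A E x \<longrightarrow> P x"
    then show ?thesis unfolding eventually_genr using E(1) by blast
  next
    assume "\<forall>x. ?A E x \<longrightarrow> \<not> P x"
    then show ?thesis unfolding eventually_genr using E(1) by blast
  qed
qed

text \<open>The quantifier "for all x near 0" is first-order. For \<open>genr\<close> the uniform
  bounds on \<open>big\<close> play the corresponding part.\<close>

lemma dpred_near0 [dfn]:
  assumes "dpred (\<lambda>e. Q (e 0) (\<lambda>i. e (Suc i)))"
  shows "dpred (\<lambda>e. eventually (\<lambda>x. Q x e) near0)"
proof -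
  have "dpred (\<lambda>e. Q (e 0) (\<lambda>i. e (Suc (Suc i))))"
    using dpred_rename[OF assms, of "case_nat 0 (\<lambda>i. Suc (Suc i))"]
    by (auto simp: inj_def split: nat.splits)
  then show ?thesis unfolding eventually_near0 by (intro dfn) auto
qed

lemma eventually_near0_scale:
  assumes "eventually P near0" "a \<noteq> \<^bold>0"
  shows "eventually (\<lambda>x. P (a \<^bold>* x)) near0"
proof -
  obtain d where d: "d \<noteq> \<^bold>0" "\<And>x. x \<noteq> \<^bold>0 \<Longrightarrow> d \<prec> x \<Longrightarrow> P x"
    using assms(1) unfolding eventually_near0 by blast
  have "P (a \<^bold>* x)" if "x \<noteq> \<^bold>0" "d \<^bold>/ a \<prec> x" for x
  proof (rule d(2))
    have "a \<^bold>* (d \<^bold>/ a) = d" using assms(2) by simp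
    then show "d \<prec> a \<^bold>* x" using that(2) vlt_mult_iff'[OF assms(2), of "d \<^bold>/ a" x] by metis
  qed (use that assms(2) in simp)
  then show ?thesis unfolding eventually_near0 using d(1) assms(2) by (intro exI[of _ "d \<^bold>/ a"]) simp
qed

text \<open>The map w \<mapsto> u/w permutes the nonzero residue classes: u/w avoids the class of a
  unit e when w avoids that of u/e, and a non-unit e is avoided automatically.\<close>

lemma eventually_genr_divide:
  assumes "eventually P genr" "unit u"
  shows "eventually (\<lambda>w. P (u \<^bold>/ w)) genr"
proof -
  obtain E where E: "finite E" "\<And>x. \<^bold>1 \<preceq> x \<Longrightarrow> \<forall>e\<in>E. x \<^bold>- e \<preceq> \<^bold>1 \<Longrightarrow> P x"
    using assms(1) unfolding eventually_genr by blast
  have "eventually (\<lambda>w. \<forall>e\<in>E. w \<^bold>- u \<^bold>/ e \<preceq> \<^bold>1) genr"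
    using E(1) by (intro eventually_ball_finite ballI eventually_genr_avoid)
  with eventually_genr_unit show ?thesis
  proof eventually_elim
    case (elim w)
    have w0: "w \<noteq> \<^bold>0" using elim(1) by (rule unit_nonzero)
    show ?case
    proof (rule E(2), use assms(2) elim(1) unit_divide unit_def veq_def in blast, rule ballI)
      fix e assume "e \<in> E"
      show "u \<^bold>/ w \<^bold>- e \<preceq> \<^bold>1"
      proof (cases "unit e")
        case True
        then have e0: "e \<noteq> \<^bold>0" by (rule unit_nonzero)
        have "u \<^bold>/ w \<^bold>- e = neg ((e \<^bold>/ w) \<^bold>* (w \<^bold>- u \<^bold>/ e))"
          using e0 w0 by (simp add: fld.right_diff_distrib)
        also have "\<dots> \<preceq> \<^bold>1"
        proof -
          have "(e \<^bold>/ w) \<^bold>* (w \<^bold>- u \<^bold>/ e) \<asymp> w \<^bold>- u \<^bold>/ e"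
            by (rule unit_mult_veq[OF unit_divide[OF True elim(1)]])
          then show ?thesis using elim(2) \<open>e \<in> E\<close> veq_vle(1) by simp
        qed
        finally show ?thesis .
      next
        case False
        have uw: "u \<^bold>/ w \<asymp> \<^bold>1" using unit_divide[OF assms(2) elim(1)] by (simp add: unit_def)
        consider "e \<prec> \<^bold>1" | "\<^bold>1 \<prec> e" using False by (auto simp: unit_def veq_def)
        then show ?thesis
        proof cases
          case 1
          then have "e \<prec> u \<^bold>/ w" using veq_vlt(2)[OF uw] by simp
          then show ?thesis using veq_vle(1)[OF sub_veq(2)] 1 vlt_imp_vle by simp
        next
          case 2
          then have "u \<^bold>/ w \<prec> e" using veq_vlt(1)[OF uw] by simp
          then show ?thesis using veq_vle(1)[OF sub_veq(1)] veq_vle(1)[OF uw] by simp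
        qed
      qed
    qed
  qed
qed

text \<open>For generic w both w and u/w are generic, and u is their product.\<close>

lemma unit_from_generic:
  assumes "eventually P genr" "\<And>u w. unit u \<Longrightarrow> unit w \<Longrightarrow> P u \<Longrightarrow> P w \<Longrightarrow> P (u \<^bold>* w)" "unit u"
  shows "P u"
proof -
  have "eventually (\<lambda>w. unit w \<and> P w \<and> P (u \<^bold>/ w)) genr"
    using eventually_genr_unit assms(1) eventually_genr_divide[OF assms(1,3)] by eventually_elim simp
  then obtain w where w: "unit w" "P w" "P (u \<^bold>/ w)"
    using eventually_happens'[OF genr_nontrivial] by blast
  then have "P (u \<^bold>/ w \<^bold>* w)" using assms(2,3) unit_divide by blast
  then show ?thesis using unit_nonzero[OF w(1)] by simp
qed

end

section \<open>Definable families over the residue field\<close>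

context C_minimal_field
begin

lemma dfun_apply: "dfun (\<lambda>e. F (e 0)) \<Longrightarrow> dfun x \<Longrightarrow> dfun (\<lambda>e. F (x e))"
  using dfun_comp1[of F x] unfolding dfun_def[of "\<lambda>e. F (e 0)"] by simp

text \<open>At least \<open>n\<close> residue classes contain an element satisfying \<open>P\<close>, in a form that is evidently
  first-order.\<close>

primrec big :: "nat \<Rightarrow> ('a \<Rightarrow> bool) \<Rightarrow> bool" where
  "big 0 P = True"
| "big (Suc n) P = (\<exists>x. \<^bold>1 \<preceq> x \<and> P x \<and> big n (\<lambda>z. P z \<and> z \<^bold>- x \<preceq> \<^bold>1))"

lemma big_mono: "big n P \<Longrightarrow> (\<And>x. P x \<Longrightarrow> Q x) \<Longrightarrow> big n Q"
proof (induction n arbitrary: P Q)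
  case (Suc n)
  then obtain x where x: "\<^bold>1 \<preceq> x" "P x" "big n (\<lambda>z. P z \<and> z \<^bold>- x \<preceq> \<^bold>1)" by auto
  have "big n (\<lambda>z. Q z \<and> z \<^bold>- x \<preceq> \<^bold>1)"
    by (rule Suc.IH[OF x(3)]) (use Suc.prems(2) in simp)
  then show ?case using x(1,2) Suc.prems(2) by auto
qed simp

lemma big_SucD: "big (Suc n) P \<Longrightarrow> big n P"
  by (auto elim: big_mono)

lemma big_antimono: "m \<le> n \<Longrightarrow> big n P \<Longrightarrow> big m P"
  by (induction n rule: dec_induct) (auto dest!: big_SucD simp del: big.simps)

text \<open>Choosing elements of \<open>P\<close> greedily in distinct residue classes must stop
  before the n-th choice.\<close>

lemma not_big_cover:
  "\<not> big n P \<Longrightarrow> \<exists>E. finite E \<and> card E < n \<and> (\<forall>x. \<^bold>1 \<preceq> x \<longrightarrow> P x \<longrightarrow> (\<exists>e\<in>E. \<^bold>1 \<prec> x \<^bold>- e))"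
proof (induction n arbitrary: P)
  case (Suc n)
  show ?case
  proof (cases "\<exists>x. \<^bold>1 \<preceq> x \<and> P x")
    case True
    then obtain x where x: "\<^bold>1 \<preceq> x" "P x" by blast
    then have "\<not> big n (\<lambda>z. P z \<and> z \<^bold>- x \<preceq> \<^bold>1)"
      using Suc.prems unfolding big.simps(2) by blast
    from Suc.IH[OF this] obtain E where E: "finite E" "card E < n"
      "\<And>z. \<^bold>1 \<preceq> z \<Longrightarrow> P z \<and> z \<^bold>- x \<preceq> \<^bold>1 \<Longrightarrow> \<exists>e\<in>E. \<^bold>1 \<prec> z \<^bold>- e" by blast
    have "\<exists>e\<in>insert x E. \<^bold>1 \<prec> z \<^bold>- e" if "\<^bold>1 \<preceq> z" "P z" for z
      using E(3)[OF that(1)] that(2) by (cases "z \<^bold>- x \<preceq> \<^bold>1") auto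
    moreover have "card (insert x E) < Suc n" using E(1,2) by (simp add: card_insert_if)
    ultimately show ?thesis using E(1) by (intro exI[of _ "insert x E"]) simp
  next
    case False
    then show ?thesis
      by (intro exI[of _ "{}"] conjI finite.emptyI) (simp, blast)
  qed
qed simp

text \<open>Pigeonhole principle for residue classes.\<close>

lemma big_avoiding:
  "big n Q \<Longrightarrow> finite E \<Longrightarrow> card E < n \<Longrightarrow> \<exists>x. \<^bold>1 \<preceq> x \<and> Q x \<and> (\<forall>e\<in>E. x \<^bold>- e \<preceq> \<^bold>1)"
proof (induction n arbitrary: Q E)
  case (Suc n)
  then obtain x where x: "\<^bold>1 \<preceq> x" "Q x" "big n (\<lambda>z. Q z \<and> z \<^bold>- x \<preceq> \<^bold>1)" by auto
  show ?case
  proof (cases "\<forall>e\<in>E. x \<^bold>- e \<preceq> \<^bold>1")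
    case True
    then show ?thesis using x by blast
  next
    case False
    then obtain e where e: "e \<in> E" "\<^bold>1 \<prec> x \<^bold>- e" by auto
    have "card (E - {e}) < n" using card_Diff1_less[OF Suc.prems(2) e(1)] Suc.prems(3) by simp
    from Suc.IH[OF x(3) _ this] obtain z where z: "\<^bold>1 \<preceq> z" "Q z" "z \<^bold>- x \<preceq> \<^bold>1"
      "\<forall>d\<in>E - {e}. z \<^bold>- d \<preceq> \<^bold>1" using Suc.prems(2) by blast
    have "z \<^bold>- e \<preceq> \<^bold>1"
    proof (rule ccontr)
      assume "\<not> z \<^bold>- e \<preceq> \<^bold>1"
      then have "\<^bold>1 \<prec> z \<^bold>- x" using vlt_sub_trans[of "\<^bold>1" z e x] e(2) vlt_sub_commute(1)[of "\<^bold>1" x e] by simp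
      then show False using z(3) vlt_iff by blast
    qed
    then have "\<forall>d\<in>E. z \<^bold>- d \<preceq> \<^bold>1" using z(4) by blast
    then show ?thesis using z(1,2) by blast
  qed
qed simp

lemma not_big_eventually:
  assumes "\<not> big n P"
  shows "eventually (\<lambda>x. \<not> P x) genr"
proof -
  obtain E where E: "finite E" "\<And>x. \<^bold>1 \<preceq> x \<Longrightarrow> P x \<Longrightarrow> \<exists>e\<in>E. \<^bold>1 \<prec> x \<^bold>- e"
    using not_big_cover[OF assms] by blast
  have "\<not> P x" if "\<^bold>1 \<preceq> x" "\<forall>e\<in>E. x \<^bold>- e \<preceq> \<^bold>1" for x
    using E(2)[OF that(1)] that(2) vlt_iff by blast
  then show ?thesis unfolding eventually_genr using E(1) by blast
qed

lemma eventually_not_both: "eventually P genr \<Longrightarrow> eventually (\<lambda>x. \<not> P x) genr \<Longrightarrow> False"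
  by (metis (mono_tags, lifting) eventually_happens'[OF genr_nontrivial] eventually_conj)

lemma eventually_big: "eventually P genr \<Longrightarrow> big n P"
  using not_big_eventually eventually_not_both by blast

lemma eventually_not_big:
  assumes "eventually P genr"
  shows "\<exists>n. \<not> big n (\<lambda>x. \<not> P x)"
proof -
  obtain E where E: "finite E" "\<And>x. \<^bold>1 \<preceq> x \<Longrightarrow> \<forall>e\<in>E. x \<^bold>- e \<preceq> \<^bold>1 \<Longrightarrow> P x"
    using assms unfolding eventually_genr by blast
  have "\<not> big (Suc (card E)) (\<lambda>x. \<not> P x)"
    using big_avoiding[of "Suc (card E)" "\<lambda>x. \<not> P x" E] E by blast
  then show ?thesis by blast
qed

section \<open>Uniform bounds in definable families\<close>

lemma dpred_big: "dpred (\<lambda>e. R (e 0) (\<lambda>i. e (Suc i))) \<Longrightarrow> dpred (\<lambda>e. big n (\<lambda>z. R z e))"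
proof (induction n arbitrary: R)
  case 0
  then show ?case by (simp add: dfn)
next
  case (Suc n)
  have "dpred (\<lambda>e. R (e 0) (\<lambda>i. e (Suc (Suc i))))"
    using dpred_rename[OF Suc.prems, of "case_nat 0 (\<lambda>i. Suc (Suc i))"]
    by (auto simp: inj_def split: nat.splits)
  then have "dpred (\<lambda>e. R (e 0) (\<lambda>i. e (Suc (Suc i))) \<and> e 0 \<^bold>- e (Suc 0) \<preceq> \<^bold>1)"
    by (intro dfn)
  then have "dpred (\<lambda>e. big n (\<lambda>z. R z (\<lambda>i. e (Suc i)) \<and> z \<^bold>- e 0 \<preceq> \<^bold>1))"
    by (rule Suc.IH[of "\<lambda>z e. R z (\<lambda>i. e (Suc i)) \<and> z \<^bold>- e 0 \<preceq> \<^bold>1"])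
  then have "dpred (\<lambda>e. \<exists>x. \<^bold>1 \<preceq> x \<and> R x e \<and> big n (\<lambda>z. R z e \<and> z \<^bold>- x \<preceq> \<^bold>1))"
    using Suc.prems by (intro dfn)
  then show ?case by simp
qed

text \<open>Countably many formulas with finitely many parameters each use fewer than \<kappa>
  parameters, and in a nested family a finite intersection is a single member.\<close>

lemma saturation_nested:
  fixes F :: "nat \<Rightarrow> 'a \<Rightarrow> bool"
  assumes def: "\<And>n. dpred (\<lambda>e. F n (e 0))"
    and nonempty: "\<And>n. \<exists>y. F n y"
    and decreasing: "\<And>m n y. m \<le> n \<Longrightarrow> F n y \<Longrightarrow> F m y"
  shows "\<exists>y. \<forall>n. F n y"
proof -
  obtain \<kappa> where \<kappa>: "natLeq <o \<kappa>" "saturated L \<kappa> M" using sat by blast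
  have "\<forall>n. \<exists>A. finite A \<and> definable_over L M A 1 ((\<lambda>x. [x]) ` Collect (F n))"
    using unary_definable[OF def] by blast
  then obtain A where A: "\<And>n. finite (A n)" "\<And>n. definable_over L M (A n) 1 ((\<lambda>x. [x]) ` Collect (F n))"
    by metis
  \<comment> \<open>The added element makes the union nonempty, hence the range of an
    enumeration.\<close>
  let ?A = "insert undefined (\<Union>n. A n)"
  have "countable ?A" using A(1) by (simp add: countable_finite)
  then have "?A = range (from_nat_into ?A)" by (simp add: range_from_nat_into)
  then have "|?A| \<le>o |UNIV :: nat set|" using card_of_image by metis
  then have "|?A| <o \<kappa>"
    using ordLeq_ordIso_trans[OF _ card_of_nat] ordLeq_ordLess_trans \<kappa>(1) by blast
  moreover have "definable_over L M ?A 1 ((\<lambda>x. [x]) ` S)" if S: "S \<in> range (\<lambda>n. Collect (F n))" for S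
  proof -
    obtain n where "S = Collect (F n)" using S by blast
    then show ?thesis using definable_over_mono[OF A(2)[of n], of ?A] by blast
  qed
  moreover have "\<Inter>G \<noteq> {}" if G: "finite G \<and> G \<subseteq> range (\<lambda>n. Collect (F n))" for G
  proof -
    obtain N where N: "finite N" "G = (\<lambda>n. Collect (F n)) ` N"
      using finite_subset_image[of G "\<lambda>n. Collect (F n)" UNIV] G by blast
    obtain y where y: "F (Max (insert 0 N)) y" using nonempty by blast
    have "F n y" if "n \<in> N" for n
      by (rule decreasing[OF _ y]) (use N(1) that in simp)
    then have "y \<in> \<Inter>G" using N(2) by auto
    then show ?thesis by blast
  qed
  ultimately have "\<Inter>(range (\<lambda>n. Collect (F n))) \<noteq> {}"
    using \<kappa>(2) unfolding saturated_def by meson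
  then show ?thesis by blast
qed

text \<open>Without a common bound, saturation would give one \<open>y\<close> for which both
  \<open>R y\<close> and its negation meet infinitely many residue classes, against strong
  minimality.\<close>

lemma uniform_generic:
  assumes "dpred (\<lambda>e. R (e 0) (e 1))"
  shows "\<exists>n. \<forall>y. \<not> big n (R y) \<or> \<not> big n (\<lambda>x. \<not> R y x)"
proof (rule ccontr)
  assume contra: "\<not> ?thesis"
  have R: "dfun x \<Longrightarrow> dfun y \<Longrightarrow> dpred (\<lambda>e. R (x e) (y e))" for x y
    by (rule dpred_comp2[OF assms])
  have "\<exists>y. \<forall>n. big n (R y) \<and> big n (\<lambda>x. \<not> R y x)"
  proof (rule saturation_nested)
    show "dpred (\<lambda>e. big n (R (e 0)) \<and> big n (\<lambda>x. \<not> R (e 0) x))" for n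
      by (intro dpred_big dfn R)
    show "\<exists>y. big n (R y) \<and> big n (\<lambda>x. \<not> R y x)" for n using contra by blast
    show "m \<le> n \<Longrightarrow> big n (R y) \<and> big n (\<lambda>x. \<not> R y x) \<Longrightarrow> big m (R y) \<and> big m (\<lambda>x. \<not> R y x)" for m n y
      using big_antimono by blast
  qed
  then obtain y where y: "\<And>n. big n (R y)" "\<And>n. big n (\<lambda>x. \<not> R y x)" by blast
  have "dpred (\<lambda>e. R y (e 0))" by (intro R dfn)
  from genr_cases[OF this] show False
  proof
    assume "eventually (R y) genr"
    then show False using eventually_not_big y(2) by blast
  next
    assume "eventually (\<lambda>x. \<not> R y x) genr"
    from eventually_not_big[OF this] show False using y(1) by simp
  qed
qed

text \<open>Finitely many witnesses use finitely many \<open>d\<close>, and the one of largest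
  valuation serves them all. The conjunct \<open>Q\<close> absorbs, during the induction, the
  condition of avoiding classes already used.\<close>

lemma big_increasing_union:
  assumes "\<And>d d' x. d \<noteq> \<^bold>0 \<Longrightarrow> d' \<noteq> \<^bold>0 \<Longrightarrow> d \<preceq> d' \<Longrightarrow> R d x \<Longrightarrow> R d' x"
  shows "big n (\<lambda>x. (\<exists>d. d \<noteq> \<^bold>0 \<and> R d x) \<and> Q x) \<Longrightarrow> \<exists>d. d \<noteq> \<^bold>0 \<and> big n (\<lambda>x. R d x \<and> Q x)"
proof (induction n arbitrary: Q)
  case 0
  show ?case by (intro exI[of _ "\<^bold>1"]) simp
next
  case (Suc n)
  then obtain x d where x: "\<^bold>1 \<preceq> x" "d \<noteq> \<^bold>0" "R d x" "Q x"
    and "big n (\<lambda>z. ((\<exists>d. d \<noteq> \<^bold>0 \<and> R d z) \<and> Q z) \<and> z \<^bold>- x \<preceq> \<^bold>1)" by auto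
  then have "big n (\<lambda>z. (\<exists>d. d \<noteq> \<^bold>0 \<and> R d z) \<and> (Q z \<and> z \<^bold>- x \<preceq> \<^bold>1))"
    by (simp add: conj_assoc)
  from Suc.IH[OF this] obtain d' where d': "d' \<noteq> \<^bold>0" "big n (\<lambda>z. R d' z \<and> (Q z \<and> z \<^bold>- x \<preceq> \<^bold>1))" by blast
  obtain c where c: "c \<noteq> \<^bold>0" "d \<preceq> c" "d' \<preceq> c"
    using vle_total[of d d'] x(2) d'(1) vle_refl[of d] vle_refl[of d'] by blast
  have "R c x" using assms[OF x(2) c(1,2) x(3)] .
  moreover have "big n (\<lambda>z. (R c z \<and> Q z) \<and> z \<^bold>- x \<preceq> \<^bold>1)"
    by (rule big_mono[OF d'(2)]) (use assms[OF d'(1) c(1,3)] in simp)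
  ultimately show ?case using x(1,4) c(1) by auto
qed

text \<open>Let \<open>n\<close> be the uniform bound. Some single member of the family already
  meets \<open>n\<close> classes, so its complement does not, and the member is generic.\<close>

lemma increasing_generic:
  assumes "dpred (\<lambda>e. R (e 0) (e 1))"
    and mono: "\<And>d d' x. d \<noteq> \<^bold>0 \<Longrightarrow> d' \<noteq> \<^bold>0 \<Longrightarrow> d \<preceq> d' \<Longrightarrow> R d x \<Longrightarrow> R d' x"
    and ev: "eventually (\<lambda>x. \<exists>d. d \<noteq> \<^bold>0 \<and> R d x) genr"
  shows "\<exists>d. d \<noteq> \<^bold>0 \<and> eventually (R d) genr"
proof -
  obtain n where n: "\<And>y. \<not> big n (R y) \<or> \<not> big n (\<lambda>x. \<not> R y x)"
    using uniform_generic[OF assms(1)] by blast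
  have "big n (\<lambda>x. (\<exists>d. d \<noteq> \<^bold>0 \<and> R d x) \<and> True)" using eventually_big[OF ev] by simp
  with mono have "\<exists>d. d \<noteq> \<^bold>0 \<and> big n (\<lambda>x. R d x \<and> True)"
    by (rule big_increasing_union[where R = R and Q = "\<lambda>_. True"])
  then obtain d where d: "d \<noteq> \<^bold>0" "big n (\<lambda>x. R d x \<and> True)" by blast
  then have "\<not> big n (\<lambda>x. \<not> R d x)" using n[of d] by simp
  from not_big_eventually[OF this] have "eventually (R d) genr" by simp
  then show ?thesis using d(1) by blast
qed

section \<open>Definable total preorders on residue classes\<close>

lemma big_least:
  assumes total: "\<forall>a b. T a b \<or> T b a" and trans: "\<forall>a b c. T a b \<longrightarrow> T b c \<longrightarrow> T a c"
  shows "big (Suc k) P \<Longrightarrow> \<exists>b. P b \<and> big (Suc k) (\<lambda>a. P a \<and> T b a)"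
proof (induction k arbitrary: P)
  case 0
  then obtain x where "\<^bold>1 \<preceq> x" "P x" by auto
  moreover have "T x x" using total by blast
  ultimately show ?case by auto
next
  case (Suc k)
  from Suc.prems obtain x where x: "\<^bold>1 \<preceq> x" "P x" "big (Suc k) (\<lambda>z. P z \<and> z \<^bold>- x \<preceq> \<^bold>1)"
    unfolding big.simps(2)[of "Suc k"] by blast
  from Suc.IH[OF x(3)] obtain b where b: "P b" "b \<^bold>- x \<preceq> \<^bold>1"
    "big (Suc k) (\<lambda>a. (P a \<and> a \<^bold>- x \<preceq> \<^bold>1) \<and> T b a)" by blast
  show ?case
  \<comment> \<open>The smaller of \<open>x\<close> and the least element \<open>b\<close> of the
    other classes is least among all.\<close>
  proof (cases "T b x")
    case True
    have "big (Suc k) (\<lambda>a. (P a \<and> T b a) \<and> a \<^bold>- x \<preceq> \<^bold>1)"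
      by (rule big_mono[OF b(3)]) simp
    then have "big (Suc (Suc k)) (\<lambda>a. P a \<and> T b a)"
      unfolding big.simps(2)[of "Suc k"] using x(1,2) True by blast
    then show ?thesis using b(1) by blast
  next
    case False
    then have "T x b" using total by blast
    have "big (Suc k) (\<lambda>a. (P a \<and> T x a) \<and> a \<^bold>- x \<preceq> \<^bold>1)"
      by (rule big_mono[OF b(3)]) (use trans \<open>T x b\<close> in blast)
    moreover have "T x x" using total by blast
    ultimately have "big (Suc (Suc k)) (\<lambda>a. P a \<and> T x a)"
      unfolding big.simps(2)[of "Suc k"] using x(1,2) by blast
    then show ?thesis using x(2) by blast
  qed
qed

text \<open>The least of many residue classes lies below all the others, while by the uniform bound an
  element that is not below the generic class is below few classes.\<close>

lemma generic_not_below: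
  assumes def: "dpred (\<lambda>e. T (e 0) (e 1))"
    and total: "\<forall>a b. T a b \<or> T b a" and trans: "\<forall>a b c. T a b \<longrightarrow> T b c \<longrightarrow> T a c"
  shows "\<exists>n. \<not> big n (\<lambda>b. eventually (\<lambda>a. \<not> T b a) genr)"
proof -
  obtain n where n: "\<And>y. \<not> big n (T y) \<or> \<not> big n (\<lambda>x. \<not> T y x)"
    using uniform_generic[OF def] by blast
  have "\<not> big (Suc n) (\<lambda>b. eventually (\<lambda>a. \<not> T b a) genr)"
  proof
    assume "big (Suc n) (\<lambda>b. eventually (\<lambda>a. \<not> T b a) genr)"
    from big_least[of T, OF total trans this] obtain b
      where b: "eventually (\<lambda>a. \<not> T b a) genr"
        "big (Suc n) (\<lambda>a. eventually (\<lambda>a'. \<not> T a a') genr \<and> T b a)" by blast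
    have "big n (\<lambda>a. eventually (\<lambda>a'. \<not> T a a') genr \<and> T b a)"
      by (rule big_SucD[OF b(2)])
    then have "big n (T b)" by (rule big_mono) simp
    then show False using n[of b] eventually_big[OF b(1)] by blast
  qed
  then show ?thesis by blast
qed

text \<open>\<open>generic_not_below\<close> is used for \<open>T\<close> and for its converse. A
  generic \<open>b\<close> is then generically neither "not below" nor "not above", and
  \<open>genr_cases\<close> turns both negations into positive statements.\<close>

lemma preorder_generic:
  assumes def: "dpred (\<lambda>e. T (e 0) (e 1))"
    and total: "\<forall>a b. T a b \<or> T b a" and trans: "\<forall>a b c. T a b \<longrightarrow> T b c \<longrightarrow> T a c"
  shows "\<exists>b. eventually (\<lambda>a. T a b \<and> T b a) genr"
proof (rule ccontr)
  assume contra: "\<not> ?thesis"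
  have T: "dfun x \<Longrightarrow> dfun y \<Longrightarrow> dpred (\<lambda>e. T (x e) (y e))" for x y
    by (rule dpred_comp2[OF def])
  obtain n where n: "\<not> big n (\<lambda>b. eventually (\<lambda>a. \<not> T b a) genr)"
    using generic_not_below[OF def total trans] by blast
  have def': "dpred (\<lambda>e. T (e 1) (e 0))" by (intro T dfn)
  have "\<exists>n. \<not> big n (\<lambda>b. eventually (\<lambda>a. \<not> T a b) genr)"
    by (rule generic_not_below[OF def']) (use total trans in blast)+
  then obtain m where m: "\<not> big m (\<lambda>b. eventually (\<lambda>a. \<not> T a b) genr)" by blast
  have "eventually (\<lambda>b. \<not> eventually (\<lambda>a. \<not> T b a) genr \<and> \<not> eventually (\<lambda>a. \<not> T a b) genr) genr"
    by (intro eventually_conj not_big_eventually[OF n] not_big_eventually[OF m])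
  then obtain b where b: "\<not> eventually (\<lambda>a. \<not> T b a) genr" "\<not> eventually (\<lambda>a. \<not> T a b) genr"
    using eventually_happens'[OF genr_nontrivial] by blast
  have T1: "dpred (\<lambda>e. T b (e 0))" and T2: "dpred (\<lambda>e. T (e 0) b)" by (intro T dfn)+
  have "eventually (T b) genr" "eventually (\<lambda>a. T a b) genr"
    using genr_cases[OF T1] genr_cases[OF T2] b by blast+
  then have "eventually (\<lambda>a. T a b \<and> T b a) genr" by (simp add: eventually_conj)
  then show False using contra by blast
qed

text \<open>The members of the family that belong to generic residue classes have the same lower cut, and a
  definable set of values is constant near the cut, so that two of them meet.\<close>

lemma residue_value_orthogonal:
  assumes def: "dpred (\<lambda>e. Z (e 0) (e 1))"
    and veq: "\<And>a x y. Z a x \<Longrightarrow> x \<asymp> y \<Longrightarrow> Z a y"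
    and nonempty: "eventually (\<lambda>a. \<exists>x. Z a x) genr"
    and disjoint: "\<And>a b x. Z a x \<Longrightarrow> Z b x \<Longrightarrow> \<^bold>1 \<prec> a \<^bold>- b"
  shows False
proof -
  have Z: "dfun x \<Longrightarrow> dfun y \<Longrightarrow> dpred (\<lambda>e. Z (x e) (y e))" for x y
    by (rule dpred_comp2[OF def])
  \<comment> \<open>The final segment of values generated by the fibre over \<open>a\<close>. Final
    segments are nested, so their inclusion is a total preorder on \<open>a\<close>.\<close>
  define U where "U a y \<longleftrightarrow> (\<exists>x. Z a x \<and> x \<preceq> y)" for a y
  have U: "dfun x \<Longrightarrow> dfun y \<Longrightarrow> dpred (\<lambda>e. U (x e) (y e))" for x y
    unfolding U_def by (rule dpred_comp2) (intro dfn Z)+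
  have up: "U a y" if "U a x" "x \<preceq> y" for a x y
    using that unfolding U_def by (meson vle_trans)
  define T where "T a b \<longleftrightarrow> (\<forall>y. U a y \<longrightarrow> U b y)" for a b
  have "dpred (\<lambda>e. T (e 0) (e 1))" unfolding T_def by (intro dfn U)
  moreover have "T a b \<or> T b a" for a b
  proof (rule ccontr)
    assume "\<not> (T a b \<or> T b a)"
    then obtain x y where "U a x" "\<not> U b x" "U b y" "\<not> U a y" unfolding T_def by blast
    then show False using vle_total[of x y] up by blast
  qed
  moreover have "T a c" if "T a b" "T b c" for a b c using that unfolding T_def by blast
  ultimately obtain b where "eventually (\<lambda>a. T a b \<and> T b a) genr"
    using preorder_generic[of T] by blast
  then have ev: "eventually (\<lambda>a. (\<forall>y. U a y \<longleftrightarrow> U b y) \<and> (\<exists>x. Z a x)) genr"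
    using nonempty unfolding T_def by eventually_elim blast
  then obtain a1 where a1: "\<And>y. U a1 y \<longleftrightarrow> U b y" "\<exists>x. Z a1 x"
    using eventually_happens'[OF genr_nontrivial] by blast
  \<comment> \<open>Two different residue classes whose fibres generate the same final
    segment.\<close>
  have "eventually (\<lambda>a. ((\<forall>y. U a y \<longleftrightarrow> U b y) \<and> (\<exists>x. Z a x)) \<and> a \<^bold>- a1 \<preceq> \<^bold>1) genr"
    by (rule eventually_conj[OF ev eventually_genr_avoid])
  then obtain a2 where a2: "\<And>y. U a2 y \<longleftrightarrow> U b y" "a2 \<^bold>- a1 \<preceq> \<^bold>1"
    using eventually_happens'[OF genr_nontrivial] by blast
  have disj: "\<not> (Z a1 x \<and> Z a2 x)" for x
    using disjoint[of a2 x a1] a2(2) vlt_iff by blast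
  have self: "U b x" if "Z a1 x \<or> Z a2 x" for x
    using that a1(1) a2(1) unfolding U_def by (meson vle_refl)
  show False
  proof (cases "\<exists>y. U b y \<and> (\<forall>z. U b z \<longrightarrow> y \<preceq> z)")
    case True
    then obtain y where y: "U b y" "\<And>z. U b z \<Longrightarrow> y \<preceq> z" by blast
    obtain x1 x2 where x1: "Z a1 x1" "x1 \<preceq> y" and x2: "Z a2 x2" "x2 \<preceq> y"
      using y(1) a1(1) a2(1) unfolding U_def by blast
    have "x1 \<asymp> y" "x2 \<asymp> y" using y(2) self x1 x2 unfolding veq_def by blast+
    then have "Z a1 y" "Z a2 y" using veq x1(1) x2(1) by blast+
    then show False using disj by blast
  next
    case False
    then have no_min: "\<exists>z. U b z \<and> z \<prec> y" if "U b y" for y using that by auto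
    have "dpred (\<lambda>e. Z a1 (e 0))" by (intro Z dfn)
    from definable_cut[OF this] obtain E where E: "finite E"
      "\<And>x y. (\<forall>e\<in>E. e \<prec> x \<and> e \<prec> y \<or> x \<prec> e \<and> y \<prec> e) \<Longrightarrow> Z a1 x = Z a1 y" by blast
    obtain x0 where "U b x0" using a1(2) self by blast
    \<comment> \<open>Inside the segment but below all its cut points, membership in the fibre of
      \<open>a1\<close> is constant, while both fibres have elements there; \<open>x0\<close> only
      makes the set nonempty.\<close>
    then have "finite (insert x0 {e \<in> E. U b e})" "insert x0 {e \<in> E. U b e} \<noteq> {}" using E(1) by auto
    then obtain m where m: "m \<in> insert x0 {e \<in> E. U b e}" "\<forall>e\<in>insert x0 {e \<in> E. U b e}. m \<preceq> e"
      using finite_vmin by blast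
    then have "U b m" using \<open>U b x0\<close> by auto
    then obtain z where z: "U b z" "z \<prec> m" using no_min by blast
    obtain x1 x2 where x1: "Z a1 x1" "x1 \<preceq> z" and x2: "Z a2 x2" "x2 \<preceq> z"
      using z(1) a1(1) a2(1) unfolding U_def by blast
    have Ux: "U b x1" "U b x2" using self x1(1) x2(1) by blast+
    have "Z a1 x1 = Z a1 x2"
    proof (rule E(2), rule ballI)
      fix e assume "e \<in> E"
      show "e \<prec> x1 \<and> e \<prec> x2 \<or> x1 \<prec> e \<and> x2 \<prec> e"
      proof (cases "U b e")
        case True
        then have "z \<prec> e" using m(2) \<open>e \<in> E\<close> vlt_vle_trans[OF z(2)] by blast
        then show ?thesis using vle_vlt_trans[OF x1(2)] vle_vlt_trans[OF x2(2)] by blast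
      next
        case False
        then have "\<not> x1 \<preceq> e" "\<not> x2 \<preceq> e" using up Ux by blast+
        then show ?thesis by simp
      qed
    qed
    then show False using x1(1) x2(1) disj by blast
  qed
qed

end

section \<open>Asymptotics of definable functions\<close>

context C_minimal_field
begin

section \<open>Residues of definable functions near 0\<close>

lemma near0_finite_cases:
  assumes "finite E" "\<And>e. e \<in> E \<Longrightarrow> dpred (\<lambda>v. P e (v 0))"
    and "eventually (\<lambda>x. \<exists>e\<in>E. P e x) near0"
  shows "\<exists>e\<in>E. eventually (P e) near0"
proof (rule ccontr)
  assume "\<not> ?thesis"
  then have "\<forall>e\<in>E. eventually (\<lambda>x. \<not> P e x) near0" using near0_cases[OF assms(2)] by blast
  then have "eventually (\<lambda>x. \<forall>e\<in>E. \<not> P e x) near0" using assms(1) by (simp add: eventually_ball_finite)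
  then have "eventually (\<lambda>x. False) near0" using assms(3) by eventually_elim blast
  then show False by (simp add: trivial_limit_def[symmetric])
qed

lemma genr_finite_cases:
  assumes "finite E" "\<And>e. e \<in> E \<Longrightarrow> dpred (\<lambda>v. P e (v 0))"
    and "eventually (\<lambda>x. \<exists>e\<in>E. P e x) genr"
  shows "\<exists>e\<in>E. eventually (P e) genr"
proof (rule ccontr)
  assume "\<not> ?thesis"
  then have "\<forall>e\<in>E. eventually (\<lambda>x. \<not> P e x) genr" using genr_cases[OF assms(2)] by blast
  then have "eventually (\<lambda>x. \<forall>e\<in>E. \<not> P e x) genr" using assms(1) by (simp add: eventually_ball_finite)
  then have "eventually (\<lambda>x. False) genr" using assms(3) by eventually_elim blast
  then show False by (simp add: trivial_limit_def[symmetric])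
qed

lemma near0_happens: "eventually P near0 \<Longrightarrow> \<exists>x. P x"
  by (rule eventually_happens'[OF near0_nontrivial])

text \<open>If \<open>F\<close> eventually left each residue class,
  \<open>increasing_generic\<close> would give one punctured ball on which it avoids all but
  finitely many classes, and those are avoided on a smaller one. But \<open>F x\<close> lies in its
  own class.\<close>

lemma residue_limit:
  assumes F: "dfun (\<lambda>e. F (e 0))" and O: "eventually (\<lambda>x. \<^bold>1 \<preceq> F x) near0"
  shows "\<exists>a. \<^bold>1 \<preceq> a \<and> eventually (\<lambda>x. \<^bold>1 \<prec> F x \<^bold>- a) near0"
proof (rule ccontr)
  note F' [dfn] = dfun_apply[OF F]
  assume contra: "\<not> ?thesis"
  have no: "eventually (\<lambda>x. F x \<^bold>- a \<preceq> \<^bold>1) near0" if "\<^bold>1 \<preceq> a" for a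
  proof -
    have "dpred (\<lambda>e. \<^bold>1 \<prec> F (e 0) \<^bold>- a)" by (intro dfn)
    from near0_cases[OF this] show ?thesis
    proof
      assume "eventually (\<lambda>x. \<^bold>1 \<prec> F x \<^bold>- a) near0"
      then show ?thesis using contra that by blast
    qed simp
  qed
  let ?R = "\<lambda>d a. \<forall>x. x \<noteq> \<^bold>0 \<longrightarrow> d \<prec> x \<longrightarrow> F x \<^bold>- a \<preceq> \<^bold>1"
  have "\<exists>d. d \<noteq> \<^bold>0 \<and> eventually (?R d) genr"
  proof (rule increasing_generic)
    show "dpred (\<lambda>e. ?R (e 0) (e 1))" by (intro dfn)
    show "?R d' a" if "d \<preceq> d'" "?R d a" for d d' a
      using that vle_vlt_trans[OF that(1)] by blast
    show "eventually (\<lambda>a. \<exists>d. d \<noteq> \<^bold>0 \<and> ?R d a) genr"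
      using eventually_genr_integral by (rule eventually_mono) (use no in \<open>simp add: eventually_near0\<close>)
  qed
  then obtain d E where d: "d \<noteq> \<^bold>0" and E: "finite E"
    "\<And>a. \<^bold>1 \<preceq> a \<Longrightarrow> \<forall>e\<in>E. a \<^bold>- e \<preceq> \<^bold>1 \<Longrightarrow> ?R d a"
    unfolding eventually_genr by blast
  have "eventually (\<lambda>x. \<forall>e\<in>{e \<in> E. \<^bold>1 \<preceq> e}. F x \<^bold>- e \<preceq> \<^bold>1) near0"
    using E(1) no by (intro eventually_ball_finite) auto
  with O eventually_near0_nonzero eventually_near0_vlt[OF d] have "eventually (\<lambda>x. False) near0"
  proof eventually_elim
    case (elim x)
    have "F x \<^bold>- e \<preceq> \<^bold>1" if "e \<in> E" for e
    proof (cases "\<^bold>1 \<preceq> e")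
      case True
      then show ?thesis using elim(4) that by blast
    next
      case False
      then have "e \<prec> F x" using elim(1) vlt_vle_trans by simp
      then show ?thesis using veq_vle(1)[OF sub_veq(2)] False by (simp add: vlt_imp_vle)
    qed
    then have "F x \<^bold>- F x \<preceq> \<^bold>1" using E(2)[OF elim(1)] elim(2,3) by blast
    then show False by simp
  qed
  then show False using near0_happens by blast
qed

text \<open>For a fixed radius the good units are closed under products, because a unit factor does
  not change v(x). So a radius that works for generic units works for all.\<close>

lemma uniform_near0:
  assumes Q: "dpred (\<lambda>e. Q (e 0) (e 1))"
    and cocycle: "\<And>u w x. unit u \<Longrightarrow> unit w \<Longrightarrow> x \<noteq> \<^bold>0 \<Longrightarrow> Q u (w \<^bold>* x) \<Longrightarrow> Q w x \<Longrightarrow> Q (u \<^bold>* w) x"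
    and ev: "eventually (\<lambda>u. eventually (Q u) near0) genr"
  shows "\<exists>d. d \<noteq> \<^bold>0 \<and> (\<forall>u x. unit u \<longrightarrow> x \<noteq> \<^bold>0 \<longrightarrow> d \<prec> x \<longrightarrow> Q u x)"
proof -
  note Q' [dfn] = dpred_comp2[OF Q]
  let ?R = "\<lambda>d u. \<forall>x. x \<noteq> \<^bold>0 \<longrightarrow> d \<prec> x \<longrightarrow> Q u x"
  have "\<exists>d. d \<noteq> \<^bold>0 \<and> eventually (?R d) genr"
  proof (rule increasing_generic)
    show "dpred (\<lambda>e. ?R (e 0) (e 1))" by (intro dfn)
    show "?R d' u" if "d \<preceq> d'" "?R d u" for d d' u
      using that vle_vlt_trans[OF that(1)] by blast
    show "eventually (\<lambda>u. \<exists>d. d \<noteq> \<^bold>0 \<and> ?R d u) genr" using ev unfolding eventually_near0 .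
  qed
  then obtain d where d: "d \<noteq> \<^bold>0" "eventually (?R d) genr" by blast
  have "?R d u" if "unit u" for u
  proof (rule unit_from_generic[OF d(2) _ that])
    fix u w assume uw: "unit u" "unit w" "?R d u" "?R d w"
    show "?R d (u \<^bold>* w)"
    proof (intro allI impI)
      fix x assume x: "x \<noteq> \<^bold>0" "d \<prec> x"
      have "d \<prec> w \<^bold>* x" using veq_vlt(2)[OF unit_mult_veq[OF uw(2)]] x(2) by blast
      moreover have "w \<^bold>* x \<noteq> \<^bold>0" using x(1) unit_nonzero[OF uw(2)] by simp
      ultimately show "Q (u \<^bold>* w) x" using cocycle[OF uw(1,2) x(1)] uw(3,4) x by blast
    qed
  qed
  then show ?thesis using d(1) by blast
qed

text \<open>Transitivity is the cocycle condition for the relation between f(x) and f(ux). The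
  reverse relation is the first one for the inverse unit at the point ux.\<close>

lemma relation_invariance:
  assumes f: "dfun (\<lambda>e. f (e 0))" and S: "dpred (\<lambda>e. S (e 0) (e 1))"
    and trans: "\<And>x y z. S x y \<Longrightarrow> S y z \<Longrightarrow> S x z"
    and ev: "eventually (\<lambda>u. eventually (\<lambda>x. S (f x) (f (u \<^bold>* x))) near0) genr"
  shows "\<exists>d. d \<noteq> \<^bold>0 \<and> (\<forall>u x. unit u \<longrightarrow> x \<noteq> \<^bold>0 \<longrightarrow> d \<prec> x \<longrightarrow> S (f x) (f (u \<^bold>* x)) \<and> S (f (u \<^bold>* x)) (f x))"
proof -
  note f' [dfn] = dfun_apply[OF f]
  note S' [dfn] = dpred_comp2[OF S]
  have "\<exists>d. d \<noteq> \<^bold>0 \<and> (\<forall>u x. unit u \<longrightarrow> x \<noteq> \<^bold>0 \<longrightarrow> d \<prec> x \<longrightarrow> S (f x) (f (u \<^bold>* x)))"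
  proof (rule uniform_near0[OF _ _ ev])
    show "dpred (\<lambda>e. S (f (e 1)) (f (e 0 \<^bold>* e 1)))" by (intro dfn)
    show "S (f x) (f (u \<^bold>* w \<^bold>* x))" if "S (f (w \<^bold>* x)) (f (u \<^bold>* (w \<^bold>* x)))" "S (f x) (f (w \<^bold>* x))" for u w x
      using trans[OF that(2,1)] by (simp add: fld.mult_assoc)
  qed
  then obtain d where d: "d \<noteq> \<^bold>0" "\<And>u x. unit u \<Longrightarrow> x \<noteq> \<^bold>0 \<Longrightarrow> d \<prec> x \<Longrightarrow> S (f x) (f (u \<^bold>* x))" by blast
  have "S (f (u \<^bold>* x)) (f x)" if "unit u" "x \<noteq> \<^bold>0" "d \<prec> x" for u x
  proof -
    have u: "u \<noteq> \<^bold>0" by (rule unit_nonzero[OF that(1)])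
    have "d \<prec> u \<^bold>* x" using veq_vlt(2)[OF unit_mult_veq[OF that(1)]] that(3) by blast
    moreover have "u \<^bold>* x \<noteq> \<^bold>0" using u that(2) by simp
    ultimately have "S (f (u \<^bold>* x)) (f (inv' u \<^bold>* (u \<^bold>* x)))" using d(2) unit_inverse[OF that(1)] by blast
    moreover have "inv' u \<^bold>* (u \<^bold>* x) = x" using u by (simp flip: fld.mult_assoc)
    ultimately show ?thesis by simp
  qed
  then show ?thesis using d by blast
qed

text \<open>For each unit one of the two inequalities holds near 0, and the same one for generic
  units. \<open>relation_invariance\<close> adds its converse.\<close>

lemma val_invariance:
  assumes f: "dfun (\<lambda>e. f (e 0))"
  shows "\<exists>d. d \<noteq> \<^bold>0 \<and> (\<forall>u x. unit u \<longrightarrow> x \<noteq> \<^bold>0 \<longrightarrow> d \<prec> x \<longrightarrow> f (u \<^bold>* x) \<asymp> f x)"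
proof -
  note f' [dfn] = dfun_apply[OF f]
  let ?A = "\<lambda>u. eventually (\<lambda>x. f x \<preceq> f (u \<^bold>* x)) near0"
  let ?B = "\<lambda>u. eventually (\<lambda>x. f (u \<^bold>* x) \<preceq> f x) near0"
  have AB: "?A u \<or> ?B u" for u
  proof -
    have "dpred (\<lambda>e. f (e 0) \<preceq> f (u \<^bold>* e 0))" by (intro dfn)
    from near0_cases[OF this] show ?thesis
    proof
      assume "eventually (\<lambda>x. \<not> f x \<preceq> f (u \<^bold>* x)) near0"
      then have "?B u" by (rule eventually_mono) (simp add: vlt_imp_vle)
      then show ?thesis by blast
    qed blast
  qed
  have "dpred (\<lambda>e. ?A (e 0))" by (intro dfn)
  from genr_cases[OF this] show ?thesis
  proof
    assume ev: "eventually ?A genr"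
    have "\<exists>d. d \<noteq> \<^bold>0 \<and> (\<forall>u x. unit u \<longrightarrow> x \<noteq> \<^bold>0 \<longrightarrow> d \<prec> x \<longrightarrow> f x \<preceq> f (u \<^bold>* x) \<and> f (u \<^bold>* x) \<preceq> f x)"
    proof (rule relation_invariance[where S = "(\<preceq>)", OF f _ _ ev])
      show "dpred (\<lambda>e. e 0 \<preceq> e 1)" by (intro dfn)
      show "x \<preceq> z" if "x \<preceq> y" "y \<preceq> z" for x y z by (rule vle_trans[OF that])
    qed
    then show ?thesis unfolding veq_def by blast
  next
    assume "eventually (\<lambda>u. \<not> ?A u) genr"
    then have ev: "eventually ?B genr" by (rule eventually_mono) (use AB in blast)
    have "\<exists>d. d \<noteq> \<^bold>0 \<and> (\<forall>u x. unit u \<longrightarrow> x \<noteq> \<^bold>0 \<longrightarrow> d \<prec> x \<longrightarrow> f (u \<^bold>* x) \<preceq> f x \<and> f x \<preceq> f (u \<^bold>* x))"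
    proof (rule relation_invariance[where S = "\<lambda>x y. y \<preceq> x", OF f _ _ ev])
      show "dpred (\<lambda>e. e 1 \<preceq> e 0)" by (intro dfn)
      show "z \<preceq> x" if "y \<preceq> x" "z \<preceq> y" for x y z by (rule vle_trans[OF that(2,1)])
    qed
    then show ?thesis unfolding veq_def by blast
  qed
qed

lemma divide_chain: "b \<noteq> \<^bold>0 \<Longrightarrow> (a \<^bold>/ b) \<^bold>* (b \<^bold>/ c) = a \<^bold>/ c"
  by (cases "c = \<^bold>0") simp_all

text \<open>For units, congruence modulo the maximal ideal is equality of leading terms, so this is
  \<open>residue_limit\<close>.\<close>

lemma eventually_rveq_const:
  assumes h: "dfun (\<lambda>e. h (e 0))" and unit: "eventually (\<lambda>x. unit (h x)) near0"
  shows "\<exists>a. unit a \<and> eventually (\<lambda>x. h x \<approx> a) near0"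
proof -
  have "eventually (\<lambda>x. \<^bold>1 \<preceq> h x) near0"
    using unit by (rule eventually_mono) (simp add: unit_def veq_def)
  from residue_limit[OF h this] obtain a where a: "eventually (\<lambda>x. \<^bold>1 \<prec> h x \<^bold>- a) near0" by blast
  have ev: "eventually (\<lambda>x. unit (h x) \<and> h x \<approx> a) near0"
    using a unit
  proof eventually_elim
    case (elim x)
    have "\<^bold>1 \<prec> a \<^bold>- h x" using elim(1) vlt_sub_commute(1) by blast
    then have "a \<approx> h x" using unit_rveqI elim(2) by blast
    then show ?case using rveq_sym elim(2) by blast
  qed
  then obtain x where x: "unit (h x)" "h x \<approx> a" using near0_happens by blast
  then have "unit a" unfolding unit_def using veq_trans[OF veq_sym[OF rveq_veq]] by blast
  moreover have "eventually (\<lambda>x. h x \<approx> a) near0" using ev by (rule eventually_mono) blast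
  ultimately show ?thesis by blast
qed

text \<open>For fixed \<open>u\<close> the ratio h(u, x) = f(ux)/f(x) is eventually a unit and has a
  residue limit; the identity h(uw, x) = h(u, wx) h(w, x) makes the radius independent of
  \<open>u\<close>.\<close>

lemma rv_invariance:
  assumes f: "dfun (\<lambda>e. f (e 0))" and nz: "\<And>x. x \<noteq> \<^bold>0 \<Longrightarrow> f x \<noteq> \<^bold>0"
  shows "\<exists>d. d \<noteq> \<^bold>0 \<and> (\<forall>u x y. unit u \<longrightarrow> x \<noteq> \<^bold>0 \<longrightarrow> y \<noteq> \<^bold>0 \<longrightarrow> d \<prec> x \<longrightarrow> d \<prec> y \<longrightarrow>
    f (u \<^bold>* x) \<^bold>/ f x \<approx> f (u \<^bold>* y) \<^bold>/ f y)"
proof -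
  note f' [dfn] = dfun_apply[OF f]
  obtain d0 where d0: "d0 \<noteq> \<^bold>0" "\<And>u x. unit u \<Longrightarrow> x \<noteq> \<^bold>0 \<Longrightarrow> d0 \<prec> x \<Longrightarrow> f (u \<^bold>* x) \<asymp> f x"
    using val_invariance[OF f] by blast
  let ?h = "\<lambda>u x. f (u \<^bold>* x) \<^bold>/ f x"
  \<comment> \<open>Comparing with \<open>y\<close> near 0 instead of with the residue limit avoids
    naming a limit that depends on \<open>u\<close>.\<close>
  let ?Q = "\<lambda>u x. eventually (\<lambda>y. ?h u x \<approx> ?h u y) near0"
  have "\<exists>d. d \<noteq> \<^bold>0 \<and> (\<forall>u x. unit u \<longrightarrow> x \<noteq> \<^bold>0 \<longrightarrow> d \<prec> x \<longrightarrow> ?Q u x)"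
  proof (rule uniform_near0)
    show "dpred (\<lambda>e. ?Q (e 0) (e 1))" by (intro dfn)
  next
    fix u w x assume uw: "unit u" "unit w" and x: "x \<noteq> \<^bold>0" and Q: "?Q u (w \<^bold>* x)" "?Q w x"
    have w: "w \<noteq> \<^bold>0" by (rule unit_nonzero[OF uw(2)])
    show "?Q (u \<^bold>* w) x"
      using eventually_near0_scale[OF Q(1) w] Q(2) eventually_near0_nonzero
    proof eventually_elim
      case (elim y)
      have "?h u (w \<^bold>* x) \<^bold>* ?h w x \<approx> ?h u (w \<^bold>* y) \<^bold>* ?h w y"
        by (rule rveq_mult[OF elim(1,2)])
      moreover have nzs: "f (w \<^bold>* x) \<noteq> \<^bold>0" "f (w \<^bold>* y) \<noteq> \<^bold>0" using nz w x elim(3) by simp_all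
      ultimately show ?case
        by (simp only: divide_chain[OF nzs(1)] divide_chain[OF nzs(2)] fld.mult_assoc[of u w])
    qed
  next
    show "eventually (\<lambda>u. eventually (?Q u) near0) genr"
      using eventually_genr_unit
    proof (rule eventually_mono)
      fix u assume u: "unit u"
      have "eventually (\<lambda>x. unit (?h u x)) near0"
        using eventually_near0_nonzero eventually_near0_vlt[OF d0(1)]
      proof eventually_elim
        case (elim x)
        then show ?case using veq_unit[OF d0(2)[OF u] nz] by blast
      qed
      moreover have h: "dfun (\<lambda>e. ?h u (e 0))" by (intro dfn)
      ultimately obtain a where a: "eventually (\<lambda>x. ?h u x \<approx> a) near0"
        using eventually_rveq_const[where h = "?h u", OF h] by blast
      show "eventually (?Q u) near0"
        using a
      proof (rule eventually_mono)
        fix x assume x: "?h u x \<approx> a"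
        show "?Q u x" using a by (rule eventually_mono) (rule rveq_trans[OF x rveq_sym])
      qed
    qed
  qed
  then obtain d where d: "d \<noteq> \<^bold>0" "\<And>u x. unit u \<Longrightarrow> x \<noteq> \<^bold>0 \<Longrightarrow> d \<prec> x \<Longrightarrow> ?Q u x" by blast
  have "?h u x \<approx> ?h u y" if "unit u" "x \<noteq> \<^bold>0" "y \<noteq> \<^bold>0" "d \<prec> x" "d \<prec> y" for u x y
  proof -
    have "eventually (\<lambda>z. ?h u x \<approx> ?h u z \<and> ?h u y \<approx> ?h u z) near0"
      using d(2)[OF that(1,2,4)] d(2)[OF that(1,3,5)] by (rule eventually_conj)
    then obtain z where "?h u x \<approx> ?h u z" "?h u y \<approx> ?h u z" using near0_happens by blast
    then show ?thesis by (rule rveq_trans[OF _ rveq_sym])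
  qed
  then show ?thesis using d(1) by blast
qed

lemma veq_imp_unit_multiple: "x \<noteq> \<^bold>0 \<Longrightarrow> x \<asymp> y \<Longrightarrow> unit (y \<^bold>/ x) \<and> y = (y \<^bold>/ x) \<^bold>* x"
  using veq_unit[OF veq_sym] by simp

text \<open>If the leading term of a function depends on the valuation of the argument only, then its
  values fill finitely many cosets of the group of 1-units over each valuation, so that by
  C-minimality only finitely many valuations occur.\<close>

lemma eventually_val_const:
  assumes F: "dfun (\<lambda>e. F (e 0))" and nz: "\<And>x. x \<noteq> \<^bold>0 \<Longrightarrow> F x \<noteq> \<^bold>0"
    and d: "d \<noteq> \<^bold>0" and inv: "\<And>u x. unit u \<Longrightarrow> x \<noteq> \<^bold>0 \<Longrightarrow> d \<prec> x \<Longrightarrow> F (u \<^bold>* x) \<approx> F x"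
  shows "\<exists>e. e \<noteq> \<^bold>0 \<and> eventually (\<lambda>x. F x \<asymp> e) near0"
proof -
  note F' [dfn] = dfun_apply[OF F]
  define Y where "Y y \<longleftrightarrow> (\<exists>x. x \<noteq> \<^bold>0 \<and> d \<prec> x \<and> F x \<approx> y)" for y
  have "dpred (\<lambda>e. Y (e 0))" unfolding Y_def by (intro dfn)
  from definable_cut[OF this] obtain E where E: "finite E"
    "\<And>x y. (\<forall>e\<in>E. e \<prec> x \<and> e \<prec> y \<or> x \<prec> e \<and> y \<prec> e) \<Longrightarrow> Y x = Y y" by blast
  show ?thesis
  proof (cases "\<exists>y. Y y \<and> (\<forall>e\<in>E. \<not> y \<asymp> e)")
    case True
    then obtain y where y: "Y y" "\<And>e. e \<in> E \<Longrightarrow> \<not> y \<asymp> e" by blast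
    have y0: "y \<noteq> \<^bold>0" using y(1) rveq_nonzero unfolding Y_def by blast
    \<comment> \<open>No cut point has the valuation of \<open>y\<close>, so \<open>Y\<close> cannot
      distinguish elements of that valuation.\<close>
    have annulus: "Y y'" if "y' \<asymp> y" for y'
    proof -
      have "Y y = Y y'"
      proof (rule E(2), rule ballI)
        fix e assume "e \<in> E"
        then have "e \<prec> y \<or> y \<prec> e" using y(2) unfolding veq_def by auto
        then show "e \<prec> y \<and> e \<prec> y' \<or> y \<prec> e \<and> y' \<prec> e"
          using veq_vlt[OF that] by blast
      qed
      then show ?thesis using y(1) by simp
    qed
    \<comment> \<open>The residue of F(x)/y, read as a relation between residue classes and
      valuations of \<open>x\<close>; by \<open>annulus\<close> every generic class is
      attained.\<close>
    define Z where "Z a x \<longleftrightarrow> \<^bold>1 \<preceq> a \<and> x \<noteq> \<^bold>0 \<and> d \<prec> x \<and> F x \<approx> a \<^bold>* y" for a x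
    have False
    proof (rule residue_value_orthogonal)
      show "dpred (\<lambda>e. Z (e 0) (e 1))" unfolding Z_def by (intro dfn)
    next
      fix a x x' assume Z: "Z a x" and xx: "x \<asymp> x'"
      have x0: "x \<noteq> \<^bold>0" using Z unfolding Z_def by blast
      obtain u where u: "unit u" "x' = u \<^bold>* x" using veq_imp_unit_multiple[OF x0 xx] by blast
      have "F x' \<approx> F x" unfolding u(2) by (rule inv[OF u(1) x0]) (use Z in \<open>simp add: Z_def\<close>)
      moreover have "d \<prec> x'" using Z veq_vlt(2)[OF xx] unfolding Z_def by blast
      moreover have "x' \<noteq> \<^bold>0" using x0 veq_nonzero[OF xx] by blast
      ultimately show "Z a x'" using Z rveq_trans unfolding Z_def by blast
    next
      show "eventually (\<lambda>a. \<exists>x. Z a x) genr"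
        using eventually_genr_unit eventually_genr_integral
      proof eventually_elim
        case (elim a)
        have "Y (a \<^bold>* y)" by (rule annulus[OF unit_mult_veq[OF elim(1)]])
        then show ?case unfolding Y_def Z_def using elim(2) by blast
      qed
    next
      fix a b x assume "Z a x" "Z b x"
      then have "a \<^bold>* y \<approx> b \<^bold>* y" and b: "\<^bold>1 \<preceq> b"
        unfolding Z_def using rveq_trans[OF rveq_sym] by blast+
      then have "b \<prec> a \<^bold>- b" using rveq_mult_right[OF y0] unfolding rveq_def[symmetric] by blast
      then show "\<^bold>1 \<prec> a \<^bold>- b" by (rule vle_vlt_trans[OF b])
    qed
    then show ?thesis ..
  next
    case False
    have "eventually (\<lambda>x. \<exists>e\<in>E. F x \<asymp> e) near0"
      using eventually_near0_nonzero eventually_near0_vlt[OF d]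
    proof eventually_elim
      case (elim x)
      then have "Y (F x)" unfolding Y_def using rveq_refl[OF nz] by blast
      then show ?case using False by blast
    qed
    moreover have "dpred (\<lambda>v. F (v 0) \<asymp> e)" for e by (intro dfn)
    ultimately obtain e where e: "eventually (\<lambda>x. F x \<asymp> e) near0"
      using near0_finite_cases[where P = "\<lambda>e x. F x \<asymp> e", OF E(1)] by blast
    have "eventually (\<lambda>x. x \<noteq> \<^bold>0 \<and> F x \<asymp> e) near0"
      by (rule eventually_conj[OF eventually_near0_nonzero e])
    then obtain x where "x \<noteq> \<^bold>0" "F x \<asymp> e" using near0_happens by blast
    then have "e \<noteq> \<^bold>0" using nz veq_nonzero by blast
    then show ?thesis using e by blast
  qed
qed

text \<open>\<open>eventually_val_const\<close> applies to x \<mapsto> f(ax)/f(x): its invariance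
  under a unit \<open>u\<close> says that f(uy)/f(y) has the same leading term at y = ax and y =
  x.\<close>

lemma ratio_val_const:
  assumes f: "dfun (\<lambda>e. f (e 0))" and nz: "\<And>x. x \<noteq> \<^bold>0 \<Longrightarrow> f x \<noteq> \<^bold>0" and a: "a \<noteq> \<^bold>0"
  shows "\<exists>e. e \<noteq> \<^bold>0 \<and> eventually (\<lambda>x. f (a \<^bold>* x) \<^bold>/ f x \<asymp> e) near0"
proof -
  note f' [dfn] = dfun_apply[OF f]
  obtain d where d: "d \<noteq> \<^bold>0" "\<And>u x y. unit u \<Longrightarrow> x \<noteq> \<^bold>0 \<Longrightarrow> y \<noteq> \<^bold>0 \<Longrightarrow> d \<prec> x \<Longrightarrow> d \<prec> y \<Longrightarrow>
    f (u \<^bold>* x) \<^bold>/ f x \<approx> f (u \<^bold>* y) \<^bold>/ f y"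
    using rv_invariance[OF f nz] by blast
  have "eventually (\<lambda>x. d \<prec> x \<and> d \<prec> a \<^bold>* x) near0"
    by (intro eventually_conj eventually_near0_vlt[OF d(1)]
        eventually_near0_scale[OF eventually_near0_vlt[OF d(1)] a])
  then obtain d' where d': "d' \<noteq> \<^bold>0" "\<And>x. x \<noteq> \<^bold>0 \<Longrightarrow> d' \<prec> x \<Longrightarrow> d \<prec> x \<and> d \<prec> a \<^bold>* x"
    unfolding eventually_near0 by blast
  show ?thesis
  proof (rule eventually_val_const[where d = d'])
    show "dfun (\<lambda>e. f (a \<^bold>* e 0) \<^bold>/ f (e 0))" by (intro dfn)
    show "f (a \<^bold>* x) \<^bold>/ f x \<noteq> \<^bold>0" if "x \<noteq> \<^bold>0" for x using nz a that by simp
    show "d' \<noteq> \<^bold>0" by (rule d'(1))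
    fix u x assume u: "unit u" and x: "x \<noteq> \<^bold>0" "d' \<prec> x"
    have nzs: "f x \<noteq> \<^bold>0" "f (a \<^bold>* x) \<noteq> \<^bold>0" "f (u \<^bold>* x) \<noteq> \<^bold>0"
      using nz a x(1) unit_nonzero[OF u] by simp_all
    have "f (u \<^bold>* (a \<^bold>* x)) \<^bold>/ f (a \<^bold>* x) \<approx> f (u \<^bold>* x) \<^bold>/ f x"
      using d(2)[OF u, of "a \<^bold>* x" x] d'(2)[OF x] a x(1) by simp
    then have "(f (u \<^bold>* (a \<^bold>* x)) \<^bold>/ f (a \<^bold>* x)) \<^bold>* (f (a \<^bold>* x) \<^bold>/ f (u \<^bold>* x)) \<approx>
        (f (u \<^bold>* x) \<^bold>/ f x) \<^bold>* (f (a \<^bold>* x) \<^bold>/ f (u \<^bold>* x))"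
      using nzs by (subst rveq_mult_right) simp_all
    moreover have "(f (u \<^bold>* (a \<^bold>* x)) \<^bold>/ f (a \<^bold>* x)) \<^bold>* (f (a \<^bold>* x) \<^bold>/ f (u \<^bold>* x)) = f (a \<^bold>* (u \<^bold>* x)) \<^bold>/ f (u \<^bold>* x)"
      by (simp only: divide_chain[OF nzs(2)] fld.mult.left_commute[of u a x])
    moreover have "(f (u \<^bold>* x) \<^bold>/ f x) \<^bold>* (f (a \<^bold>* x) \<^bold>/ f (u \<^bold>* x)) = f (a \<^bold>* x) \<^bold>/ f x"
      using divide_chain[OF nzs(3), of "f (a \<^bold>* x)" "f x"] by (simp only: fld.mult_commute)
    ultimately show "f (a \<^bold>* (u \<^bold>* x)) \<^bold>/ f (u \<^bold>* x) \<approx> f (a \<^bold>* x) \<^bold>/ f x" by simp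
  qed
qed

end

section \<open>Existence of limits\<close>

context C_minimal_field
begin

lemma vlt_inverse: "x \<noteq> \<^bold>0 \<Longrightarrow> y \<noteq> \<^bold>0 \<Longrightarrow> inv' x \<prec> inv' y \<longleftrightarrow> y \<prec> x"
proof -
  assume nz: "x \<noteq> \<^bold>0" "y \<noteq> \<^bold>0"
  have 1: "inv' x \<^bold>* (x \<^bold>* y) = y" using nz by (simp flip: fld.mult_assoc)
  have 2: "inv' y \<^bold>* (x \<^bold>* y) = x" using nz by (simp add: fld.mult.left_commute[of "inv' y"])
  have "x \<^bold>* y \<noteq> \<^bold>0" using nz by simp
  from vlt_mult_iff[OF this, of "inv' x" "inv' y"] show ?thesis unfolding 1 2 by simp
qed

text \<open>The elements \<open>a\<close> for which \<open>F(ax)\<close> and \<open>F(x)\<close> eventually have the same leading term form a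
  definable subgroup. By C-minimality it contains all units, since otherwise the units would have to
  act through a finite group.\<close>

lemma no_slow_decay_nonzero:
  assumes F: "dfun (\<lambda>e. F (e 0))" and nz: "\<And>x. x \<noteq> \<^bold>0 \<Longrightarrow> F x \<noteq> \<^bold>0"
    and pos: "eventually (\<lambda>x. \<^bold>1 \<prec> F x) near0"
    and small: "\<And>e. \<^bold>1 \<prec> e \<Longrightarrow> eventually (\<lambda>x. F x \<prec> e) near0"
  shows False
proof -
  note F' [dfn] = dfun_apply[OF F]
  \<comment> \<open>By \<open>S_mult\<close> and \<open>S_ex\<close> this relation behaves like the
    graph of a homomorphism from the nonzero elements to the nonzero residue classes.\<close>
  define S where "S a b \<longleftrightarrow> eventually (\<lambda>x. F (a \<^bold>* x) \<approx> b \<^bold>* F x) near0" for a b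
  have S': "dfun x \<Longrightarrow> dfun y \<Longrightarrow> dpred (\<lambda>e. S (x e) (y e))" for x y
    unfolding S_def by (rule dpred_comp2) (intro dfn)+
  note S' [dfn]
  have S_mult: "S (a \<^bold>* a') (b \<^bold>* b')" if "S a b" "S a' b'" "a' \<noteq> \<^bold>0" "b \<noteq> \<^bold>0" for a b a' b'
    unfolding S_def
    using eventually_near0_scale[OF that(1)[unfolded S_def] that(3)] that(2)[unfolded S_def]
  proof eventually_elim
    case (elim x)
    have "b \<^bold>* F (a' \<^bold>* x) \<approx> b \<^bold>* (b' \<^bold>* F x)"
      by (rule rveq_mult[OF rveq_refl[OF that(4)] elim(2)])
    with elim(1) show ?case unfolding fld.mult_assoc by (rule rveq_trans)
  qed
  have S_ex: "\<exists>b. unit b \<and> S a b" if a: "a \<noteq> \<^bold>0" for a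
  proof -
    let ?h = "\<lambda>x. F (a \<^bold>* x) \<^bold>/ F x"
    obtain e where e: "e \<noteq> \<^bold>0" "eventually (\<lambda>x. ?h x \<asymp> e) near0"
      using ratio_val_const[OF F nz a] by blast
    have val: "eventually (\<lambda>x. F (a \<^bold>* x) \<asymp> e \<^bold>* F x) near0"
      using e(2) eventually_near0_nonzero
    proof eventually_elim
      case (elim x)
      have "?h x \<^bold>* F x \<asymp> e \<^bold>* F x" by (rule veq_mult[OF elim(1) veq_refl])
      then show ?case using nz[OF elim(2)] by simp
    qed
    \<comment> \<open>Both v(F(ax)) and v(F(x)) are positive and below every v(e) > 0 of M, so they
      cannot differ by a nonzero value; the same argument excludes a negative one.\<close>
    have "\<not> \<^bold>1 \<prec> e"
    proof
      assume "\<^bold>1 \<prec> e"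
      have "eventually (\<lambda>x. False) near0"
        using val pos eventually_near0_scale[OF small[OF \<open>\<^bold>1 \<prec> e\<close>] a]
      proof eventually_elim
        case (elim x)
        have "e \<^bold>* \<^bold>1 \<prec> e \<^bold>* F x" using elim(2) vlt_mult_iff'[OF e(1)] by blast
        then have "e \<prec> F (a \<^bold>* x)" using veq_vlt(2)[OF elim(1)] by simp
        then show False using vlt_trans[OF _ elim(3)] vlt_irrefl by blast
      qed
      then show False using near0_happens by blast
    qed
    moreover have "\<not> e \<prec> \<^bold>1"
    proof
      assume "e \<prec> \<^bold>1"
      then have "\<^bold>1 \<prec> inv' e" using vlt_inverse[of "\<^bold>1" e] e(1) by simp
      have "eventually (\<lambda>x. False) near0"
        using val small[OF \<open>\<^bold>1 \<prec> inv' e\<close>] eventually_near0_scale[OF pos a]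
      proof eventually_elim
        case (elim x)
        have "e \<^bold>* F x \<prec> e \<^bold>* inv' e" using elim(2) vlt_mult_iff'[OF e(1)] by blast
        then have "F (a \<^bold>* x) \<prec> \<^bold>1" using veq_vlt(1)[OF elim(1)] e(1) by simp
        then show False using vlt_trans[OF _ elim(3)] vlt_irrefl by blast
      qed
      then show False using near0_happens by blast
    qed
    ultimately have "e \<asymp> \<^bold>1" by (simp add: veq_def)
    have unit: "eventually (\<lambda>x. unit (?h x)) near0"
      unfolding unit_def using e(2) by (rule eventually_mono) (rule veq_trans[OF _ \<open>e \<asymp> \<^bold>1\<close>])
    have h: "dfun (\<lambda>e. ?h (e 0))" by (intro dfn)
    obtain b where b: "unit b" "eventually (\<lambda>x. ?h x \<approx> b) near0"
      using eventually_rveq_const[where h = ?h, OF h unit] by blast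
    have "S a b" unfolding S_def using b(2) eventually_near0_nonzero
    proof eventually_elim
      case (elim x)
      have "?h x \<^bold>* F x \<approx> b \<^bold>* F x" using elim(1) rveq_mult_right[OF nz[OF elim(2)]] by blast
      then show ?case using nz[OF elim(2)] by simp
    qed
    then show ?thesis using b(1) by blast
  qed
  have unit_trivial: "eventually (\<lambda>x. F (u \<^bold>* x) \<approx> F x) near0" if u: "unit u" for u
  proof -
    \<comment> \<open>By strong minimality the residues taken on units are generic, hence all of
      them, or confined to finitely many classes.\<close>
    let ?I = "\<lambda>b. \<exists>u. unit u \<and> S u b"
    have "dpred (\<lambda>e. ?I (e 0))" by (intro dfn)
    from genr_cases[OF this] show ?thesis
    proof
      assume ev: "eventually ?I genr"
      have I: "?I b" if "unit b" for b
      proof (rule unit_from_generic[OF ev _ that])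
        fix b b' assume b: "unit b" "unit b'" "?I b" "?I b'"
        then obtain w w' where w: "unit w" "S w b" "unit w'" "S w' b'" by blast
        then have "S (w \<^bold>* w') (b \<^bold>* b')" using S_mult unit_nonzero b(1) by blast
        then show "?I (b \<^bold>* b')" using unit_mult[OF w(1,3)] by blast
      qed
      have "dpred (\<lambda>e. S (e 0) \<^bold>1)" by (intro dfn)
      from definable_cut[OF this] obtain E where E: "finite E"
        "\<And>x y. (\<forall>e\<in>E. e \<prec> x \<and> e \<prec> y \<or> x \<prec> e \<and> y \<prec> e) \<Longrightarrow> S x \<^bold>1 = S y \<^bold>1" by blast
      obtain d where d: "d \<noteq> \<^bold>0" "\<And>e. e \<in> E \<Longrightarrow> e \<noteq> \<^bold>0 \<Longrightarrow> e \<preceq> d"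
        using finite_nonzero_bound[OF E(1)] by blast
      obtain a where a: "a \<noteq> \<^bold>0" "d \<prec> a" using ex_larger[OF d(1)] by blast
      obtain b where b: "unit b" "S a b" using S_ex[OF a(1)] by blast
      obtain w where w: "unit w" "S w (inv' b)" using I[OF unit_inverse[OF b(1)]] by blast
      \<comment> \<open>The unit \<open>w\<close> corrects the residue of \<open>a\<close> to 1.
        Beyond all cut points the kernel consists of whole annuli, so it contains uc along with c,
        and therefore \<open>u\<close>.\<close>
      let ?c = "w \<^bold>* a"
      have b0: "b \<noteq> \<^bold>0" by (rule unit_nonzero[OF b(1)])
      have c0: "?c \<noteq> \<^bold>0" using a(1) unit_nonzero[OF w(1)] by simp
      have "S ?c (inv' b \<^bold>* b)" using S_mult[OF w(2) b(2) a(1)] b0 by simp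
      then have c: "S ?c \<^bold>1" using b0 by simp
      have dc: "d \<prec> ?c" using a(2) veq_vlt(2)[OF unit_mult_veq[OF w(1)]] by blast
      then have duc: "d \<prec> u \<^bold>* ?c" using veq_vlt(2)[OF unit_mult_veq[OF u]] by blast
      have "S ?c \<^bold>1 = S (u \<^bold>* ?c) \<^bold>1"
      proof (rule E(2), rule ballI)
        fix e assume "e \<in> E"
        show "e \<prec> ?c \<and> e \<prec> u \<^bold>* ?c \<or> ?c \<prec> e \<and> u \<^bold>* ?c \<prec> e"
        proof (cases "e = \<^bold>0")
          case True
          then show ?thesis using c0 unit_nonzero[OF u] by simp
        next
          case False
          then have "e \<preceq> d" using d(2) \<open>e \<in> E\<close> by blast
          then show ?thesis using vle_vlt_trans dc duc by blast
        qed
      qed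
      then have uc: "S (u \<^bold>* ?c) \<^bold>1" using c by simp
      have "eventually (\<lambda>x. F (u \<^bold>* (?c \<^bold>* x)) \<approx> F (?c \<^bold>* x)) near0"
        using c[unfolded S_def] uc[unfolded S_def]
      proof eventually_elim
        case (elim x)
        have "F (u \<^bold>* ?c \<^bold>* x) \<approx> F (?c \<^bold>* x)" by (rule rveq_trans[OF elim(2) rveq_sym[OF elim(1)]])
        then show ?case by (simp only: fld.mult_assoc)
      qed
      then have "eventually (\<lambda>x. F (u \<^bold>* (?c \<^bold>* (inv' ?c \<^bold>* x))) \<approx> F (?c \<^bold>* (inv' ?c \<^bold>* x))) near0"
        by (rule eventually_near0_scale) (use c0 in simp)
      moreover have "?c \<^bold>* (inv' ?c \<^bold>* x) = x" for x
        using fld.right_inverse[OF c0] fld.mult_assoc[of ?c "inv' ?c" x] by simp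
      ultimately show ?thesis by simp
    next
      assume "eventually (\<lambda>b. \<not> ?I b) genr"
      then obtain E where E: "finite E" "\<And>b. \<^bold>1 \<preceq> b \<Longrightarrow> \<forall>e\<in>E. b \<^bold>- e \<preceq> \<^bold>1 \<Longrightarrow> \<not> ?I b"
        unfolding eventually_genr by blast
      have "eventually (\<lambda>w. \<exists>e\<in>E. S w e) genr"
        using eventually_genr_unit
      proof (rule eventually_mono)
        fix w assume w: "unit w"
        obtain b where b: "unit b" "S w b" using S_ex[OF unit_nonzero[OF w]] by blast
        have "\<not> (\<forall>e\<in>E. b \<^bold>- e \<preceq> \<^bold>1)" using E(2)[of b] b w unfolding unit_def veq_def by blast
        then obtain e where e: "e \<in> E" "\<^bold>1 \<prec> b \<^bold>- e" by auto
        then have "e \<approx> b" using unit_rveqI[OF _ b(1)] vlt_sub_commute(1)[of "\<^bold>1" b e] by blast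
        then have be: "b \<approx> e" by (rule rveq_sym)
        have "S w e" unfolding S_def using b(2)[unfolded S_def] eventually_near0_nonzero
        proof eventually_elim
          case (elim x)
          have "b \<^bold>* F x \<approx> e \<^bold>* F x" using be rveq_mult_right[OF nz[OF elim(2)]] by blast
          with elim(1) show ?case by (rule rveq_trans)
        qed
        then show "\<exists>e\<in>E. S w e" using e(1) by blast
      qed
      moreover have "dpred (\<lambda>v. S (v 0) e)" for e by (intro dfn)
      ultimately obtain e where e: "eventually (\<lambda>w. S w e) genr"
        using genr_finite_cases[where P = "\<lambda>e w. S w e", OF E(1)] by blast
      \<comment> \<open>With finitely many residues one class \<open>e\<close> is generic. A unit is
        a product of two generic ones, so all units have residue e^2; comparison with the unit 1
        shows that this residue is trivial.\<close>
      have e_sq: "S w (e \<^bold>* e)" if w: "unit w" for w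
      proof -
        have "eventually (\<lambda>z. (S z e \<and> S (w \<^bold>/ z) e) \<and> unit z) genr"
          by (intro eventually_conj e eventually_genr_divide[OF e w] eventually_genr_unit)
        then obtain z where z: "S z e" "S (w \<^bold>/ z) e" "unit z"
          using eventually_happens'[OF genr_nontrivial] by blast
        have z0: "z \<noteq> \<^bold>0" by (rule unit_nonzero[OF z(3)])
        obtain x where "F (z \<^bold>* x) \<approx> e \<^bold>* F x" using near0_happens[OF z(1)[unfolded S_def]] by blast
        then have "e \<noteq> \<^bold>0" using rveq_nonzero by fastforce
        from S_mult[OF z(2,1) z0 this] show ?thesis using z0 by simp
      qed
      show ?thesis
        using e_sq[OF u, unfolded S_def] e_sq[OF unit_one, unfolded S_def]
      proof eventually_elim
        case (elim x)
        then show ?case using rveq_trans[OF elim(1) rveq_sym[OF elim(2)]] by simp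
      qed
    qed
  qed
  have "\<exists>d. d \<noteq> \<^bold>0 \<and> (\<forall>u x. unit u \<longrightarrow> x \<noteq> \<^bold>0 \<longrightarrow> d \<prec> x \<longrightarrow> F (u \<^bold>* x) \<approx> F x)"
  proof (rule uniform_near0)
    show "dpred (\<lambda>e. F (e 0 \<^bold>* e 1) \<approx> F (e 1))" by (intro dfn)
    show "F (u \<^bold>* w \<^bold>* x) \<approx> F x" if "F (u \<^bold>* (w \<^bold>* x)) \<approx> F (w \<^bold>* x)" "F (w \<^bold>* x) \<approx> F x" for u w x
      unfolding fld.mult_assoc by (rule rveq_trans[OF that])
    show "eventually (\<lambda>u. eventually (\<lambda>x. F (u \<^bold>* x) \<approx> F x) near0) genr"
      using eventually_genr_unit unit_trivial by (rule eventually_mono)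
  qed
  then obtain d where "d \<noteq> \<^bold>0" "\<And>u x. unit u \<Longrightarrow> x \<noteq> \<^bold>0 \<Longrightarrow> d \<prec> x \<Longrightarrow> F (u \<^bold>* x) \<approx> F x" by blast
  from eventually_val_const[OF F nz this] obtain e where e: "eventually (\<lambda>x. F x \<asymp> e) near0" by blast
  have "eventually (\<lambda>x. F x \<asymp> e \<and> \<^bold>1 \<prec> F x) near0" by (rule eventually_conj[OF e pos])
  then obtain x where "F x \<asymp> e" "\<^bold>1 \<prec> F x" using near0_happens by blast
  then have "\<^bold>1 \<prec> e" using veq_vlt(2) by blast
  have "eventually (\<lambda>x. F x \<asymp> e \<and> F x \<prec> e) near0" by (rule eventually_conj[OF e small[OF \<open>\<^bold>1 \<prec> e\<close>]])
  then obtain y where "F y \<asymp> e" "F y \<prec> e" using near0_happens by blast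
  then show False using veq_vlt(1) vlt_irrefl by blast
qed

text \<open>Near 0 the function has no zeros, since v(F x) lies below a finite value; replacing
  zeros by 1 elsewhere is harmless.\<close>

lemma no_slow_decay:
  assumes F: "dfun (\<lambda>e. F (e 0))" and pos: "eventually (\<lambda>x. \<^bold>1 \<prec> F x) near0"
    and small: "\<And>e. \<^bold>1 \<prec> e \<Longrightarrow> eventually (\<lambda>x. F x \<prec> e) near0"
  shows False
proof -
  note F' [dfn] = dfun_apply[OF F]
  let ?G = "\<lambda>x. if F x = \<^bold>0 then \<^bold>1 else F x"
  obtain p where "\<^bold>1 \<prec> p" using ex_small' by blast
  have "eventually (\<lambda>x. F x \<noteq> \<^bold>0) near0"
    using small[OF \<open>\<^bold>1 \<prec> p\<close>] by (rule eventually_mono) (use zero_vlt in metis)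
  then have FG: "eventually (\<lambda>x. ?G x = F x) near0" by (rule eventually_mono) simp
  show False
  proof (rule no_slow_decay_nonzero[where F = ?G])
    show "dfun (\<lambda>e. ?G (e 0))" by (intro dfn)
    show "eventually (\<lambda>x. \<^bold>1 \<prec> ?G x) near0" using FG pos by eventually_elim simp
    show "eventually (\<lambda>x. ?G x \<prec> e) near0" if "\<^bold>1 \<prec> e" for e
      using FG small[OF that] by eventually_elim simp
  qed simp
qed

lemma no_slow_growth:
  assumes F: "dfun (\<lambda>e. F (e 0))" and neg: "eventually (\<lambda>x. F x \<prec> \<^bold>1) near0"
    and small: "\<And>r. r \<prec> \<^bold>1 \<Longrightarrow> eventually (\<lambda>x. r \<prec> F x) near0"
  shows False
proof (rule no_slow_decay[where F = "\<lambda>x. inv' (F x)"])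
  note F' [dfn] = dfun_apply[OF F]
  show "dfun (\<lambda>e. inv' (F (e 0)))" by (intro dfn)
  show "eventually (\<lambda>x. \<^bold>1 \<prec> inv' (F x)) near0"
    using neg
  proof (rule eventually_mono)
    fix x assume "F x \<prec> \<^bold>1"
    moreover from this have "F x \<noteq> \<^bold>0" using zero_vlt by metis
    ultimately show "\<^bold>1 \<prec> inv' (F x)" using vlt_inverse[of "\<^bold>1" "F x"] by simp
  qed
  fix e assume e: "\<^bold>1 \<prec> e"
  show "eventually (\<lambda>x. inv' (F x) \<prec> e) near0"
  \<comment> \<open>The bound e = 0 has to be treated as well, because v(0) = \<infinity> exceeds
    v(1).\<close>
  proof (cases "e = \<^bold>0")
    case True
    show ?thesis using neg
    proof (rule eventually_mono)
      fix x assume "F x \<prec> \<^bold>1"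
      then have "F x \<noteq> \<^bold>0" using zero_vlt by metis
      then show "inv' (F x) \<prec> e" using True by simp
    qed
  next
    case False
    have "inv' e \<prec> \<^bold>1" using vlt_inverse[of e "\<^bold>1"] e False by simp
    from small[OF this] neg show ?thesis
    proof eventually_elim
      case (elim x)
      have "F x \<noteq> \<^bold>0" using elim(2) zero_vlt by metis
      then show ?case using vlt_inverse[of "F x" "inv' e"] elim(1) False by simp
    qed
  qed
qed

text \<open>Here the radii of the eventual balls have the unattained supremum v(1). No point is a
  common centre, yet all differences F(ax) - F(x) are eventually integral. So F(x) modulo integral
  elements depends on v(x) only, while its values fill a ball of radius below v(1); the value group
  would cover the residue classes in that ball.\<close>

lemma no_limit_chain:
  assumes F: "dfun (\<lambda>e. F (e 0))"
    and chain: "\<And>r. (\<exists>c. eventually (\<lambda>x. r \<preceq> F x \<^bold>- c) near0) \<longleftrightarrow> r \<prec> \<^bold>1"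
    and dense: "\<And>r. r \<prec> \<^bold>1 \<Longrightarrow> \<exists>r'. r \<prec> r' \<and> r' \<prec> \<^bold>1"
  shows False
proof -
  note F' [dfn] = dfun_apply[OF F]
  \<comment> \<open>With \<open>c\<close> in all balls of the chain, v(F(x) - c) would be negative
    and eventually above each negative value.\<close>
  have no_center: "\<exists>r. r \<prec> \<^bold>1 \<and> eventually (\<lambda>x. F x \<^bold>- c \<prec> r) near0" for c
  proof (rule ccontr)
    assume contra: "\<not> ?thesis"
    have ge: "eventually (\<lambda>x. r \<preceq> F x \<^bold>- c) near0" if "r \<prec> \<^bold>1" for r
    proof -
      have "dpred (\<lambda>e. F (e 0) \<^bold>- c \<prec> r)" by (intro dfn)
      from near0_cases[OF this] show ?thesis
      proof
        assume "eventually (\<lambda>x. F x \<^bold>- c \<prec> r) near0"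
        then show ?thesis using contra that by blast
      qed simp
    qed
    show False
    proof (rule no_slow_growth[where F = "\<lambda>x. F x \<^bold>- c"])
      show "dfun (\<lambda>e. F (e 0) \<^bold>- c)" by (intro dfn)
      have "dpred (\<lambda>e. \<^bold>1 \<preceq> F (e 0) \<^bold>- c)" by (intro dfn)
      from near0_cases[OF this] chain[of "\<^bold>1"] show "eventually (\<lambda>x. F x \<^bold>- c \<prec> \<^bold>1) near0" by auto
      show "eventually (\<lambda>x. r \<prec> F x \<^bold>- c) near0" if r: "r \<prec> \<^bold>1" for r
      proof -
        obtain r' where r': "r \<prec> r'" "r' \<prec> \<^bold>1" using dense[OF r] by blast
        show ?thesis using ge[OF r'(2)] by (rule eventually_mono) (rule vlt_vle_trans[OF r'(1)])
      qed
    qed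
  qed
  \<comment> \<open>F(ax) and F(x) are eventually in the same balls of the chain, so a non-integral
    difference would again be of slow growth.\<close>
  have diff: "eventually (\<lambda>x. \<^bold>1 \<preceq> F (a \<^bold>* x) \<^bold>- F x) near0" if a: "a \<noteq> \<^bold>0" for a
  proof (rule ccontr)
    assume contra: "\<not> ?thesis"
    show False
    proof (rule no_slow_growth[where F = "\<lambda>x. F (a \<^bold>* x) \<^bold>- F x"])
      show "dfun (\<lambda>e. F (a \<^bold>* e 0) \<^bold>- F (e 0))" by (intro dfn)
      have "dpred (\<lambda>e. \<^bold>1 \<preceq> F (a \<^bold>* e 0) \<^bold>- F (e 0))" by (intro dfn)
      from near0_cases[OF this] contra show "eventually (\<lambda>x. F (a \<^bold>* x) \<^bold>- F x \<prec> \<^bold>1) near0" by simp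
      show "eventually (\<lambda>x. r \<prec> F (a \<^bold>* x) \<^bold>- F x) near0" if r: "r \<prec> \<^bold>1" for r
      proof -
        obtain r' where r': "r \<prec> r'" "r' \<prec> \<^bold>1" using dense[OF r] by blast
        obtain c where c: "eventually (\<lambda>x. r' \<preceq> F x \<^bold>- c) near0" using chain r'(2) by blast
        show ?thesis using c eventually_near0_scale[OF c a]
        proof eventually_elim
          case (elim x)
          have "r' \<preceq> c \<^bold>- F x" using elim(1) vle_sub_commute(1) by blast
          then show ?case using vle_sub_trans[OF elim(2)] vlt_vle_trans[OF r'(1)] by blast
        qed
      qed
    qed
  qed
  have "\<exists>d. d \<noteq> \<^bold>0 \<and> (\<forall>u x. unit u \<longrightarrow> x \<noteq> \<^bold>0 \<longrightarrow> d \<prec> x \<longrightarrow> \<^bold>1 \<preceq> F (u \<^bold>* x) \<^bold>- F x)"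
  proof (rule uniform_near0)
    show "dpred (\<lambda>e. \<^bold>1 \<preceq> F (e 0 \<^bold>* e 1) \<^bold>- F (e 1))" by (intro dfn)
    show "\<^bold>1 \<preceq> F (u \<^bold>* w \<^bold>* x) \<^bold>- F x"
      if "\<^bold>1 \<preceq> F (u \<^bold>* (w \<^bold>* x)) \<^bold>- F (w \<^bold>* x)" "\<^bold>1 \<preceq> F (w \<^bold>* x) \<^bold>- F x" for u w x
      unfolding fld.mult_assoc by (rule vle_sub_trans[OF that])
    show "eventually (\<lambda>u. eventually (\<lambda>x. \<^bold>1 \<preceq> F (u \<^bold>* x) \<^bold>- F x) near0) genr"
      using eventually_genr_unit by (rule eventually_mono) (rule diff[OF unit_nonzero])
  qed
  then obtain d where d: "d \<noteq> \<^bold>0" "\<And>u x. unit u \<Longrightarrow> x \<noteq> \<^bold>0 \<Longrightarrow> d \<prec> x \<Longrightarrow> \<^bold>1 \<preceq> F (u \<^bold>* x) \<^bold>- F x" by blast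
  define Y where "Y y \<longleftrightarrow> (\<exists>x. x \<noteq> \<^bold>0 \<and> d \<prec> x \<and> \<^bold>1 \<preceq> F x \<^bold>- y)" for y
  have "dpred (\<lambda>e. Y (e 0))" unfolding Y_def by (intro dfn)
  from definable_separated[OF this] obtain A where A: "finite A"
    "\<And>x y. (\<forall>(a, c)\<in>A. (c \<preceq> x \<^bold>- a \<longleftrightarrow> c \<preceq> y \<^bold>- a) \<and> (c \<prec> x \<^bold>- a \<longleftrightarrow> c \<prec> y \<^bold>- a)) \<Longrightarrow> Y x = Y y" by blast
  from no_center have "\<forall>c. \<exists>r. r \<prec> \<^bold>1 \<and> eventually (\<lambda>x. F x \<^bold>- c \<prec> r) near0" by blast
  then obtain \<rho> where \<rho>: "\<And>c. \<rho> c \<prec> \<^bold>1" "\<And>c. eventually (\<lambda>x. F x \<^bold>- c \<prec> \<rho> c) near0" by metis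
  \<comment> \<open>The maximum \<open>r\<close> satisfies v(r) < 0, and near 0 every centre
    \<open>a\<close> of the tests for \<open>Y\<close> has v(F(x) - a) < v(r). The point 0 only
    makes the set nonempty.\<close>
  let ?R = "\<rho> ` insert \<^bold>0 (fst ` A)"
  have "finite ?R" "?R \<noteq> {}" using A(1) by simp_all
  from finite_vmax[OF this] obtain r where r: "r \<in> ?R" "\<forall>s\<in>?R. s \<preceq> r" by (rule bexE)
  have r1: "r \<prec> \<^bold>1" using r(1) \<rho>(1) by (elim imageE) simp
  then have r0: "r \<noteq> \<^bold>0" using zero_vlt by metis
  have "eventually (\<lambda>x. \<forall>a\<in>fst ` A. F x \<^bold>- a \<prec> r) near0"
  proof (rule eventually_ball_finite)
    show "\<forall>a\<in>fst ` A. eventually (\<lambda>x. F x \<^bold>- a \<prec> r) near0"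
    proof
      fix a assume "a \<in> fst ` A"
      then have "\<rho> a \<in> ?R" by blast
      with r(2) have "\<rho> a \<preceq> r" by (rule bspec)
      show "eventually (\<lambda>x. F x \<^bold>- a \<prec> r) near0"
        using \<rho>(2)[of a] by (rule eventually_mono) (rule vlt_vle_trans[OF _ \<open>\<rho> a \<preceq> r\<close>])
    qed
  qed (use A(1) in simp)
  then have "eventually (\<lambda>x. (\<forall>a\<in>fst ` A. F x \<^bold>- a \<prec> r) \<and> x \<noteq> \<^bold>0 \<and> d \<prec> x) near0"
    by (intro eventually_conj eventually_near0_nonzero eventually_near0_vlt[OF d(1)])
  then obtain x0 where x0: "\<And>a. a \<in> fst ` A \<Longrightarrow> F x0 \<^bold>- a \<prec> r" "x0 \<noteq> \<^bold>0" "d \<prec> x0"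
    using near0_happens by blast
  \<comment> \<open>The closed ball of radius v(r) about \<open>F x0\<close> is too small to reach
    any centre of the tests, so its points pass the same tests as \<open>F x0\<close>.\<close>
  have ball: "Y y" if y: "r \<preceq> y \<^bold>- F x0" for y
  proof -
    have "Y (F x0) = Y y"
    proof (rule A(2), clarify)
      fix a c assume "(a, c) \<in> A"
      then have "a \<in> fst ` A" by (simp add: rev_image_eqI)
      moreover have "r \<preceq> F x0 \<^bold>- y" using y vle_sub_commute(1) by blast
      ultimately have "F x0 \<^bold>- a \<prec> F x0 \<^bold>- y" using x0(1) vlt_vle_trans by blast
      then have "F x0 \<^bold>- a \<asymp> y \<^bold>- a" by (rule sub_veq_of_close)
      then show "(c \<preceq> F x0 \<^bold>- a \<longleftrightarrow> c \<preceq> y \<^bold>- a) \<and> (c \<prec> F x0 \<^bold>- a \<longleftrightarrow> c \<prec> y \<^bold>- a)"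
        by (simp add: veq_vle(2) veq_vlt(2))
    qed
    moreover have "Y (F x0)" unfolding Y_def using x0(2,3) by (intro exI[of _ x0]) simp
    ultimately show ?thesis by simp
  qed
  \<comment> \<open>The residue of (F(x) - F(x0))/r as a function of v(x).\<close>
  define Z where "Z a x \<longleftrightarrow> \<^bold>1 \<preceq> a \<and> x \<noteq> \<^bold>0 \<and> d \<prec> x \<and> r \<prec> F x \<^bold>- (F x0 \<^bold>+ r \<^bold>* a)" for a x
  show False
  proof (rule residue_value_orthogonal)
    show "dpred (\<lambda>e. Z (e 0) (e 1))" unfolding Z_def by (intro dfn)
  next
    fix a x x' assume Z: "Z a x" and xx: "x \<asymp> x'"
    have x: "x \<noteq> \<^bold>0" "d \<prec> x" using Z unfolding Z_def by blast+
    obtain u where u: "unit u" "x' = u \<^bold>* x" using veq_imp_unit_multiple[OF x(1) xx] by blast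
    have "\<^bold>1 \<preceq> F x' \<^bold>- F x" unfolding u(2) by (rule d(2)[OF u(1) x])
    then have "r \<prec> F x' \<^bold>- F x" by (rule vlt_vle_trans[OF r1])
    then have "r \<prec> F x' \<^bold>- (F x0 \<^bold>+ r \<^bold>* a)" using Z vlt_sub_trans unfolding Z_def by blast
    moreover have "d \<prec> x'" using x(2) veq_vlt(2)[OF xx] by blast
    moreover have "x' \<noteq> \<^bold>0" using x(1) veq_nonzero[OF xx] by blast
    ultimately show "Z a x'" using Z unfolding Z_def by blast
  next
    show "eventually (\<lambda>a. \<exists>x. Z a x) genr"
      using eventually_genr_integral
    proof (rule eventually_mono)
      fix a assume a: "\<^bold>1 \<preceq> a"
      have "r \<^bold>* \<^bold>1 \<preceq> r \<^bold>* a" using a vle_mult_iff'[OF r0] by blast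
      then have "Y (F x0 \<^bold>+ r \<^bold>* a)" by (intro ball) simp
      then obtain x where x: "x \<noteq> \<^bold>0" "d \<prec> x" "\<^bold>1 \<preceq> F x \<^bold>- (F x0 \<^bold>+ r \<^bold>* a)" unfolding Y_def by blast
      then show "\<exists>x. Z a x" unfolding Z_def using a vlt_vle_trans[OF r1] by blast
    qed
  next
    fix a b x assume "Z a x" "Z b x"
    then have "r \<prec> F x \<^bold>- (F x0 \<^bold>+ r \<^bold>* b)" "r \<prec> (F x0 \<^bold>+ r \<^bold>* a) \<^bold>- F x"
      unfolding Z_def using vlt_sub_commute(1) by blast+
    from this(2,1) have "r \<prec> (F x0 \<^bold>+ r \<^bold>* a) \<^bold>- (F x0 \<^bold>+ r \<^bold>* b)" by (rule vlt_sub_trans)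
    then have "r \<^bold>* \<^bold>1 \<prec> r \<^bold>* (a \<^bold>- b)" by (simp add: fld.right_diff_distrib)
    then show "\<^bold>1 \<prec> a \<^bold>- b" using vlt_mult_iff'[OF r0] by blast
  qed
qed

text \<open>The limit at 0 in valuation form, which is first-order in \<open>l\<close>;
  \<open>converges_limitin\<close> leads back to the topology.\<close>

definition converges :: "('a \<Rightarrow> 'a) \<Rightarrow> 'a \<Rightarrow> bool" where
  "converges F l \<longleftrightarrow> (\<forall>r. r \<noteq> \<^bold>0 \<longrightarrow> eventually (\<lambda>x. r \<preceq> F x \<^bold>- l) near0)"

text \<open>The chain consists of all closed balls that \<open>F\<close> eventually enters, indexed
  by centre and radius so that nothing has to be chosen. Two of them share a value of
  \<open>F\<close> and are therefore nested.\<close>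

lemma complete_limit:
  assumes F: "dfun (\<lambda>e. F (e 0))" and complete: "definably_complete L M"
    and all: "\<And>r. r \<noteq> \<^bold>0 \<Longrightarrow> \<exists>c. eventually (\<lambda>x. r \<preceq> F x \<^bold>- c) near0"
  shows "\<exists>l. converges F l"
proof -
  note F' [dfn] = dfun_apply[OF F]
  let ?I = "{[c, r] | c r. r \<noteq> \<^bold>0 \<and> eventually (\<lambda>x. r \<preceq> F x \<^bold>- c) near0}"
  let ?B = "\<lambda>i. closed_ball L M (i ! 0) (i ! 1)"
  have "dpred (\<lambda>e. e 1 \<noteq> \<^bold>0 \<and> eventually (\<lambda>x. e 1 \<preceq> F x \<^bold>- e 0) near0)" by (intro dfn)
  then have "\<exists>A. finite A \<and> definable_over L M A 2 ?I"
    by (rule definable_dpred) (auto simp: upt_rec)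
  then have I: "definable L M 2 ?I" using definable_over_mono[OF _ subset_UNIV] by blast
  have "dpred (\<lambda>e. (e 1 \<noteq> \<^bold>0 \<and> eventually (\<lambda>x. e 1 \<preceq> F x \<^bold>- e 0) near0) \<and> e 1 \<preceq> e 2 \<^bold>- e 0)" by (intro dfn)
  then have "\<exists>A. finite A \<and> definable_over L M A 3 {i @ [x] | i x. i \<in> ?I \<and> x \<in> ?B i}"
    by (rule definable_dpred) (auto simp: upt_rec closed_ball_iff numeral_2_eq_2)
  then have B: "definable L M (2 + 1) {i @ [x] | i x. i \<in> ?I \<and> x \<in> ?B i}"
    using definable_over_mono[OF _ subset_UNIV] by (simp add: numeral_3_eq_3) blast
  have radius: "has_radius L M (?B i) (i ! 1)" if "i \<in> ?I" for i
    using that by (auto simp: has_radius_def zer_def[symmetric])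
  have sub: "closed_ball L M c' r' \<subseteq> closed_ball L M c r"
    if ev: "eventually (\<lambda>x. r \<preceq> F x \<^bold>- c) near0" "eventually (\<lambda>x. r' \<preceq> F x \<^bold>- c') near0"
      and le: "r \<preceq> r'" for c r c' r'
  proof
    fix y assume y: "y \<in> closed_ball L M c' r'"
    obtain x where x: "r \<preceq> F x \<^bold>- c" "r' \<preceq> F x \<^bold>- c'"
      using near0_happens[OF eventually_conj[OF ev]] by blast
    have "r' \<preceq> y \<^bold>- c'" using y unfolding closed_ball_iff .
    moreover have "r' \<preceq> c' \<^bold>- F x" using x(2) vle_sub_commute(1) by blast
    ultimately have "r' \<preceq> y \<^bold>- F x" by (rule vle_sub_trans)
    then have "r \<preceq> y \<^bold>- F x" by (rule vle_trans[OF le])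
    then show "y \<in> closed_ball L M c r" using vle_sub_trans x(1) unfolding closed_ball_iff by blast
  qed
  have "?B i \<subseteq> ?B j \<or> ?B j \<subseteq> ?B i" if "i \<in> ?I" "j \<in> ?I" for i j
  proof -
    have "eventually (\<lambda>x. i ! 1 \<preceq> F x \<^bold>- i ! 0) near0" "eventually (\<lambda>x. j ! 1 \<preceq> F x \<^bold>- j ! 0) near0"
      using that by auto
    then show ?thesis using sub vle_total[of "i ! 1" "j ! 1"] by blast
  qed
  then have "definable_ball_chain L M 2 ?I ?B"
    unfolding definable_ball_chain_def is_ball_def using I B radius by blast
  moreover have "\<exists>i\<in>?I. \<exists>d. has_radius L M (?B i) d \<and> c \<prec> d" if c: "c \<noteq> \<zero>\<^bsub>K\<^esub>" for c
  proof -
    have "c \<noteq> \<^bold>0" using c by (simp add: zer_def)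
    then obtain r where r: "r \<noteq> \<^bold>0" "c \<prec> r" using ex_larger by blast
    obtain b where "eventually (\<lambda>x. r \<preceq> F x \<^bold>- b) near0" using all[OF r(1)] by blast
    then have i: "[b, r] \<in> ?I" using r(1) by blast
    show ?thesis using radius[OF i] r(2) by (intro bexI[OF _ i] exI[of _ r]) simp
  qed
  ultimately have "(\<Inter>i\<in>?I. ?B i) \<noteq> {}"
    using complete unfolding definably_complete_def by blast
  then obtain l where l: "\<And>i. i \<in> ?I \<Longrightarrow> l \<in> ?B i" by blast
  have "eventually (\<lambda>x. r \<preceq> F x \<^bold>- l) near0" if r: "r \<noteq> \<^bold>0" for r
  proof -
    obtain c where c: "eventually (\<lambda>x. r \<preceq> F x \<^bold>- c) near0" using all[OF r] by blast
    then have "[c, r] \<in> ?I" using r by blast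
    from l[OF this] have "r \<preceq> c \<^bold>- l" unfolding closed_ball_iff using vle_sub_commute(1) by simp
    then show ?thesis using vle_sub_trans by (intro eventually_mono[OF c]) blast
  qed
  then show ?thesis unfolding converges_def by blast
qed

text \<open>The attainable radii form an initial segment, nonempty by the bound on \<open>F\<close>.
  If it is bounded, a maximum contradicts \<open>no_slow_decay\<close>, and otherwise C-minimality
  supplies a supremum, which contradicts \<open>no_limit_chain\<close>.\<close>

lemma bounded_limit:
  assumes F: "dfun (\<lambda>e. F (e 0))" and complete: "definably_complete L M"
    and bounded: "r0 \<noteq> \<^bold>0" "eventually (\<lambda>x. r0 \<preceq> F x) near0"
  shows "\<exists>l. converges F l"
proof (rule complete_limit[OF F complete], rule ccontr)
  note F' [dfn] = dfun_apply[OF F]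
  define R where "R r \<longleftrightarrow> (\<exists>c. eventually (\<lambda>x. r \<preceq> F x \<^bold>- c) near0)" for r
  fix r1 assume r1: "r1 \<noteq> \<^bold>0" "\<not> (\<exists>c. eventually (\<lambda>x. r1 \<preceq> F x \<^bold>- c) near0)"
  then have nR: "\<not> R r1" unfolding R_def by blast
  have Rd: "dpred (\<lambda>e. R (e 0))" unfolding R_def by (intro dfn)
  have down: "R r" if Rr': "R r'" and le: "r \<preceq> r'" for r r'
  proof -
    obtain c where "eventually (\<lambda>x. r' \<preceq> F x \<^bold>- c) near0" using Rr' unfolding R_def by blast
    then have "eventually (\<lambda>x. r \<preceq> F x \<^bold>- c) near0" by (rule eventually_mono) (rule vle_trans[OF le])
    then show ?thesis unfolding R_def by blast
  qed
  have Rr0: "R r0" unfolding R_def using bounded(2) by (intro exI[of _ "\<^bold>0"]) simp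
  have R0: "\<not> R \<^bold>0" using nR down vle_zero by blast
  show False
  proof (cases "\<exists>s. R s \<and> (\<forall>r. R r \<longrightarrow> r \<preceq> s)")
    case True
    then obtain s where s: "R s" "\<And>r. R r \<Longrightarrow> r \<preceq> s" by blast
    have s0: "s \<noteq> \<^bold>0" using s(1) R0 by blast
    obtain c where c: "eventually (\<lambda>x. s \<preceq> F x \<^bold>- c) near0" using s(1) unfolding R_def by blast
    have scale: "r \<preceq> y \<^bold>/ s \<longleftrightarrow> s \<^bold>* r \<preceq> y" for r y
      using vle_mult_iff'[OF s0, of r "y \<^bold>/ s"] s0 by simp
    have "eventually (\<lambda>x. \<^bold>1 \<preceq> (F x \<^bold>- c) \<^bold>/ s) near0"
      using c unfolding scale by simp
    moreover have "dfun (\<lambda>e. (F (e 0) \<^bold>- c) \<^bold>/ s)" by (intro dfn)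
    ultimately obtain a where a: "eventually (\<lambda>x. \<^bold>1 \<prec> (F x \<^bold>- c) \<^bold>/ s \<^bold>- a) near0"
      using residue_limit[where F = "\<lambda>x. (F x \<^bold>- c) \<^bold>/ s"] by blast
    have eq: "(F x \<^bold>- c) \<^bold>/ s \<^bold>- a = (F x \<^bold>- (c \<^bold>+ s \<^bold>* a)) \<^bold>/ s" for x
      using s0 by (simp add: fld.diff_divide_distrib fld.add_divide_distrib fld.diff_diff_add)
    show False
    \<comment> \<open>The residue limit \<open>a\<close> improves the centre beyond radius v(s), but
      maximality of \<open>s\<close> allows no definite gain.\<close>
    proof (rule no_slow_decay[OF _ a])
      show "dfun (\<lambda>e. (F (e 0) \<^bold>- c) \<^bold>/ s \<^bold>- a)" by (intro dfn)
      fix e assume e: "\<^bold>1 \<prec> e"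
      have "s \<^bold>* \<^bold>1 \<prec> s \<^bold>* e" using e vlt_mult_iff'[OF s0] by blast
      then have "s \<prec> s \<^bold>* e" by simp
      then have "\<not> s \<^bold>* e \<preceq> s" unfolding vlt_iff .
      then have "\<not> R (s \<^bold>* e)" using s(2) by blast
      then have no: "\<not> eventually (\<lambda>x. e \<preceq> (F x \<^bold>- c) \<^bold>/ s \<^bold>- a) near0"
        unfolding R_def eq scale by blast
      have "dpred (\<lambda>v. e \<preceq> (F (v 0) \<^bold>- c) \<^bold>/ s \<^bold>- a)" by (intro dfn)
      from near0_cases[OF this] no show "eventually (\<lambda>x. (F x \<^bold>- c) \<^bold>/ s \<^bold>- a \<prec> e) near0" by simp
    qed
  next
    case False
    then have no_max: "\<exists>r'. R r' \<and> r \<prec> r'" if "R r" for r using that by auto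
    from definable_cut[OF Rd] obtain E where E: "finite E"
      "\<And>x y. (\<forall>e\<in>E. e \<prec> x \<and> e \<prec> y \<or> x \<prec> e \<and> y \<prec> e) \<Longrightarrow> R x = R y" by blast
    \<comment> \<open>The supremum is sought as the least cut point outside the segment;
      \<open>r1\<close> makes the set nonempty and keeps the result nonzero.\<close>
    have "finite {e \<in> insert r1 E. \<not> R e}" "{e \<in> insert r1 E. \<not> R e} \<noteq> {}" using E(1) nR by auto
    then obtain s where "s \<in> {e \<in> insert r1 E. \<not> R e}" "\<forall>e\<in>{e \<in> insert r1 E. \<not> R e}. s \<preceq> e"
      using finite_vmin by blast
    then have s: "\<not> R s" "\<And>e. e \<in> E \<Longrightarrow> \<not> R e \<Longrightarrow> s \<preceq> e" "s \<preceq> r1" using nR by blast+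
    have s0: "s \<noteq> \<^bold>0" using s(3) r1(1) zero_vle by metis
    have R_iff: "R r \<longleftrightarrow> r \<prec> s" for r
    proof
      assume "R r"
      then show "r \<prec> s" using down s(1) vlt_iff by blast
    next
      assume rs: "r \<prec> s"
      show "R r"
      proof (rule ccontr)
        assume nr: "\<not> R r"
        \<comment> \<open>An \<open>r\<close> below \<open>s\<close> but outside the segment would
          be on the same side of all cut points as an element \<open>p'\<close> of the segment above
          every cut point inside it.\<close>
        have "finite {e \<in> insert r0 E. R e}" "{e \<in> insert r0 E. R e} \<noteq> {}" using E(1) Rr0 by auto
        then obtain p where p: "p \<in> {e \<in> insert r0 E. R e}" "\<forall>e\<in>{e \<in> insert r0 E. R e}. e \<preceq> p"
          using finite_vmax by blast
        then obtain p' where p': "R p'" "p \<prec> p'" using no_max by blast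
        have "R r = R p'"
        proof (rule E(2), rule ballI)
          fix e assume "e \<in> E"
          show "e \<prec> r \<and> e \<prec> p' \<or> r \<prec> e \<and> p' \<prec> e"
          proof (cases "R e")
            case True
            then have "e \<prec> p'" using p(2) \<open>e \<in> E\<close> vle_vlt_trans[OF _ p'(2)] by blast
            moreover have "e \<prec> r" using nr down[OF True] vlt_iff by blast
            ultimately show ?thesis by blast
          next
            case False
            then have "r \<prec> e" using vlt_vle_trans[OF rs s(2)] \<open>e \<in> E\<close> by blast
            moreover have "p' \<prec> e" using False down[OF p'(1)] vlt_iff by blast
            ultimately show ?thesis by blast
          qed
        qed
        then show False using nr p'(1) by blast
      qed
    qed
    have scale: "r \<preceq> F x \<^bold>/ s \<^bold>- c \<longleftrightarrow> s \<^bold>* r \<preceq> F x \<^bold>- s \<^bold>* c" for r x c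
    proof -
      have "s \<^bold>* (F x \<^bold>/ s \<^bold>- c) = F x \<^bold>- s \<^bold>* c" using s0 by (simp add: fld.right_diff_distrib)
      then show ?thesis using vle_mult_iff'[OF s0, of r "F x \<^bold>/ s \<^bold>- c"] by simp
    qed
    show False
    proof (rule no_limit_chain[where F = "\<lambda>x. F x \<^bold>/ s"])
      show "dfun (\<lambda>e. F (e 0) \<^bold>/ s)" by (intro dfn)
      fix r
      have "(\<exists>c. eventually (\<lambda>x. r \<preceq> F x \<^bold>/ s \<^bold>- c) near0) \<longleftrightarrow> R (s \<^bold>* r)"
      proof
        assume "R (s \<^bold>* r)"
        then obtain c where "eventually (\<lambda>x. s \<^bold>* r \<preceq> F x \<^bold>- c) near0" unfolding R_def by blast
        moreover have "s \<^bold>* (c \<^bold>/ s) = c" using s0 by simp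
        ultimately show "\<exists>c. eventually (\<lambda>x. r \<preceq> F x \<^bold>/ s \<^bold>- c) near0"
          unfolding scale by (intro exI[of _ "c \<^bold>/ s"]) simp
      qed (unfold R_def scale, blast)
      also have "\<dots> \<longleftrightarrow> r \<prec> \<^bold>1" unfolding R_iff using vlt_mult_iff'[OF s0, of r "\<^bold>1"] by simp
      finally show "(\<exists>c. eventually (\<lambda>x. r \<preceq> F x \<^bold>/ s \<^bold>- c) near0) \<longleftrightarrow> r \<prec> \<^bold>1" .
      assume "r \<prec> \<^bold>1"
      then have "R (s \<^bold>* r)" unfolding R_iff using vlt_mult_iff'[OF s0, of r "\<^bold>1"] by simp
      then obtain r' where r': "R r'" "s \<^bold>* r \<prec> r'" using no_max by blast
      have "s \<^bold>* (r' \<^bold>/ s) = r'" using s0 by simp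
      then have "r \<prec> r' \<^bold>/ s" "r' \<^bold>/ s \<prec> \<^bold>1"
        using r' R_iff vlt_mult_iff'[OF s0, of r "r' \<^bold>/ s"] vlt_mult_iff'[OF s0, of "r' \<^bold>/ s" "\<^bold>1"] by simp_all
      then show "\<exists>r'. r \<prec> r' \<and> r' \<prec> \<^bold>1" by blast
    qed
  qed
qed

end

section \<open>The asymptotic endomorphism\<close>

context C_minimal_field
begin

section \<open>Uniqueness and arithmetic of limits\<close>

lemma converges_vlt:
  assumes "converges F l" "r \<noteq> \<^bold>0"
  shows "eventually (\<lambda>x. r \<prec> F x \<^bold>- l) near0"
proof -
  obtain r' where r': "r' \<noteq> \<^bold>0" "r \<prec> r'" using ex_larger[OF assms(2)] by blast
  have "eventually (\<lambda>x. r' \<preceq> F x \<^bold>- l) near0" using assms(1) r'(1) unfolding converges_def by blast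
  then show ?thesis by (rule eventually_mono) (rule vlt_vle_trans[OF r'(2)])
qed

lemma converges_unique:
  assumes "converges F l" "converges F l'"
  shows "l = l'"
proof (rule ccontr)
  assume "l \<noteq> l'"
  then have "l \<^bold>- l' \<noteq> \<^bold>0" by simp
  then have "eventually (\<lambda>x. l \<^bold>- l' \<prec> F x \<^bold>- l \<and> l \<^bold>- l' \<prec> F x \<^bold>- l') near0"
    using converges_vlt assms by (intro eventually_conj)
  then obtain x where x: "l \<^bold>- l' \<prec> F x \<^bold>- l" "l \<^bold>- l' \<prec> F x \<^bold>- l'" using near0_happens by blast
  have "l \<^bold>- l' \<prec> l \<^bold>- F x" using x(1) vlt_sub_commute(1) by blast
  then have "l \<^bold>- l' \<prec> l \<^bold>- l'" using vlt_sub_trans x(2) by blast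
  then show False by simp
qed

lemma converges_rveq:
  assumes "converges F l" "l \<noteq> \<^bold>0"
  shows "eventually (\<lambda>x. F x \<approx> l) near0"
  using converges_vlt[OF assms] unfolding rveq_def .

lemma converges_cong:
  assumes "converges F l" "eventually (\<lambda>x. F x = G x) near0"
  shows "converges G l"
  unfolding converges_def
proof (intro allI impI)
  fix r assume "r \<noteq> \<^bold>0"
  then have "eventually (\<lambda>x. r \<preceq> F x \<^bold>- l) near0" using assms(1) unfolding converges_def by blast
  then show "eventually (\<lambda>x. r \<preceq> G x \<^bold>- l) near0" using assms(2) by eventually_elim simp
qed

lemma converges_scale:
  assumes "converges F l" "a \<noteq> \<^bold>0"
  shows "converges (\<lambda>x. F (a \<^bold>* x)) l"
  unfolding converges_def
proof (intro allI impI)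
  fix r assume "r \<noteq> \<^bold>0"
  then have "eventually (\<lambda>x. r \<preceq> F x \<^bold>- l) near0" using assms(1) unfolding converges_def by blast
  then show "eventually (\<lambda>x. r \<preceq> F (a \<^bold>* x) \<^bold>- l) near0" by (rule eventually_near0_scale) (rule assms(2))
qed

lemma converges_mult:
  assumes F: "converges F l" "l \<noteq> \<^bold>0" and G: "converges G m" "m \<noteq> \<^bold>0"
  shows "converges (\<lambda>x. F x \<^bold>* G x) (l \<^bold>* m)"
  unfolding converges_def
proof (intro allI impI)
  fix r assume "r \<noteq> \<^bold>0"
  then have nz: "r \<^bold>/ m \<noteq> \<^bold>0" "r \<^bold>/ l \<noteq> \<^bold>0" using F G by simp_all
  show "eventually (\<lambda>x. r \<preceq> F x \<^bold>* G x \<^bold>- l \<^bold>* m) near0"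
    using converges_vlt[OF F(1) nz(1)] converges_vlt[OF G(1) nz(2)] converges_rveq[OF G]
  proof eventually_elim
    case (elim x)
    have "(r \<^bold>/ m) \<^bold>* m \<preceq> (F x \<^bold>- l) \<^bold>* m" using elim(1) by (intro vle_mult vlt_imp_vle)
    moreover have "(F x \<^bold>- l) \<^bold>* G x \<asymp> (F x \<^bold>- l) \<^bold>* m"
      by (rule veq_mult[OF veq_refl rveq_veq[OF elim(3)]])
    ultimately have 1: "r \<preceq> (F x \<^bold>- l) \<^bold>* G x" using veq_vle(2) G(2) by simp
    have "(r \<^bold>/ l) \<^bold>* l \<preceq> (G x \<^bold>- m) \<^bold>* l" using elim(2) by (intro vle_mult vlt_imp_vle)
    then have 2: "r \<preceq> l \<^bold>* (G x \<^bold>- m)" using F(2) by (simp add: fld.mult_commute)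
    have "F x \<^bold>* G x \<^bold>- l \<^bold>* m = (F x \<^bold>- l) \<^bold>* G x \<^bold>+ l \<^bold>* (G x \<^bold>- m)"
      by (simp add: fld.left_diff_distrib fld.right_diff_distrib fld.add_diff_eq)
    then show ?case using vle_add[OF 1 2] by simp
  qed
qed

text \<open>A constant valuation both bounds the function and keeps its limit away from 0.\<close>

lemma nonzero_limit:
  assumes F: "dfun (\<lambda>e. F (e 0))" and complete: "definably_complete L M"
    and val: "e \<noteq> \<^bold>0" "eventually (\<lambda>x. F x \<asymp> e) near0"
  shows "\<exists>l. l \<noteq> \<^bold>0 \<and> converges F l"
proof -
  have "eventually (\<lambda>x. e \<preceq> F x) near0" using val(2) by (rule eventually_mono) (simp add: veq_def)
  from bounded_limit[OF F complete val(1) this] obtain l where l: "converges F l" by blast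
  have "l \<noteq> \<^bold>0"
  proof
    assume "l = \<^bold>0"
    have "eventually (\<lambda>x. False) near0"
      using converges_vlt[OF l val(1)] val(2)
    proof eventually_elim
      case (elim x)
      then show False using veq_vlt(2)[OF elim(2)] \<open>l = \<^bold>0\<close> by simp
    qed
    then show False using near0_happens by blast
  qed
  then show ?thesis using l by blast
qed

lemma asymptotic_endomorphism:
  assumes f: "dfun (\<lambda>e. f (e 0))" and nz: "\<And>x. x \<noteq> \<^bold>0 \<Longrightarrow> f x \<noteq> \<^bold>0"
    and complete: "definably_complete L M"
  shows "\<exists>g c. dfun (\<lambda>e. g (e 0)) \<and> (\<forall>a. a \<noteq> \<^bold>0 \<longrightarrow> g a \<noteq> \<^bold>0) \<and>
    (\<forall>a b. a \<noteq> \<^bold>0 \<longrightarrow> b \<noteq> \<^bold>0 \<longrightarrow> g (a \<^bold>* b) = g a \<^bold>* g b) \<and> c \<noteq> \<^bold>0 \<and>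
    converges (\<lambda>x. f x \<^bold>/ g x) c"
proof -
  note f' [dfn] = dfun_apply[OF f]
  \<comment> \<open>The value 1 at 0 is a placeholder that makes \<open>g\<close> total.\<close>
  define g where "g a = (if a = \<^bold>0 then \<^bold>1 else THE l. converges (\<lambda>x. f (a \<^bold>* x) \<^bold>/ f x) l)" for a
  have g: "g a \<noteq> \<^bold>0 \<and> converges (\<lambda>x. f (a \<^bold>* x) \<^bold>/ f x) (g a)" if a: "a \<noteq> \<^bold>0" for a
  proof -
    have h: "dfun (\<lambda>e. f (a \<^bold>* e 0) \<^bold>/ f (e 0))" by (intro dfn)
    obtain e where "e \<noteq> \<^bold>0" "eventually (\<lambda>x. f (a \<^bold>* x) \<^bold>/ f x \<asymp> e) near0"
      using ratio_val_const[OF f nz a] by blast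
    from nonzero_limit[where F = "\<lambda>x. f (a \<^bold>* x) \<^bold>/ f x", OF h complete this]
    obtain l where l: "l \<noteq> \<^bold>0" "converges (\<lambda>x. f (a \<^bold>* x) \<^bold>/ f x) l" by blast
    then have "g a = l"
      unfolding g_def using a converges_unique by (simp add: the_equality)
    then show ?thesis using l by simp
  qed
  \<comment> \<open>Uniqueness of limits removes the description operator and gives a first-order
    formula for the graph of \<open>g\<close>.\<close>
  have g_iff: "l = g a \<longleftrightarrow> (if a = \<^bold>0 then l = \<^bold>1 else converges (\<lambda>x. f (a \<^bold>* x) \<^bold>/ f x) l)" for a l
  proof (cases "a = \<^bold>0")
    case False
    then show ?thesis using g[OF False] converges_unique by auto
  qed (simp add: g_def)
  have "dpred (\<lambda>e. if e 1 = \<^bold>0 then e 0 = \<^bold>1 else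
      \<forall>r. r \<noteq> \<^bold>0 \<longrightarrow> eventually (\<lambda>x. r \<preceq> f (e 1 \<^bold>* x) \<^bold>/ f x \<^bold>- e 0) near0)"
    by (intro dfn)
  then have dg: "dfun (\<lambda>e. g (e 0))"
    unfolding dfun_def g_iff converges_def by (simp only: One_nat_def)
  note g' [dfn] = dfun_apply[OF dg]
  have g_mult: "g (a \<^bold>* b) = g a \<^bold>* g b" if a: "a \<noteq> \<^bold>0" and b: "b \<noteq> \<^bold>0" for a b
  proof -
    \<comment> \<open>f(abx)/f(x) telescopes through f(bx), and replacing \<open>x\<close> by bx
      does not affect the first limit.\<close>
    have "converges (\<lambda>x. (f (a \<^bold>* (b \<^bold>* x)) \<^bold>/ f (b \<^bold>* x)) \<^bold>* (f (b \<^bold>* x) \<^bold>/ f x)) (g a \<^bold>* g b)"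
      using g[OF a] g[OF b] by (intro converges_mult converges_scale[OF _ b]) blast+
    moreover have "eventually (\<lambda>x. (f (a \<^bold>* (b \<^bold>* x)) \<^bold>/ f (b \<^bold>* x)) \<^bold>* (f (b \<^bold>* x) \<^bold>/ f x) =
        f (a \<^bold>* b \<^bold>* x) \<^bold>/ f x) near0"
      using eventually_near0_nonzero
    proof (rule eventually_mono)
      fix x assume "x \<noteq> \<^bold>0"
      then have "f (b \<^bold>* x) \<noteq> \<^bold>0" using nz b by simp
      then show "(f (a \<^bold>* (b \<^bold>* x)) \<^bold>/ f (b \<^bold>* x)) \<^bold>* (f (b \<^bold>* x) \<^bold>/ f x) = f (a \<^bold>* b \<^bold>* x) \<^bold>/ f x"
        by (simp only: divide_chain fld.mult_assoc[of a b x] not_False_eq_True)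
    qed
    ultimately have "converges (\<lambda>x. f (a \<^bold>* b \<^bold>* x) \<^bold>/ f x) (g a \<^bold>* g b)" by (rule converges_cong)
    moreover have "a \<^bold>* b \<noteq> \<^bold>0" using a b by simp
    ultimately show ?thesis using g converges_unique by blast
  qed
  let ?F = "\<lambda>x. f x \<^bold>/ g x"
  have F: "dfun (\<lambda>e. ?F (e 0))" by (intro dfn)
  have F_nz: "?F x \<noteq> \<^bold>0" if "x \<noteq> \<^bold>0" for x using nz g that by simp
  \<comment> \<open>With F = f/g, the ratio F(ux)/F(x) is f(ux)/f(x) divided by g(u), so its leading
    term is eventually that of 1.\<close>
  have "\<exists>d. d \<noteq> \<^bold>0 \<and> (\<forall>u x. unit u \<longrightarrow> x \<noteq> \<^bold>0 \<longrightarrow> d \<prec> x \<longrightarrow> ?F (u \<^bold>* x) \<approx> ?F x)"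
  proof (rule uniform_near0)
    show "dpred (\<lambda>e. ?F (e 0 \<^bold>* e 1) \<approx> ?F (e 1))" by (intro dfn)
    show "?F (u \<^bold>* w \<^bold>* x) \<approx> ?F x" if "?F (u \<^bold>* (w \<^bold>* x)) \<approx> ?F (w \<^bold>* x)" "?F (w \<^bold>* x) \<approx> ?F x" for u w x
      unfolding fld.mult_assoc by (rule rveq_trans[OF that])
    show "eventually (\<lambda>u. eventually (\<lambda>x. ?F (u \<^bold>* x) \<approx> ?F x) near0) genr"
      using eventually_genr_unit
    proof (rule eventually_mono)
      fix u assume "unit u"
      then have u: "u \<noteq> \<^bold>0" by (rule unit_nonzero)
      have "eventually (\<lambda>x. f (u \<^bold>* x) \<^bold>/ f x \<approx> g u) near0"
        using converges_rveq g[OF u] by blast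
      then show "eventually (\<lambda>x. ?F (u \<^bold>* x) \<approx> ?F x) near0"
        using eventually_near0_nonzero
      proof eventually_elim
        case (elim x)
        have nzs: "f x \<noteq> \<^bold>0" "g u \<noteq> \<^bold>0" "g x \<noteq> \<^bold>0" using nz g u elim(2) by blast+
        then have "f x \<^bold>/ (g u \<^bold>* g x) \<noteq> \<^bold>0" by simp
        then have "(f (u \<^bold>* x) \<^bold>/ f x) \<^bold>* (f x \<^bold>/ (g u \<^bold>* g x)) \<approx> g u \<^bold>* (f x \<^bold>/ (g u \<^bold>* g x))"
          using elim(1) rveq_mult_right by blast
        moreover have "g u \<^bold>* (f x \<^bold>/ (g u \<^bold>* g x)) = ?F x" using nzs by simp
        ultimately show ?case
          by (simp only: divide_chain[OF nzs(1)] g_mult[OF u elim(2)])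
      qed
    qed
  qed
  then obtain d where "d \<noteq> \<^bold>0" "\<And>u x. unit u \<Longrightarrow> x \<noteq> \<^bold>0 \<Longrightarrow> d \<prec> x \<Longrightarrow> ?F (u \<^bold>* x) \<approx> ?F x" by blast
  from eventually_val_const[where F = ?F, OF F F_nz this]
  obtain e where "e \<noteq> \<^bold>0" "eventually (\<lambda>x. ?F x \<asymp> e) near0" by blast
  from nonzero_limit[where F = ?F, OF F complete this] obtain c where "c \<noteq> \<^bold>0" "converges ?F c" by blast
  then show ?thesis using dg g g_mult by blast
qed

section \<open>The valuation topology and definable maps on the multiplicative group\<close>

lemma openin_open_ball: "c \<noteq> \<^bold>0 \<Longrightarrow> openin (valuation_topology L M) (open_ball L M a c)"
  unfolding valuation_topology_def openin_topology_generated_by_iff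
  by (rule generate_topology_on.Basis) (auto simp: zer_def)

text \<open>Induction over the generation of the open set. For a ball containing \<open>l\<close>,
  its centre can be replaced by \<open>l\<close> without changing the radius.\<close>

lemma converges_generated_open:
  assumes "generate_topology_on {open_ball L M a c | a c. c \<noteq> \<zero>\<^bsub>K\<^esub>} U" "l \<in> U" "converges F l"
  shows "eventually (\<lambda>x. F x \<in> U) near0"
  using assms(1,2)
proof (induction rule: generate_topology_on.induct)
  case (Int A B)
  then show ?case by (auto intro: eventually_conj)
next
  case (UN \<K>)
  then obtain k where k: "k \<in> \<K>" "l \<in> k" by blast
  from UN.IH[OF k] show ?case by (rule eventually_mono) (use k(1) in blast)
next
  case (Basis s)
  then obtain a c where s: "s = open_ball L M a c" "c \<noteq> \<^bold>0" by (auto simp: zer_def)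
  then have l: "c \<prec> l \<^bold>- a" using Basis by (simp add: open_ball_iff)
  show ?case
    using converges_vlt[OF assms(3) s(2)]
    by (rule eventually_mono) (use vlt_sub_trans[OF _ l] in \<open>simp add: s(1) open_ball_iff\<close>)
qed simp

lemma converges_limitin:
  assumes "converges F l" "eventually (\<lambda>x. F x = G x) near0"
  shows "limitin (valuation_topology L M) G l (atin (valuation_topology L M) \<^bold>0)"
  unfolding limitin_def
proof (intro conjI allI impI)
  let ?T = "valuation_topology L M"
  have "l \<in> open_ball L M l \<^bold>1" by (simp add: open_ball_iff)
  then show "l \<in> topspace ?T"
    using openin_subset[OF openin_open_ball[of "\<^bold>1" l]] fld.one_neq_zero by blast
  fix U assume "openin ?T U \<and> l \<in> U"
  then have "generate_topology_on {open_ball L M a c | a c. c \<noteq> \<zero>\<^bsub>K\<^esub>} U" "l \<in> U"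
    by (simp_all add: valuation_topology_def openin_topology_generated_by_iff)
  from converges_generated_open[OF this converges_cong[OF assms]]
  obtain d where d: "d \<noteq> \<^bold>0" "\<And>x. x \<noteq> \<^bold>0 \<Longrightarrow> d \<prec> x \<Longrightarrow> G x \<in> U"
    unfolding eventually_near0 by blast
  show "eventually (\<lambda>x. G x \<in> U) (atin ?T \<^bold>0)"
    unfolding eventually_atin
  proof (intro disjI2 exI[of _ "open_ball L M \<^bold>0 d"] conjI ballI)
    show "openin ?T (open_ball L M \<^bold>0 d)" by (rule openin_open_ball[OF d(1)])
    show "\<^bold>0 \<in> open_ball L M \<^bold>0 d" using d(1) by (simp add: open_ball_iff)
    show "G x \<in> U" if "x \<in> open_ball L M \<^bold>0 d - {\<^bold>0}" for x
      using d(2) that by (simp add: open_ball_iff)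
  qed
qed

text \<open>Definability of a map on the multiplicative group says nothing about its value at 0, so
  1 is put there to obtain a definable total function.\<close>

lemma definable_map_dfun:
  assumes "definable_map L M (carrier (mult_group L M)) f"
  shows "dfun (\<lambda>e. if e 0 = \<^bold>0 then \<^bold>1 else f (e 0))"
proof -
  let ?S = "{[x, f x] | x. x \<in> carrier (mult_group L M)}"
  have "dpred (\<lambda>e. map e [0..<2] \<in> ?S)"
    by (rule dpred_definable) (use assms in \<open>simp add: definable_map_def\<close>)
  moreover have "map e [0..<2] \<in> ?S \<longleftrightarrow> e 0 \<noteq> \<^bold>0 \<and> e 1 = f (e 0)" for e
    by (auto simp: zer_def upt_rec)
  ultimately have "dpred (\<lambda>e. e 0 \<noteq> \<^bold>0 \<and> e 1 = f (e 0))" by simp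
  from dpred_rename[OF this, of "transpose 0 1"]
  have [dfn]: "dpred (\<lambda>e. e 1 \<noteq> \<^bold>0 \<and> e 0 = f (e 1))" by (simp add: transpose_def)
  have "dpred (\<lambda>e. if e 1 = \<^bold>0 then e 0 = \<^bold>1 else e 1 \<noteq> \<^bold>0 \<and> e 0 = f (e 1))" by (intro dfn)
  moreover have "(if e 1 = \<^bold>0 then e 0 = \<^bold>1 else e 1 \<noteq> \<^bold>0 \<and> e 0 = f (e 1)) \<longleftrightarrow>
      e 0 = (if e 1 = \<^bold>0 then \<^bold>1 else f (e 1))" for e :: "nat \<Rightarrow> 'a" by simp
  ultimately show ?thesis unfolding dfun_def by (simp only: One_nat_def)
qed

lemma dfun_definable_map:
  assumes "dfun (\<lambda>e. g (e 0))"
  shows "definable_map L M (carrier (mult_group L M)) g"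
proof -
  note g [dfn] = dfun_apply[OF assms]
  have "dpred (\<lambda>e. e 0 \<noteq> \<^bold>0 \<and> e 1 = g (e 0))" by (intro dfn)
  then have "\<exists>A. finite A \<and> definable_over L M A 2 {[x, g x] | x. x \<in> carrier (mult_group L M)}"
    by (rule definable_dpred) (auto simp: zer_def upt_rec)
  then show ?thesis unfolding definable_map_def using definable_over_mono[OF _ subset_UNIV] by blast
qed

end

theorem theorem7p4:
  fixes L :: "('f, 'r) vf_signature"
    and T :: "('f, 'r) fo_form set"
    and M :: "('f, 'r, 'a) fo_struct"
    and t :: 'f
    and f :: "'a \<Rightarrow> 'a"
  defines "K \<equiv> field_of L M"
  assumes language: "contains_vf_language L"
    and complete: "complete_theory TYPE('a) L T"
    and C_minimal_expansion: "C_minimal_ACVF_theory TYPE('a) L T"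
    and model: "M \<Turnstile> T"
    and monster: "monster L M"
    and t_constant: "fun_ar L t = 0"
    and t_nonzero: "fun_int M t [] \<noteq> \<zero>\<^bsub>K\<^esub>"
    and t_positive: "val_less L M \<one>\<^bsub>K\<^esub> (fun_int M t [])"
    and def_complete: "definably_complete L M"
    and f_maps: "f \<in> carrier (mult_group L M) \<rightarrow> carrier (mult_group L M)"
    and f_definable: "definable_map L M (carrier (mult_group L M)) f"
  shows "\<exists>g c. g \<in> hom (mult_group L M) (mult_group L M) \<and>
    definable_map L M (carrier (mult_group L M)) g \<and>
    c \<in> carrier (mult_group L M) \<and>
    limitin (valuation_topology L M) (\<lambda>x. f x \<otimes>\<^bsub>K\<^esub> inv\<^bsub>K\<^esub> g x) c
      (atin (valuation_topology L M) \<zero>\<^bsub>K\<^esub>)"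
proof -
  have "is_ACVF L M" "C_minimal L M"
    using C_minimal_expansion model unfolding C_minimal_ACVF_theory_def by blast+
  moreover have "\<exists>\<kappa>. natLeq <o \<kappa> \<and> saturated L \<kappa> M"
    using monster unfolding monster_def by blast
  ultimately interpret C_minimal_field L M
    using language by unfold_locales
  let ?f = "\<lambda>x. if x = \<^bold>0 then \<^bold>1 else f x"
  have f_nz: "?f x \<noteq> \<^bold>0" if "x \<noteq> \<^bold>0" for x
    using funcset_mem[OF f_maps, of x] that by (simp add: zer_def)
  obtain g c where g: "dfun (\<lambda>e. g (e 0))" "\<And>a. a \<noteq> \<^bold>0 \<Longrightarrow> g a \<noteq> \<^bold>0"
      "\<And>a b. a \<noteq> \<^bold>0 \<Longrightarrow> b \<noteq> \<^bold>0 \<Longrightarrow> g (a \<^bold>* b) = g a \<^bold>* g b"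
    and c: "c \<noteq> \<^bold>0" "converges (\<lambda>x. ?f x \<^bold>/ g x) c"
    using asymptotic_endomorphism[where f = ?f, OF definable_map_dfun[OF f_definable] f_nz def_complete] by blast
  have "g \<in> hom (mult_group L M) (mult_group L M)"
    using g(2,3) by (auto simp: hom_def zer_def mul_def)
  moreover have "eventually (\<lambda>x. ?f x \<^bold>/ g x = f x \<otimes>\<^bsub>K\<^esub> inv\<^bsub>K\<^esub> g x) near0"
    using eventually_near0_nonzero
    by (rule eventually_mono) (simp add: g(2) dvs_def inv'_def mul_def K_def)
  from converges_limitin[OF c(2) this]
  have "limitin (valuation_topology L M) (\<lambda>x. f x \<otimes>\<^bsub>K\<^esub> inv\<^bsub>K\<^esub> g x) c
      (atin (valuation_topology L M) \<zero>\<^bsub>K\<^esub>)"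
    by (simp add: zer_def K_def)
  ultimately show ?thesis
    using dfun_definable_map[OF g(1)] c(1) by (auto simp: zer_def)
qed

end
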